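(* The system $\mathsf{RCA}_0^{\omega}$ proves the implication $\mathsf{STS}^{+}\rightarrow\mathsf{cocode}_0$. Here $\mathsf{STS}^{+}$ is the statement: "for any $M\subseteq[0,1]$, if $(M,d)$ is a countably-compact metric space, then it is separable"; and $\mathsf{cocode}_0$ is the statement: "for any non-empty countable set $A\subseteq[0,1]$, there is a sequence $(x_n)_{n\in\mathbb N}$ in $A$ such that $(\forall x\in\mathbb R)(x\in A\leftrightarrow(\exists n\in\mathbb N)(x_n=_{\mathbb R}x))$".
   Context: Language and base theory. The finite types are generated by: $0$ is a type, and if $\sigma,\tau$ are types then so is $\sigma\to\tau$. Type $0$ is the type of natural numbers, $1:=0\to0$, $n+1:=n\to0$. The language $\mathsf{L}_\omega$ of higher-order arithmetic has variables of all finite types, the constants $0,1,<_0,+_0,\times_0,=_0$ on type $0$, combinators, and recursor constants $\mathbf{R}_\sigma$ for each type $\sigma$. Equality at type $\tau=(\tau_1\to\dots\to\tau_k\to0)$ is defined by $x=_\tau y\equiv(\forall z_1^{\tau_1}\dots z_k^{\tau_k})(xz_1\dots z_k=_0yz_1\dots z_k)$. The theory $\mathsf{RCA}_0^\omega$ (Kohlenbach's base theory of higher-order Reverse Mathematics, with classical logic) consists of: (a) axioms that $0,1,<_0,+_0,\times_0$ form an ordered semi-ring with equality $=_0$; (b) the defining axioms of the $\Pi$ and $\Sigma$ combinators (i.e. $K$ and $S$), giving $\lambda$-abstraction in all types; (c) the axiom for $\mathbf{R}_0$: $\mathbf{R}_0(f,m,0)=m$, $\mathbf{R}_0(f,m,n+1)=f(n,\mathbf{R}_0(f,m,n))$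 for $m^0,f^1$ (with pairs of numbers coded); (d) extensionality: $x=_\rho y\to\varphi(x)=_\tau\varphi(y)$ for all $x^\rho,y^\rho,\varphi^{\rho\to\tau}$ and all types $\rho,\tau$; (e) induction for quantifier-free formulas of $\mathsf{L}_\omega$ (with parameters of any type); (f) $\mathsf{QF\text{-}AC}^{1,0}$, where for types $\sigma,\tau$ the schema $\mathsf{QF\text{-}AC}^{\sigma,\tau}$ is $(\forall x^\sigma)(\exists y^\tau)A(x,y)\to(\exists Y^{\sigma\to\tau})(\forall x^\sigma)A(x,Y(x))$ for quantifier-free $A$. Reals, functions, sets. Real numbers are coded by sequences of rationals $(q_n)$ with $|q_n-q_{n+i}|<2^{-n}$ for all $n,i$; $x=_{\mathbb R}y$ for reals coded by $(q_n),(r_n)$ means $|q_n-r_n|\le2^{-n+1}$ for all $n$, and $<_{\mathbb R}$ is defined similarly. Functions on $\mathbb{R}$ or $[0,1]$ (with values in $\mathbb R$ or $\mathbb N$) are functionals on codes that map $=_{\mathbb R}$-equal reals to equal values. A set $A\subseteq\mathbb R$ is given by its characteristic function $F_A:\mathbb R\to\{0,1\}$, and $x\in A$ means $F_A(x)=1$. A set $A\subseteq\mathbb R$ is countable if there is $Y:\mathbb R\to\mathbb N$ such that $(\forall x,y\in A)(Y(x)=_0Y(y)\to x=_{\mathbb R}y)$. Metric spaces. For $M\subseteq[0,1]$, with equality $=_M$ on $M$ being $=_{\mathbb R}$, a functional $d:M^2\to\mathbb R$ (respecting $=_M$ in both arguments) is a metric on $M$ if for all $x,y,z\in M$: $d(x,y)=_{\mathbb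 R}0\leftrightarrow x=_My$; $0\le_{\mathbb R}d(x,y)=_{\mathbb R}d(y,x)$; $d(x,y)\le_{\mathbb R}d(x,z)+d(z,y)$. The metric $d$ is arbitrary, not necessarily related to the Euclidean metric. $B_d^M(x,r):=\{y\in M:d(x,y)<r\}$. $(M,d)$ is countably-compact if for any sequence $(a_n)_{n\in\mathbb N}$ in $M$ and any sequence of rationals $(r_n)_{n\in\mathbb N}$ with $M\subset\bigcup_{n\in\mathbb N}B_d^M(a_n,r_n)$, there is $m\in\mathbb N$ with $M\subset\bigcup_{n\le m}B_d^M(a_n,r_n)$. $(M,d)$ is separable if there is a sequence $(x_n)_{n\in\mathbb N}$ in $M$ such that $(\forall x\in M,k\in\mathbb N)(\exists n\in\mathbb N)(d(x,x_n)<\frac1{2^k})$. *)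

theory Defs
  imports Main
begin

section \<open>The language of higher-order arithmetic\<close>

datatype ty = T0 | Fn ty ty  (infixr "\<^bold>\<rightarrow>" 70)

abbreviation T1 :: ty where "T1 \<equiv> T0 \<^bold>\<rightarrow> T0"

text \<open>A variable is identified by its name together with its type.\<close>

type_synonym var = "string \<times> ty"

text \<open>Locally nameless syntax: \<open>V\<close> is a named (free) variable, \<open>Bound i\<close> refers to the \<open>i\<close>-th
  enclosing quantifier. There is no binder inside terms, since lambda abstraction is defined from
  the combinators. \<open>Rec \<sigma>\<close> is the recursor constant of type \<open>\<sigma>\<close>.\<close>

datatype tm =
    V var
  | Bound nat
  | Zero
  | One
  | Plus
  | Times
  | Pi_c ty ty
  | Sigma_c ty ty ty
  | Rec ty
  | App tm tm  (infixl "\<^bold>\<cdot>" 90)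

text \<open>The relation constants \<open>=\<^sub>0\<close> and \<open><\<^sub>0\<close> form the prime formulas.\<close>

datatype fm =
    Eq tm tm  (infix "\<^bold>=" 50)
  | Less tm tm  (infix "\<^bold><" 50)
  | Falsum
  | Imp fm fm  (infixr "\<^bold>\<longrightarrow>" 25)
  | Forall ty fm

definition Neg :: "fm \<Rightarrow> fm"  ("\<^bold>\<not> _" [40] 40)
  where "(\<^bold>\<not> \<phi>) = (\<phi> \<^bold>\<longrightarrow> Falsum)"

definition Disj :: "fm \<Rightarrow> fm \<Rightarrow> fm"  (infixr "\<^bold>\<or>" 30)
  where "(\<phi> \<^bold>\<or> \<psi>) = (\<^bold>\<not> \<phi> \<^bold>\<longrightarrow> \<psi>)"

definition Conj :: "fm \<Rightarrow> fm \<Rightarrow> fm"  (infixr "\<^bold>\<and>" 35)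
  where "(\<phi> \<^bold>\<and> \<psi>) = (\<^bold>\<not> (\<phi> \<^bold>\<longrightarrow> \<^bold>\<not> \<psi>))"

definition Iff :: "fm \<Rightarrow> fm \<Rightarrow> fm"  (infixr "\<^bold>\<longleftrightarrow>" 25)
  where "(\<phi> \<^bold>\<longleftrightarrow> \<psi>) = ((\<phi> \<^bold>\<longrightarrow> \<psi>) \<^bold>\<and> (\<psi> \<^bold>\<longrightarrow> \<phi>))"

definition Exists :: "ty \<Rightarrow> fm \<Rightarrow> fm"
  where "Exists \<sigma> \<phi> = (\<^bold>\<not> Forall \<sigma> (\<^bold>\<not> \<phi>))"

text \<open>Typing; the list \<open>E\<close> gives the types of the enclosing quantifiers, innermost first.\<close>

fun typ_of :: "ty list \<Rightarrow> tm \<Rightarrow> ty option"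
  where
    "typ_of E (V v) = Some (snd v)"
  | "typ_of E (Bound i) = (if i < length E then Some (E ! i) else None)"
  | "typ_of E Zero = Some T0"
  | "typ_of E One = Some T0"
  | "typ_of E Plus = Some (T0 \<^bold>\<rightarrow> T0 \<^bold>\<rightarrow> T0)"
  | "typ_of E Times = Some (T0 \<^bold>\<rightarrow> T0 \<^bold>\<rightarrow> T0)"
  | "typ_of E (Pi_c \<sigma> \<tau>) = Some (\<sigma> \<^bold>\<rightarrow> \<tau> \<^bold>\<rightarrow> \<sigma>)"
  | "typ_of E (Sigma_c \<rho> \<sigma> \<tau>) =
      Some ((\<rho> \<^bold>\<rightarrow> \<sigma> \<^bold>\<rightarrow> \<tau>) \<^bold>\<rightarrow> (\<rho> \<^bold>\<rightarrow> \<sigma>) \<^bold>\<rightarrow> \<rho> \<^bold>\<rightarrow> \<tau>)"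
  | "typ_of E (Rec \<sigma>) = Some ((T0 \<^bold>\<rightarrow> \<sigma> \<^bold>\<rightarrow> \<sigma>) \<^bold>\<rightarrow> \<sigma> \<^bold>\<rightarrow> T0 \<^bold>\<rightarrow> \<sigma>)"
  | "typ_of E (s \<^bold>\<cdot> t) =
      (case (typ_of E s, typ_of E t) of
         (Some (\<sigma> \<^bold>\<rightarrow> \<tau>), Some \<sigma>') \<Rightarrow> if \<sigma> = \<sigma>' then Some \<tau> else None
       | _ \<Rightarrow> None)"

fun wf_fm :: "ty list \<Rightarrow> fm \<Rightarrow> bool"
  where
    "wf_fm E (s \<^bold>= t) \<longleftrightarrow> typ_of E s = Some T0 \<and> typ_of E t = Some T0"
  | "wf_fm E (s \<^bold>< t) \<longleftrightarrow> typ_of E s = Some T0 \<and> typ_of E t = Some T0"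
  | "wf_fm E Falsum \<longleftrightarrow> True"
  | "wf_fm E (\<phi> \<^bold>\<longrightarrow> \<psi>) \<longleftrightarrow> wf_fm E \<phi> \<and> wf_fm E \<psi>"
  | "wf_fm E (Forall \<sigma> \<phi>) \<longleftrightarrow> wf_fm (\<sigma> # E) \<phi>"

fun quantifier_free :: "fm \<Rightarrow> bool"
  where
    "quantifier_free (\<phi> \<^bold>\<longrightarrow> \<psi>) \<longleftrightarrow> quantifier_free \<phi> \<and> quantifier_free \<psi>"
  | "quantifier_free (Forall \<sigma> \<phi>) \<longleftrightarrow> False"
  | "quantifier_free \<phi> \<longleftrightarrow> True"

fun vars_tm :: "tm \<Rightarrow> var set"
  where
    "vars_tm (V v) = {v}"
  | "vars_tm (s \<^bold>\<cdot> t) = vars_tm s \<union> vars_tm t"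
  | "vars_tm t = {}"

fun vars_fm :: "fm \<Rightarrow> var set"
  where
    "vars_fm (s \<^bold>= t) = vars_tm s \<union> vars_tm t"
  | "vars_fm (s \<^bold>< t) = vars_tm s \<union> vars_tm t"
  | "vars_fm Falsum = {}"
  | "vars_fm (\<phi> \<^bold>\<longrightarrow> \<psi>) = vars_fm \<phi> \<union> vars_fm \<psi>"
  | "vars_fm (Forall \<sigma> \<phi>) = vars_fm \<phi>"

text \<open>\<open>inst_fm 0 u \<phi>\<close> instantiates the body \<open>\<phi>\<close> of a quantifier with the term \<open>u\<close>. It is only used
  for \<open>u\<close> without \<open>Bound\<close>, so that nothing in \<open>u\<close> needs to be shifted.\<close>

fun inst_tm :: "nat \<Rightarrow> tm \<Rightarrow> tm \<Rightarrow> tm"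
  where
    "inst_tm k u (Bound i) = (if i = k then u else Bound i)"
  | "inst_tm k u (s \<^bold>\<cdot> t) = inst_tm k u s \<^bold>\<cdot> inst_tm k u t"
  | "inst_tm k u t = t"

fun inst_fm :: "nat \<Rightarrow> tm \<Rightarrow> fm \<Rightarrow> fm"
  where
    "inst_fm k u (s \<^bold>= t) = (inst_tm k u s \<^bold>= inst_tm k u t)"
  | "inst_fm k u (s \<^bold>< t) = (inst_tm k u s \<^bold>< inst_tm k u t)"
  | "inst_fm k u Falsum = Falsum"
  | "inst_fm k u (\<phi> \<^bold>\<longrightarrow> \<psi>) = (inst_fm k u \<phi> \<^bold>\<longrightarrow> inst_fm k u \<psi>)"
  | "inst_fm k u (Forall \<sigma> \<phi>) = Forall \<sigma> (inst_fm (Suc k) u \<phi>)"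

fun subst_tm :: "var \<Rightarrow> tm \<Rightarrow> tm \<Rightarrow> tm"
  where
    "subst_tm v u (V w) = (if w = v then u else V w)"
  | "subst_tm v u (s \<^bold>\<cdot> t) = subst_tm v u s \<^bold>\<cdot> subst_tm v u t"
  | "subst_tm v u t = t"

fun subst_fm :: "var \<Rightarrow> tm \<Rightarrow> fm \<Rightarrow> fm"
  where
    "subst_fm v u (s \<^bold>= t) = (subst_tm v u s \<^bold>= subst_tm v u t)"
  | "subst_fm v u (s \<^bold>< t) = (subst_tm v u s \<^bold>< subst_tm v u t)"
  | "subst_fm v u Falsum = Falsum"
  | "subst_fm v u (\<phi> \<^bold>\<longrightarrow> \<psi>) = (subst_fm v u \<phi> \<^bold>\<longrightarrow> subst_fm v u \<psi>)"
  | "subst_fm v u (Forall \<sigma> \<phi>) = Forall \<sigma> (subst_fm v u \<phi>)"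

text \<open>Quantification over a named variable.\<close>

fun bind_fm :: "nat \<Rightarrow> var \<Rightarrow> fm \<Rightarrow> fm"
  where
    "bind_fm k v (s \<^bold>= t) = (subst_tm v (Bound k) s \<^bold>= subst_tm v (Bound k) t)"
  | "bind_fm k v (s \<^bold>< t) = (subst_tm v (Bound k) s \<^bold>< subst_tm v (Bound k) t)"
  | "bind_fm k v Falsum = Falsum"
  | "bind_fm k v (\<phi> \<^bold>\<longrightarrow> \<psi>) = (bind_fm k v \<phi> \<^bold>\<longrightarrow> bind_fm k v \<psi>)"
  | "bind_fm k v (Forall \<sigma> \<phi>) = Forall \<sigma> (bind_fm (Suc k) v \<phi>)"

definition all_v :: "var \<Rightarrow> fm \<Rightarrow> fm"
  where "all_v v \<phi> = Forall (snd v) (bind_fm 0 v \<phi>)"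

definition ex_v :: "var \<Rightarrow> fm \<Rightarrow> fm"
  where "ex_v v \<phi> = Exists (snd v) (bind_fm 0 v \<phi>)"

text \<open>Equality at higher types, \<open>s =\<^sub>\<sigma> t\<close>.\<close>

fun lift_tm :: "tm \<Rightarrow> tm"
  where
    "lift_tm (Bound i) = Bound (Suc i)"
  | "lift_tm (s \<^bold>\<cdot> t) = lift_tm s \<^bold>\<cdot> lift_tm t"
  | "lift_tm t = t"

fun eq_at :: "ty \<Rightarrow> tm \<Rightarrow> tm \<Rightarrow> fm"
  where
    "eq_at T0 s t = (s \<^bold>= t)"
  | "eq_at (\<sigma> \<^bold>\<rightarrow> \<tau>) s t = Forall \<sigma> (eq_at \<tau> (lift_tm s \<^bold>\<cdot> Bound 0) (lift_tm t \<^bold>\<cdot> Bound 0))"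

section \<open>Derivability in classical logic\<close>

text \<open>Natural deduction from open hypotheses \<open>\<Gamma>\<close> over a theory \<open>T\<close>. Free variables in a
  member of \<open>T\<close> are read as universally quantified: \<open>T\<close> is disregarded in the eigenvariable
  condition of \<open>All_I\<close>.\<close>

inductive derives :: "fm set \<Rightarrow> fm set \<Rightarrow> fm \<Rightarrow> bool" for T :: "fm set"
  where
    Ax: "\<phi> \<in> T \<Longrightarrow> wf_fm [] \<phi> \<Longrightarrow> derives T \<Gamma> \<phi>"
  | Hyp: "\<phi> \<in> \<Gamma> \<Longrightarrow> wf_fm [] \<phi> \<Longrightarrow> derives T \<Gamma> \<phi>"
  | Imp_I: "derives T (insert \<phi> \<Gamma>) \<psi> \<Longrightarrow> wf_fm [] \<phi> \<Longrightarrow> derives T \<Gamma> (\<phi> \<^bold>\<longrightarrow> \<psi>)"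
  | Imp_E: "derives T \<Gamma> (\<phi> \<^bold>\<longrightarrow> \<psi>) \<Longrightarrow> derives T \<Gamma> \<phi> \<Longrightarrow> derives T \<Gamma> \<psi>"
  | Classical: "derives T (insert (\<^bold>\<not> \<phi>) \<Gamma>) Falsum \<Longrightarrow> wf_fm [] \<phi> \<Longrightarrow> derives T \<Gamma> \<phi>"
  | All_I: "derives T \<Gamma> (inst_fm 0 (V v) \<phi>) \<Longrightarrow> v \<notin> vars_fm \<phi> \<Longrightarrow> \<forall>\<psi>\<in>\<Gamma>. v \<notin> vars_fm \<psi> \<Longrightarrow>
      wf_fm [] (Forall (snd v) \<phi>) \<Longrightarrow> derives T \<Gamma> (Forall (snd v) \<phi>)"
  | All_E: "derives T \<Gamma> (Forall \<sigma> \<phi>) \<Longrightarrow> typ_of [] t = Some \<sigma> \<Longrightarrow> derives T \<Gamma> (inst_fm 0 t \<phi>)"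

definition proves :: "fm set \<Rightarrow> fm \<Rightarrow> bool"  (infix "\<turnstile>" 20)
  where "(T \<turnstile> \<phi>) \<longleftrightarrow> derives T {} \<phi>"

section \<open>The theory \<open>RCA\<^sub>0\<^sup>\<omega>\<close>\<close>

abbreviation plus_tm :: "tm \<Rightarrow> tm \<Rightarrow> tm"  (infixl "\<^bold>+" 65)
  where "s \<^bold>+ t \<equiv> Plus \<^bold>\<cdot> s \<^bold>\<cdot> t"

abbreviation times_tm :: "tm \<Rightarrow> tm \<Rightarrow> tm"  (infixl "\<^bold>*" 70)
  where "s \<^bold>* t \<equiv> Times \<^bold>\<cdot> s \<^bold>\<cdot> t"

definition semiring_axioms :: "tm \<Rightarrow> tm \<Rightarrow> tm \<Rightarrow> fm set"
  where "semiring_axioms x y z = {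
    (x \<^bold>+ y) \<^bold>+ z \<^bold>= x \<^bold>+ (y \<^bold>+ z),
    x \<^bold>+ y \<^bold>= y \<^bold>+ x,
    x \<^bold>+ Zero \<^bold>= x,
    (x \<^bold>* y) \<^bold>* z \<^bold>= x \<^bold>* (y \<^bold>* z),
    x \<^bold>* y \<^bold>= y \<^bold>* x,
    x \<^bold>* One \<^bold>= x,
    x \<^bold>* Zero \<^bold>= Zero,
    x \<^bold>* (y \<^bold>+ z) \<^bold>= x \<^bold>* y \<^bold>+ x \<^bold>* z}"

definition order_axioms :: "tm \<Rightarrow> tm \<Rightarrow> tm \<Rightarrow> fm set"
  where "order_axioms x y z = {
    \<^bold>\<not> x \<^bold>< x,
    x \<^bold>< y \<^bold>\<longrightarrow> y \<^bold>< z \<^bold>\<longrightarrow> x \<^bold>< z,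
    x \<^bold>< y \<^bold>\<or> x \<^bold>= y \<^bold>\<or> y \<^bold>< x,
    Zero \<^bold>< One,
    x \<^bold>< y \<^bold>\<longrightarrow> x \<^bold>+ z \<^bold>< y \<^bold>+ z,
    x \<^bold>< y \<^bold>\<longrightarrow> Zero \<^bold>< z \<^bold>\<longrightarrow> x \<^bold>* z \<^bold>< y \<^bold>* z}"

text \<open>Congruence of \<open>=\<^sub>0\<close> with respect to function symbols is an instance of extensionality, so only
  congruence for \<open><\<^sub>0\<close> is listed.\<close>

definition equality_axioms :: "tm \<Rightarrow> tm \<Rightarrow> tm \<Rightarrow> fm set"
  where "equality_axioms x y z = {
    x \<^bold>= x,
    x \<^bold>= y \<^bold>\<longrightarrow> y \<^bold>= x,
    x \<^bold>= y \<^bold>\<longrightarrow> y \<^bold>= z \<^bold>\<longrightarrow> x \<^bold>= z,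
    x \<^bold>= y \<^bold>\<longrightarrow> x \<^bold>< z \<^bold>\<longrightarrow> y \<^bold>< z,
    x \<^bold>= y \<^bold>\<longrightarrow> z \<^bold>< x \<^bold>\<longrightarrow> z \<^bold>< y}"

definition induction_axiom :: "var \<Rightarrow> fm \<Rightarrow> fm"
  where "induction_axiom n A =
    (subst_fm n Zero A \<^bold>\<longrightarrow> all_v n (A \<^bold>\<longrightarrow> subst_fm n (V n \<^bold>+ One) A) \<^bold>\<longrightarrow> all_v n A)"

text \<open>The instance of \<open>QF-AC\<^sup>\<sigma>\<^sup>,\<^sup>\<tau>\<close> for \<open>A(x,y)\<close>, where \<open>\<sigma>\<close> and \<open>\<tau>\<close> are the types of \<open>x\<close> and \<open>y\<close>.\<close>

definition QF_AC_axiom :: "var \<Rightarrow> var \<Rightarrow> var \<Rightarrow> fm \<Rightarrow> fm"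
  where "QF_AC_axiom x y Y A =
    (all_v x (ex_v y A) \<^bold>\<longrightarrow> ex_v Y (all_v x (subst_fm y (V Y \<^bold>\<cdot> V x) A)))"

inductive_set RCA0_omega :: "fm set"
  where
    semiring: "\<phi> \<in> semiring_axioms (V (''x'', T0)) (V (''y'', T0)) (V (''z'', T0)) \<Longrightarrow>
      \<phi> \<in> RCA0_omega"
  | order: "\<phi> \<in> order_axioms (V (''x'', T0)) (V (''y'', T0)) (V (''z'', T0)) \<Longrightarrow> \<phi> \<in> RCA0_omega"
  | equality: "\<phi> \<in> equality_axioms (V (''x'', T0)) (V (''y'', T0)) (V (''z'', T0)) \<Longrightarrow>
      \<phi> \<in> RCA0_omega"
  | Pi_combinator: "eq_at \<sigma> (Pi_c \<sigma> \<tau> \<^bold>\<cdot> V (''x'', \<sigma>) \<^bold>\<cdot> V (''y'', \<tau>)) (V (''x'', \<sigma>)) \<in> RCA0_omega"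
  | Sigma_combinator: "x = V (''x'', \<rho> \<^bold>\<rightarrow> \<sigma> \<^bold>\<rightarrow> \<tau>) \<Longrightarrow> y = V (''y'', \<rho> \<^bold>\<rightarrow> \<sigma>) \<Longrightarrow> z = V (''z'', \<rho>) \<Longrightarrow>
      eq_at \<tau> (Sigma_c \<rho> \<sigma> \<tau> \<^bold>\<cdot> x \<^bold>\<cdot> y \<^bold>\<cdot> z) (x \<^bold>\<cdot> z \<^bold>\<cdot> (y \<^bold>\<cdot> z)) \<in> RCA0_omega"
  | Rec_zero: "f = V (''f'', T0 \<^bold>\<rightarrow> T0 \<^bold>\<rightarrow> T0) \<Longrightarrow> m = V (''m'', T0) \<Longrightarrow>
      (Rec T0 \<^bold>\<cdot> f \<^bold>\<cdot> m \<^bold>\<cdot> Zero \<^bold>= m) \<in> RCA0_omega"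
  | Rec_step: "f = V (''f'', T0 \<^bold>\<rightarrow> T0 \<^bold>\<rightarrow> T0) \<Longrightarrow> m = V (''m'', T0) \<Longrightarrow> n = V (''n'', T0) \<Longrightarrow>
      (Rec T0 \<^bold>\<cdot> f \<^bold>\<cdot> m \<^bold>\<cdot> (n \<^bold>+ One) \<^bold>= f \<^bold>\<cdot> n \<^bold>\<cdot> (Rec T0 \<^bold>\<cdot> f \<^bold>\<cdot> m \<^bold>\<cdot> n)) \<in> RCA0_omega"
  | extensionality: "x = V (''x'', \<rho>) \<Longrightarrow> y = V (''y'', \<rho>) \<Longrightarrow> f = V (''f'', \<rho> \<^bold>\<rightarrow> \<tau>) \<Longrightarrow>
      (eq_at \<rho> x y \<^bold>\<longrightarrow> eq_at \<tau> (f \<^bold>\<cdot> x) (f \<^bold>\<cdot> y)) \<in> RCA0_omega"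
  | QF_induction: "quantifier_free A \<Longrightarrow> wf_fm [] A \<Longrightarrow> snd n = T0 \<Longrightarrow>
      induction_axiom n A \<in> RCA0_omega"
  | QF_AC_1_0: "quantifier_free A \<Longrightarrow> wf_fm [] A \<Longrightarrow> snd x = T1 \<Longrightarrow> snd y = T0 \<Longrightarrow>
      snd Y = T1 \<^bold>\<rightarrow> T0 \<Longrightarrow> Y \<notin> vars_fm A \<Longrightarrow> QF_AC_axiom x y Y A \<in> RCA0_omega"

section \<open>Primitive recursive terms\<close>

text \<open>Lambda abstraction by combinators.\<close>

fun lam :: "var \<Rightarrow> tm \<Rightarrow> tm"
  where
    "lam v (V w) =
      (if w = v then Sigma_c (snd v) (snd v \<^bold>\<rightarrow> snd v) (snd v) \<^bold>\<cdot> Pi_c (snd v) (snd v \<^bold>\<rightarrow> snd v) \<^bold>\<cdot> Pi_c (snd v) (snd v)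
       else Pi_c (snd w) (snd v) \<^bold>\<cdot> V w)"
  | "lam v (s \<^bold>\<cdot> t) =
      (if v \<in> vars_tm (s \<^bold>\<cdot> t)
       then Sigma_c (snd v) (the (typ_of [] t)) (the (typ_of [] (s \<^bold>\<cdot> t))) \<^bold>\<cdot> lam v s \<^bold>\<cdot> lam v t
       else Pi_c (the (typ_of [] (s \<^bold>\<cdot> t))) (snd v) \<^bold>\<cdot> (s \<^bold>\<cdot> t))"
  | "lam v t = Pi_c (the (typ_of [] t)) (snd v) \<^bold>\<cdot> t"

abbreviation "vi \<equiv> (''i'', T0)"
abbreviation "vk \<equiv> (''k'', T0)"
abbreviation "vm \<equiv> (''m'', T0)"
abbreviation "vn \<equiv> (''n'', T0)"

definition pred_tm :: tm
  where "pred_tm = lam vn (Rec T0 \<^bold>\<cdot> lam vi (lam vk (V vi)) \<^bold>\<cdot> Zero \<^bold>\<cdot> V vn)"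

definition monus_tm :: tm
  where "monus_tm = lam vm (lam vn (Rec T0 \<^bold>\<cdot> lam vi (lam vk (pred_tm \<^bold>\<cdot> V vk)) \<^bold>\<cdot> V vm \<^bold>\<cdot> V vn))"

definition exp2_tm :: tm
  where "exp2_tm = lam vn (Rec T0 \<^bold>\<cdot> lam vi (lam vk (V vk \<^bold>+ V vk)) \<^bold>\<cdot> One \<^bold>\<cdot> V vn)"

text \<open>Triangular numbers, and the largest \<open>w\<close> whose triangular number is at most \<open>n\<close>.\<close>

definition tri_tm :: tm
  where "tri_tm = lam vn (Rec T0 \<^bold>\<cdot> lam vi (lam vk (V vk \<^bold>+ (V vi \<^bold>+ One))) \<^bold>\<cdot> Zero \<^bold>\<cdot> V vn)"

definition tri_root_tm :: tm
  where "tri_root_tm = lam vn (Rec T0 \<^bold>\<cdot>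
    lam vi (lam vk (V vk \<^bold>+ monus_tm \<^bold>\<cdot> One \<^bold>\<cdot> (monus_tm \<^bold>\<cdot> (tri_tm \<^bold>\<cdot> (V vk \<^bold>+ One)) \<^bold>\<cdot> (V vi \<^bold>+ One))))
    \<^bold>\<cdot> Zero \<^bold>\<cdot> V vn)"

text \<open>Cantor's bijective pairing and its projections.\<close>

definition pair :: "tm \<Rightarrow> tm \<Rightarrow> tm"
  where "pair s t = tri_tm \<^bold>\<cdot> (s \<^bold>+ t) \<^bold>+ t"

definition snd_tm :: tm
  where "snd_tm = lam vn (monus_tm \<^bold>\<cdot> V vn \<^bold>\<cdot> (tri_tm \<^bold>\<cdot> (tri_root_tm \<^bold>\<cdot> V vn)))"

definition fst_tm :: tm
  where "fst_tm = lam vn (monus_tm \<^bold>\<cdot> (tri_root_tm \<^bold>\<cdot> V vn) \<^bold>\<cdot> (snd_tm \<^bold>\<cdot> V vn))"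

section \<open>Rationals\<close>

text \<open>Every number codes a rational: \<open>\<langle>\<langle>a, b\<rangle>, c\<rangle>\<close> codes \<open>(a - b) / (c + 1)\<close>.\<close>

definition rat :: "tm \<Rightarrow> tm \<Rightarrow> tm \<Rightarrow> tm"
  where "rat a b c = pair (pair a b) c"

definition pos_part :: "tm \<Rightarrow> tm"
  where "pos_part q = fst_tm \<^bold>\<cdot> (fst_tm \<^bold>\<cdot> q)"

definition neg_part :: "tm \<Rightarrow> tm"
  where "neg_part q = snd_tm \<^bold>\<cdot> (fst_tm \<^bold>\<cdot> q)"

definition denom_pred :: "tm \<Rightarrow> tm"
  where "denom_pred q = snd_tm \<^bold>\<cdot> q"

definition denom :: "tm \<Rightarrow> tm"
  where "denom q = denom_pred q \<^bold>+ One"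

definition rat_less :: "tm \<Rightarrow> tm \<Rightarrow> fm"  (infix "<\<^sub>Q" 50)
  where "(q <\<^sub>Q r) =
    (pos_part q \<^bold>* denom r \<^bold>+ neg_part r \<^bold>* denom q \<^bold>< pos_part r \<^bold>* denom q \<^bold>+ neg_part q \<^bold>* denom r)"

definition rat_le :: "tm \<Rightarrow> tm \<Rightarrow> fm"  (infix "\<le>\<^sub>Q" 50)
  where "(q \<le>\<^sub>Q r) = (\<^bold>\<not> r <\<^sub>Q q)"

text \<open>The last component is \<open>(c + 1) (c' + 1) - 1\<close>.\<close>

definition rat_plus :: "tm \<Rightarrow> tm \<Rightarrow> tm"  (infixl "+\<^sub>Q" 65)
  where "q +\<^sub>Q r =
    rat (pos_part q \<^bold>* denom r \<^bold>+ pos_part r \<^bold>* denom q)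
        (neg_part q \<^bold>* denom r \<^bold>+ neg_part r \<^bold>* denom q)
        (denom_pred q \<^bold>* denom_pred r \<^bold>+ denom_pred q \<^bold>+ denom_pred r)"

definition rat_minus :: "tm \<Rightarrow> tm \<Rightarrow> tm"  (infixl "-\<^sub>Q" 65)
  where "q -\<^sub>Q r = q +\<^sub>Q rat (neg_part r) (pos_part r) (denom_pred r)"

text \<open>\<open>\<bar>a - b\<bar>\<close> is the sum of the two truncated differences.\<close>

definition rat_abs :: "tm \<Rightarrow> tm"
  where "rat_abs q =
    rat (monus_tm \<^bold>\<cdot> pos_part q \<^bold>\<cdot> neg_part q \<^bold>+ monus_tm \<^bold>\<cdot> neg_part q \<^bold>\<cdot> pos_part q) Zero (denom_pred q)"

text \<open>\<open>half_pow n\<close> is \<open>2\<^sup>-\<^sup>n\<close>, and \<open>double_half_pow n\<close> is \<open>2\<^sup>-\<^sup>n\<^sup>+\<^sup>1\<close>.\<close>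

definition half_pow :: "tm \<Rightarrow> tm"
  where "half_pow n = rat One Zero (pred_tm \<^bold>\<cdot> (exp2_tm \<^bold>\<cdot> n))"

definition double_half_pow :: "tm \<Rightarrow> tm"
  where "double_half_pow n = rat (One \<^bold>+ One) Zero (pred_tm \<^bold>\<cdot> (exp2_tm \<^bold>\<cdot> n))"

section \<open>Reals\<close>

text \<open>The argument terms of the formulas below must not contain \<open>Bound\<close>; outer quantifiers are
  introduced by \<^const>\<open>all_v\<close> and \<^const>\<open>ex_v\<close> only afterwards.\<close>

definition is_real :: "tm \<Rightarrow> fm"
  where "is_real x = Forall T0 (Forall T0
    (rat_abs (x \<^bold>\<cdot> Bound 1 -\<^sub>Q x \<^bold>\<cdot> (Bound 1 \<^bold>+ Bound 0)) <\<^sub>Q half_pow (Bound 1)))"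

definition real_eq :: "tm \<Rightarrow> tm \<Rightarrow> fm"  (infix "=\<^sub>R" 50)
  where "(x =\<^sub>R y) = Forall T0 (rat_abs (x \<^bold>\<cdot> Bound 0 -\<^sub>Q y \<^bold>\<cdot> Bound 0) \<le>\<^sub>Q double_half_pow (Bound 0))"

definition real_less :: "tm \<Rightarrow> tm \<Rightarrow> fm"  (infix "<\<^sub>R" 50)
  where "(x <\<^sub>R y) = Exists T0 (x \<^bold>\<cdot> Bound 0 +\<^sub>Q double_half_pow (Bound 0) <\<^sub>Q y \<^bold>\<cdot> Bound 0)"

definition real_le :: "tm \<Rightarrow> tm \<Rightarrow> fm"  (infix "\<le>\<^sub>R" 50)
  where "(x \<le>\<^sub>R y) = (\<^bold>\<not> y <\<^sub>R x)"

abbreviation "vx \<equiv> (''x'', T1)"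
abbreviation "vy \<equiv> (''y'', T1)"
abbreviation "vz \<equiv> (''z'', T1)"
abbreviation "vu \<equiv> (''u'', T1)"

text \<open>The index shift in the sum restores the rate of convergence.\<close>

definition real_plus_tm :: tm
  where "real_plus_tm = lam vx (lam vy (lam vn
    (V vx \<^bold>\<cdot> (V vn \<^bold>+ One) +\<^sub>Q V vy \<^bold>\<cdot> (V vn \<^bold>+ One))))"

definition real_plus :: "tm \<Rightarrow> tm \<Rightarrow> tm"  (infixl "+\<^sub>R" 65)
  where "x +\<^sub>R y = real_plus_tm \<^bold>\<cdot> x \<^bold>\<cdot> y"

text \<open>The constant sequence \<open>q\<close>.\<close>

definition real_of_rat :: "tm \<Rightarrow> tm"
  where "real_of_rat q = Pi_c T0 T0 \<^bold>\<cdot> q"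

definition real_zero :: tm  ("0\<^sub>R")
  where "0\<^sub>R = real_of_rat (rat Zero Zero Zero)"

definition real_one :: tm  ("1\<^sub>R")
  where "1\<^sub>R = real_of_rat (rat One Zero Zero)"

section \<open>Sets, countability and metric spaces\<close>

text \<open>A set is represented by its characteristic function \<open>F\<close> of type \<open>1 \<rightarrow> 0\<close>. The formulas below
  bind the names \<open>x\<close>, \<open>y\<close>, \<open>z\<close>, \<open>u\<close>, \<open>a\<close>, \<open>r\<close>, \<open>k\<close>, \<open>m\<close>, \<open>n\<close>, \<open>Y\<close>, hence are meant for arguments in which
  these do not occur.\<close>

definition extensional_on_reals :: "tm \<Rightarrow> fm"
  where "extensional_on_reals F = all_v vx (all_v vy
    (is_real (V vx) \<^bold>\<and> is_real (V vy) \<^bold>\<and> V vx =\<^sub>R V vy \<^bold>\<longrightarrow> F \<^bold>\<cdot> V vx \<^bold>= F \<^bold>\<cdot> V vy))"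

definition is_set :: "tm \<Rightarrow> fm"
  where "is_set F = (extensional_on_reals F \<^bold>\<and>
    all_v vx (is_real (V vx) \<^bold>\<longrightarrow> F \<^bold>\<cdot> V vx \<^bold>= Zero \<^bold>\<or> F \<^bold>\<cdot> V vx \<^bold>= One))"

definition mem :: "tm \<Rightarrow> tm \<Rightarrow> fm"  (infix "\<^bold>\<in>" 50)
  where "(x \<^bold>\<in> F) = (is_real x \<^bold>\<and> F \<^bold>\<cdot> x \<^bold>= One)"

definition all_in :: "var \<Rightarrow> tm \<Rightarrow> fm \<Rightarrow> fm"
  where "all_in v F \<phi> = all_v v (V v \<^bold>\<in> F \<^bold>\<longrightarrow> \<phi>)"

definition sub_unit_interval :: "tm \<Rightarrow> fm"
  where "sub_unit_interval F = all_in vx F (0\<^sub>R \<le>\<^sub>R V vx \<^bold>\<and> V vx \<le>\<^sub>R 1\<^sub>R)"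

definition nonempty :: "tm \<Rightarrow> fm"
  where "nonempty F = ex_v vx (V vx \<^bold>\<in> F)"

abbreviation "vY \<equiv> (''Y'', T1 \<^bold>\<rightarrow> T0)"

definition countable :: "tm \<Rightarrow> fm"
  where "countable F = ex_v vY (extensional_on_reals (V vY) \<^bold>\<and>
    all_in vx F (all_in vy F (V vY \<^bold>\<cdot> V vx \<^bold>= V vY \<^bold>\<cdot> V vy \<^bold>\<longrightarrow> V vx =\<^sub>R V vy)))"

text \<open>Sequences of reals have type \<open>0 \<rightarrow> 1\<close>.\<close>

definition sequence_in :: "tm \<Rightarrow> tm \<Rightarrow> fm"
  where "sequence_in a F = all_v vn (a \<^bold>\<cdot> V vn \<^bold>\<in> F)"

text \<open>The functional \<open>d\<close> has type \<open>1 \<rightarrow> 1 \<rightarrow> 1\<close>; only its values on \<open>M\<close> matter.\<close>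

definition real_functional_on :: "tm \<Rightarrow> tm \<Rightarrow> fm"
  where "real_functional_on M d =
    (all_in vx M (all_in vy M (is_real (d \<^bold>\<cdot> V vx \<^bold>\<cdot> V vy))) \<^bold>\<and>
     all_in vx M (all_in vy M (all_in vz M (all_in vu M
       (V vx =\<^sub>R V vz \<^bold>\<and> V vy =\<^sub>R V vu \<^bold>\<longrightarrow> d \<^bold>\<cdot> V vx \<^bold>\<cdot> V vy =\<^sub>R d \<^bold>\<cdot> V vz \<^bold>\<cdot> V vu)))))"

definition metric :: "tm \<Rightarrow> tm \<Rightarrow> fm"
  where "metric M d = (real_functional_on M d \<^bold>\<and>
    all_in vx M (all_in vy M (all_in vz M
      ((d \<^bold>\<cdot> V vx \<^bold>\<cdot> V vy =\<^sub>R 0\<^sub>R \<^bold>\<longleftrightarrow> V vx =\<^sub>R V vy) \<^bold>\<and>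
       (0\<^sub>R \<le>\<^sub>R d \<^bold>\<cdot> V vx \<^bold>\<cdot> V vy \<^bold>\<and> d \<^bold>\<cdot> V vx \<^bold>\<cdot> V vy =\<^sub>R d \<^bold>\<cdot> V vy \<^bold>\<cdot> V vx) \<^bold>\<and>
       d \<^bold>\<cdot> V vx \<^bold>\<cdot> V vy \<le>\<^sub>R d \<^bold>\<cdot> V vx \<^bold>\<cdot> V vz +\<^sub>R d \<^bold>\<cdot> V vz \<^bold>\<cdot> V vy))))"

definition in_ball :: "tm \<Rightarrow> tm \<Rightarrow> tm \<Rightarrow> tm \<Rightarrow> tm \<Rightarrow> fm"
  where "in_ball M d y x q = (y \<^bold>\<in> M \<^bold>\<and> d \<^bold>\<cdot> x \<^bold>\<cdot> y <\<^sub>R real_of_rat q)"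

abbreviation "va \<equiv> (''a'', T0 \<^bold>\<rightarrow> T1)"
abbreviation "vr \<equiv> (''r'', T1)"

definition countably_compact :: "tm \<Rightarrow> tm \<Rightarrow> fm"
  where "countably_compact M d = all_v va (all_v vr
    (sequence_in (V va) M \<^bold>\<longrightarrow>
     all_in vy M (ex_v vn (in_ball M d (V vy) (V va \<^bold>\<cdot> V vn) (V vr \<^bold>\<cdot> V vn))) \<^bold>\<longrightarrow>
     ex_v vm (all_in vy M (ex_v vn
       ((V vn \<^bold>< V vm \<^bold>\<or> V vn \<^bold>= V vm) \<^bold>\<and> in_ball M d (V vy) (V va \<^bold>\<cdot> V vn) (V vr \<^bold>\<cdot> V vn))))))"

definition separable :: "tm \<Rightarrow> tm \<Rightarrow> fm"
  where "separable M d = ex_v va (sequence_in (V va) M \<^bold>\<and>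
    all_in vx M (all_v vk (ex_v vn
      (d \<^bold>\<cdot> V vx \<^bold>\<cdot> (V va \<^bold>\<cdot> V vn) <\<^sub>R real_of_rat (half_pow (V vk))))))"

section \<open>The principles \<open>STS\<^sup>+\<close> and \<open>cocode\<^sub>0\<close>\<close>

abbreviation "vA \<equiv> (''A'', T1 \<^bold>\<rightarrow> T0)"
abbreviation "vM \<equiv> (''M'', T1 \<^bold>\<rightarrow> T0)"
abbreviation "vd \<equiv> (''d'', T1 \<^bold>\<rightarrow> T1 \<^bold>\<rightarrow> T1)"

text \<open>Spaces are taken to be non-empty: the empty space is vacuously countably-compact, but contains
  no sequence at all, so without this convention the principle would be refutable.\<close>

definition STS_plus :: fm
  where "STS_plus = all_v vM (all_v vd
    (is_set (V vM) \<^bold>\<and> sub_unit_interval (V vM) \<^bold>\<and> nonempty (V vM) \<^bold>\<and>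
     metric (V vM) (V vd) \<^bold>\<and> countably_compact (V vM) (V vd) \<^bold>\<longrightarrow> separable (V vM) (V vd)))"

definition cocode0 :: fm
  where "cocode0 = all_v vA
    (is_set (V vA) \<^bold>\<and> sub_unit_interval (V vA) \<^bold>\<and> nonempty (V vA) \<^bold>\<and> countable (V vA) \<^bold>\<longrightarrow>
     ex_v va (sequence_in (V va) (V vA) \<^bold>\<and>
       all_v vx (is_real (V vx) \<^bold>\<longrightarrow> (V vx \<^bold>\<in> V vA \<^bold>\<longleftrightarrow> ex_v vn (V va \<^bold>\<cdot> V vn =\<^sub>R V vx)))))"

end

theory Submission
  imports Defs "HOL-Library.Countable_Set"
begin

text \<open>By completeness it suffices to verify the implication in every Henkin model of
  \<open>RCA\<^sub>0\<^sup>\<omega>\<close>. Let \<open>Y\<close> be injective on the set \<open>A\<close>, and let \<open>x\<^sub>0\<close> be a member of \<open>A\<close>. Reading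
  \<open>Y x\<^sub>0\<close> as infinity, let \<open>d(x, y) = 1 / (min (Y x) (Y y) + 1)\<close> for distinct \<open>x\<close> and \<open>y\<close> in \<open>A\<close>.
  This is an ultrametric in which every point but \<open>x\<^sub>0\<close> is isolated, so that a dense sequence together
  with \<open>x\<^sub>0\<close> enumerates \<open>A\<close>. A ball of a cover that contains \<open>x\<^sub>0\<close> contains all \<open>y\<close> with \<open>Y y\<close> large.
  Whether a ball contains \<open>y\<close> is a \<open>\<Sigma>\<^sub>1\<close> condition on the number \<open>Y y\<close> alone, so the remaining
  points need no induction over quantifiers of type \<open>1\<close>: strong \<open>\<Sigma>\<^sub>1\<close>-bounding yields a bound on the
  indices of the balls that cover them.\<close>

section \<open>Syntax\<close>

text \<open>Some member of \<open>A\<close> has to serve as a limit: if all points were isolated,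
  singleton balls would cover an infinite \<open>A\<close> without a finite subcover. Any member
  will do, since a single point can be prepended to the dense sequence. The obstacle is that the set
  of values of \<open>Y\<close> on \<open>A\<close> need not exist, because membership in it
  quantifies over reals. Ordinary bounding asks for a witness at every \<open>j \<le> b\<close> and
  is not applicable; the strong form bounds the witnesses at those \<open>j\<close> that have one,
  without telling which. It is drawn from choice: if a bounded function had no maximum, a choice
  functional could be iterated by the recursor of type 0 until the bound is exceeded. Passing to
  models spares derivations inside the calculus, but a model may contain nonstandard numbers, so
  that every induction on its numbers has to name a quantifier-free formula. Distances are constant
  sequences of rationals, which reduces comparisons of reals to inequalities between
  numbers.\<close>

fun lc_tm :: "nat \<Rightarrow> tm \<Rightarrow> bool"
  where
    "lc_tm k (Bound i) \<longleftrightarrow> i < k"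
  | "lc_tm k (s \<^bold>\<cdot> t) \<longleftrightarrow> lc_tm k s \<and> lc_tm k t"
  | "lc_tm k t \<longleftrightarrow> True"

fun lc_fm :: "nat \<Rightarrow> fm \<Rightarrow> bool"
  where
    "lc_fm k (s \<^bold>= t) \<longleftrightarrow> lc_tm k s \<and> lc_tm k t"
  | "lc_fm k (s \<^bold>< t) \<longleftrightarrow> lc_tm k s \<and> lc_tm k t"
  | "lc_fm k Falsum \<longleftrightarrow> True"
  | "lc_fm k (\<phi> \<^bold>\<longrightarrow> \<psi>) \<longleftrightarrow> lc_fm k \<phi> \<and> lc_fm k \<psi>"
  | "lc_fm k (Forall \<sigma> \<phi>) \<longleftrightarrow> lc_fm (Suc k) \<phi>"

lemma typ_of_App:
  "typ_of E (s \<^bold>\<cdot> t) = Some \<tau> \<longleftrightarrow> (\<exists>\<sigma>. typ_of E s = Some (\<sigma> \<^bold>\<rightarrow> \<tau>) \<and> typ_of E t = Some \<sigma>)"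
  by (auto split: option.splits ty.splits)

lemma typ_of_lc: "typ_of E t = Some \<sigma> \<Longrightarrow> lc_tm (length E) t"
  by (induction t arbitrary: \<sigma>) (auto simp del: typ_of.simps(10) simp add: typ_of_App split: if_splits)

lemma wf_fm_lc: "wf_fm E \<phi> \<Longrightarrow> lc_fm (length E) \<phi>"
  by (induction \<phi> arbitrary: E) (fastforce dest: typ_of_lc)+

lemma typ_of_weaken: "typ_of E t = Some \<sigma> \<Longrightarrow> typ_of (E @ F) t = Some \<sigma>"
  by (induction t arbitrary: \<sigma>)
     (auto simp del: typ_of.simps(10) simp add: typ_of_App nth_append split: if_splits, blast?)

lemma wf_fm_weaken: "wf_fm E \<phi> \<Longrightarrow> wf_fm (E @ F) \<phi>"
proof (induction \<phi> arbitrary: E)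
  case (Forall \<rho> \<phi>)
  from Forall.IH[of "\<rho> # E"] Forall.prems show ?case by simp
qed (auto intro: typ_of_weaken)

lemma lc_tm_mono: "lc_tm k t \<Longrightarrow> k \<le> l \<Longrightarrow> lc_tm l t"
  by (induction t) auto

lemma inst_tm_lc: "lc_tm k t \<Longrightarrow> inst_tm k u t = t"
  by (induction t) auto

lemma inst_fm_lc: "lc_fm k \<phi> \<Longrightarrow> inst_fm k u \<phi> = \<phi>"
  by (induction \<phi> arbitrary: k) (auto simp: inst_tm_lc)

text \<open>The type of the instantiated binder stands last in the context: the outermost quantifier
  is removed, and \<open>E\<close> lists the binders already passed on the way to its
  occurrences.\<close>

lemma typ_of_inst:
  assumes "typ_of [] u = Some \<sigma>"
  shows "typ_of (E @ [\<sigma>]) t = Some \<tau> \<Longrightarrow> typ_of E (inst_tm (length E) u t) = Some \<tau>"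
proof (induction t arbitrary: \<tau>)
  case (Bound i)
  then show ?case using typ_of_weaken[OF assms, of E]
    by (auto simp: nth_append split: if_splits)
qed (auto simp del: typ_of.simps(10) simp add: typ_of_App, blast?)

lemma wf_fm_inst:
  assumes "typ_of [] u = Some \<sigma>"
  shows "wf_fm (E @ [\<sigma>]) \<phi> \<Longrightarrow> wf_fm E (inst_fm (length E) u \<phi>)"
proof (induction \<phi> arbitrary: E)
  case (Forall \<rho> \<phi>)
  from Forall.IH[of "\<rho> # E"] Forall.prems show ?case by simp
qed (auto intro: typ_of_inst[OF assms])

lemma finite_vars_tm [simp]: "finite (vars_tm t)"
  by (induction t) auto

lemma finite_vars_fm [simp]: "finite (vars_fm \<phi>)"
  by (induction \<phi>) auto

lemma fresh_var:
  assumes "finite (S :: var set)"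
  obtains v where "snd v = \<sigma>" "v \<notin> S"
proof -
  have "infinite (range (\<lambda>s :: string. (s, \<sigma>)))"
    by (auto simp: finite_image_iff inj_on_def infinite_UNIV_listI)
  with assms obtain v where "v \<in> range (\<lambda>s :: string. (s, \<sigma>))" "v \<notin> S"
    by (meson finite_subset subsetI)
  then show ?thesis by (intro that[of v]) auto
qed

text \<open>The syntactic counterpart of evaluation: \<open>e\<close> treats the free variables and
  the stack \<open>bs\<close> the outer binders, while \<open>k\<close> counts the binders passed
  inside the formula. The truth lemma compares the two. Only terms without \<open>Bound\<close> are
  inserted, so nothing is shifted.\<close>

fun msub_tm :: "(var \<Rightarrow> tm) \<Rightarrow> tm list \<Rightarrow> nat \<Rightarrow> tm \<Rightarrow> tm"
  where
    "msub_tm e bs k (V v) = e v"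
  | "msub_tm e bs k (Bound i) = (if i < k then Bound i else bs ! (i - k))"
  | "msub_tm e bs k (s \<^bold>\<cdot> t) = msub_tm e bs k s \<^bold>\<cdot> msub_tm e bs k t"
  | "msub_tm e bs k t = t"

fun msub_fm :: "(var \<Rightarrow> tm) \<Rightarrow> tm list \<Rightarrow> nat \<Rightarrow> fm \<Rightarrow> fm"
  where
    "msub_fm e bs k (s \<^bold>= t) = (msub_tm e bs k s \<^bold>= msub_tm e bs k t)"
  | "msub_fm e bs k (s \<^bold>< t) = (msub_tm e bs k s \<^bold>< msub_tm e bs k t)"
  | "msub_fm e bs k Falsum = Falsum"
  | "msub_fm e bs k (\<phi> \<^bold>\<longrightarrow> \<psi>) = (msub_fm e bs k \<phi> \<^bold>\<longrightarrow> msub_fm e bs k \<psi>)"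
  | "msub_fm e bs k (Forall \<sigma> \<phi>) = Forall \<sigma> (msub_fm e bs (Suc k) \<phi>)"

definition typed_env :: "(var \<Rightarrow> tm) \<Rightarrow> bool"
  where "typed_env e \<longleftrightarrow> (\<forall>v. typ_of [] (e v) = Some (snd v))"

abbreviation typed_list :: "tm list \<Rightarrow> ty list \<Rightarrow> bool"
  where "typed_list \<equiv> list_all2 (\<lambda>b \<sigma>. typ_of [] b = Some \<sigma>)"

lemma typed_envD: "typed_env e \<Longrightarrow> typ_of [] (e v) = Some (snd v)"
  unfolding typed_env_def by blast

lemma typed_env_upd: "typed_env e \<Longrightarrow> typ_of [] t = Some (snd v) \<Longrightarrow> typed_env (e(v := t))"
  unfolding typed_env_def by (metis fun_upd_apply)

lemma typed_env_V [simp]: "typed_env V"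
  by (simp add: typed_env_def)

lemma msub_tm_typ:
  assumes "typed_env e" "typed_list bs E"
  shows "typ_of (F @ E) t = Some \<tau> \<Longrightarrow> typ_of F (msub_tm e bs (length F) t) = Some \<tau>"
proof (induction t arbitrary: \<tau>)
  case (V v)
  then show ?case
    using typ_of_weaken[OF typed_envD[OF assms(1)], of F] by simp
next
  case (Bound i)
  then show ?case using assms(2) typ_of_weaken[of "[]" _ _ F]
    by (auto simp: nth_append list_all2_conv_all_nth split: if_splits)
qed (auto simp del: typ_of.simps(10) simp add: typ_of_App, blast?)

lemma msub_fm_wf:
  assumes "typed_env e" "typed_list bs E"
  shows "wf_fm (F @ E) \<phi> \<Longrightarrow> wf_fm F (msub_fm e bs (length F) \<phi>)"
proof (induction \<phi> arbitrary: F)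
  case (Forall \<rho> \<phi>)
  from Forall.IH[of "\<rho> # F"] Forall.prems show ?case by simp
qed (auto intro: msub_tm_typ[OF assms])

text \<open>The inserted terms contain no \<open>Bound\<close>, so instantiation passes them by and
  only meets the index \<open>k\<close>. This is how the truth lemma goes below a
  quantifier.\<close>

lemma inst_msub_tm:
  assumes "typed_env e" "typed_list bs E"
  shows "lc_tm (Suc k + length E) t \<Longrightarrow> inst_tm k a (msub_tm e bs (Suc k) t) = msub_tm e (a # bs) k t"
proof (induction t)
  case (V v)
  have "lc_tm 0 (e v)" using typ_of_lc[OF typed_envD[OF assms(1)]] by simp
  then show ?case by (simp add: inst_tm_lc lc_tm_mono)
next
  case (Bound i)
  have "lc_tm 0 (bs ! (i - Suc k))" if "\<not> i \<le> k"
    using that Bound assms(2) typ_of_lc[of "[]"] by (auto simp: list_all2_conv_all_nth)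
  then show ?case
    by (cases "i - k") (auto simp: inst_tm_lc lc_tm_mono diff_Suc not_less le_Suc_eq split: nat.splits)
qed auto

lemma inst_msub_fm:
  assumes "typed_env e" "typed_list bs E"
  shows "lc_fm (Suc k + length E) \<phi> \<Longrightarrow> inst_fm k a (msub_fm e bs (Suc k) \<phi>) = msub_fm e (a # bs) k \<phi>"
  by (induction \<phi> arbitrary: k) (auto simp: inst_msub_tm[OF assms])

text \<open>Named and nameless quantification meet here: a value supplied for the bound name is the
  same as an update of the environment.\<close>

lemma msub_bind_tm:
  "lc_tm k t \<Longrightarrow> msub_tm e [a] k (subst_tm v (Bound k) t) = msub_tm (e(v := a)) [] k t"
  by (induction t) auto

lemma msub_bind_fm:
  "lc_fm k \<phi> \<Longrightarrow> msub_fm e [a] k (bind_fm k v \<phi>) = msub_fm (e(v := a)) [] k \<phi>"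
  by (induction \<phi> arbitrary: k) (auto simp: msub_bind_tm)

lemma inst_bind_tm: "lc_tm k t \<Longrightarrow> inst_tm k (V v) (subst_tm v (Bound k) t) = t"
  by (induction t) auto

lemma inst_bind_fm: "lc_fm k \<phi> \<Longrightarrow> inst_fm k (V v) (bind_fm k v \<phi>) = \<phi>"
  by (induction \<phi> arbitrary: k) (auto simp: inst_bind_tm)

lemma vars_bind_tm: "vars_tm (subst_tm v (Bound k) t) = vars_tm t - {v}"
  by (induction t) auto

lemma vars_bind_fm: "vars_fm (bind_fm k v \<phi>) = vars_fm \<phi> - {v}"
  by (induction \<phi> arbitrary: k) (auto simp: vars_bind_tm)

lemma typ_of_bind:
  "typ_of E t = Some \<tau> \<Longrightarrow> typ_of (E @ [snd v]) (subst_tm v (Bound (length E)) t) = Some \<tau>"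
proof (induction t arbitrary: \<tau>)
  case (Bound i)
  then show ?case by (auto simp: nth_append split: if_splits)
qed (auto simp del: typ_of.simps(10) simp add: typ_of_App, blast?)

lemma wf_fm_bind: "wf_fm E \<phi> \<Longrightarrow> wf_fm (E @ [snd v]) (bind_fm (length E) v \<phi>)"
proof (induction \<phi> arbitrary: E)
  case (Forall \<rho> \<phi>)
  from Forall.IH[of "\<rho> # E"] Forall.prems show ?case by simp
qed (auto intro: typ_of_bind)

lemma msub_tm_V: "lc_tm k t \<Longrightarrow> msub_tm V [] k t = t"
  by (induction t) auto

lemma msub_fm_V: "lc_fm k \<phi> \<Longrightarrow> msub_fm V [] k \<phi> = \<phi>"
  by (induction \<phi> arbitrary: k) (auto simp: msub_tm_V)

lemma msub_tm_cong: "(\<And>v. v \<in> vars_tm t \<Longrightarrow> e v = e' v) \<Longrightarrow> msub_tm e bs k t = msub_tm e' bs k t"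
  by (induction t) auto

lemma msub_fm_cong: "(\<And>v. v \<in> vars_fm \<phi> \<Longrightarrow> e v = e' v) \<Longrightarrow> msub_fm e bs k \<phi> = msub_fm e' bs k \<phi>"
  by (induction \<phi> arbitrary: k) (auto intro: msub_tm_cong)

lemma wf_Neg [simp]: "wf_fm E (\<^bold>\<not> \<phi>) \<longleftrightarrow> wf_fm E \<phi>"
  by (simp add: Neg_def)

lemma wf_Conj [simp]: "wf_fm E (\<phi> \<^bold>\<and> \<psi>) \<longleftrightarrow> wf_fm E \<phi> \<and> wf_fm E \<psi>"
  by (simp add: Conj_def)

lemma wf_all_v [simp]: "wf_fm [] \<phi> \<Longrightarrow> wf_fm [] (all_v v \<phi>)"
  using wf_fm_bind[of "[]"] by (simp add: all_v_def)

section \<open>Henkin sets\<close>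

lemma derives_wf: "derives T \<Gamma> \<phi> \<Longrightarrow> wf_fm [] \<phi>"
  by (induction rule: derives.induct) (auto dest: wf_fm_inst[where E="[]"])

context
  fixes T :: "fm set"
begin

lemma proves_wf: "T \<turnstile> \<phi> \<Longrightarrow> wf_fm [] \<phi>"
  by (simp add: proves_def derives_wf)

lemma proves_mp: "T \<turnstile> \<phi> \<^bold>\<longrightarrow> \<psi> \<Longrightarrow> T \<turnstile> \<phi> \<Longrightarrow> T \<turnstile> \<psi>"
  unfolding proves_def by (rule derives.Imp_E)

lemma proves_refl: "wf_fm [] \<phi> \<Longrightarrow> T \<turnstile> \<phi> \<^bold>\<longrightarrow> \<phi>"
  unfolding proves_def by (rule derives.Imp_I, rule derives.Hyp) simp_all

lemma proves_K: "wf_fm [] \<phi> \<Longrightarrow> wf_fm [] \<psi> \<Longrightarrow> T \<turnstile> \<phi> \<^bold>\<longrightarrow> \<psi> \<^bold>\<longrightarrow> \<phi>"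
  unfolding proves_def by (rule derives.Imp_I, rule derives.Imp_I, rule derives.Hyp) simp_all

lemma proves_weaken: "T \<turnstile> \<phi> \<Longrightarrow> wf_fm [] \<psi> \<Longrightarrow> T \<turnstile> \<psi> \<^bold>\<longrightarrow> \<phi>"
  using proves_mp proves_K proves_wf by blast

lemma derives_mp_Hyp: "(\<phi> \<^bold>\<longrightarrow> \<psi>) \<in> \<Gamma> \<Longrightarrow> wf_fm [] (\<phi> \<^bold>\<longrightarrow> \<psi>) \<Longrightarrow> derives T \<Gamma> \<phi> \<Longrightarrow> derives T \<Gamma> \<psi>"
  by (rule derives.Imp_E) (rule derives.Hyp)

text \<open>Weakening of hypotheses, which would have to rename eigenvariables, is avoided: the rule
  is derived as one implication from an explicit set of hypotheses, and its premises are then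
  detached.\<close>

lemma proves_mp_under:
  assumes "T \<turnstile> \<chi> \<^bold>\<longrightarrow> \<phi> \<^bold>\<longrightarrow> \<psi>" "T \<turnstile> \<chi> \<^bold>\<longrightarrow> \<phi>"
  shows "T \<turnstile> \<chi> \<^bold>\<longrightarrow> \<psi>"
proof -
  have wf: "wf_fm [] \<chi>" "wf_fm [] \<phi>" "wf_fm [] \<psi>" using proves_wf[OF assms(1)] by auto
  let ?G = "{\<chi>, \<chi> \<^bold>\<longrightarrow> \<phi>, \<chi> \<^bold>\<longrightarrow> \<phi> \<^bold>\<longrightarrow> \<psi>}"
  have \<chi>: "derives T ?G \<chi>" by (rule derives.Hyp) (simp_all add: wf)
  have "derives T ?G \<phi>" by (rule derives_mp_Hyp[OF _ _ \<chi>]) (simp_all add: wf)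
  moreover have "derives T ?G (\<phi> \<^bold>\<longrightarrow> \<psi>)" by (rule derives_mp_Hyp[OF _ _ \<chi>]) (simp_all add: wf)
  ultimately have "derives T ?G \<psi>" by (blast intro: derives.Imp_E)
  then have "T \<turnstile> (\<chi> \<^bold>\<longrightarrow> \<phi> \<^bold>\<longrightarrow> \<psi>) \<^bold>\<longrightarrow> (\<chi> \<^bold>\<longrightarrow> \<phi>) \<^bold>\<longrightarrow> \<chi> \<^bold>\<longrightarrow> \<psi>"
    unfolding proves_def by (intro derives.Imp_I) (simp_all add: wf)
  then show ?thesis using assms proves_mp by blast
qed

lemma proves_trans:
  assumes "T \<turnstile> \<phi> \<^bold>\<longrightarrow> \<chi>" "T \<turnstile> \<chi> \<^bold>\<longrightarrow> \<psi>" shows "T \<turnstile> \<phi> \<^bold>\<longrightarrow> \<psi>"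
proof -
  have "wf_fm [] \<phi>" using proves_wf[OF assms(1)] by simp
  then show ?thesis using proves_mp_under[OF proves_weaken[OF assms(2)] assms(1)] by blast
qed

lemma derives_Neg_Hyp: "(\<^bold>\<not> \<phi>) \<in> \<Gamma> \<Longrightarrow> derives T \<Gamma> \<phi> \<Longrightarrow> derives T \<Gamma> Falsum"
  unfolding Neg_def using derives_mp_Hyp derives_wf by auto

lemma proves_exfalso:
  assumes "wf_fm [] \<phi>" "wf_fm [] \<psi>" shows "T \<turnstile> \<^bold>\<not> \<phi> \<^bold>\<longrightarrow> \<phi> \<^bold>\<longrightarrow> \<psi>"
  unfolding proves_def
  by (rule derives.Imp_I, rule derives.Imp_I, rule derives.Classical,
      rule derives_Neg_Hyp[of \<phi>], simp, rule derives.Hyp) (simp_all add: assms)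

lemma proves_dneg:
  assumes "wf_fm [] \<phi>" shows "T \<turnstile> \<^bold>\<not> \<^bold>\<not> \<phi> \<^bold>\<longrightarrow> \<phi>"
  unfolding proves_def
  by (rule derives.Imp_I, rule derives.Classical,
      rule derives_Neg_Hyp[of "\<^bold>\<not> \<phi>"], simp, rule derives.Hyp) (simp_all add: assms)

lemma proves_conjD1:
  assumes "wf_fm [] \<phi>" "wf_fm [] \<psi>" shows "T \<turnstile> \<phi> \<^bold>\<and> \<psi> \<^bold>\<longrightarrow> \<phi>"
  unfolding proves_def Conj_def
  by (rule derives.Imp_I, rule derives.Classical, rule derives_Neg_Hyp[of "\<phi> \<^bold>\<longrightarrow> \<^bold>\<not> \<psi>"], simp,
      rule derives.Imp_I, subst (4) Neg_def, rule derives.Imp_I,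
      rule derives_Neg_Hyp[of \<phi>], simp, rule derives.Hyp) (simp_all add: assms)

lemma proves_conjD2:
  assumes "wf_fm [] \<phi>" "wf_fm [] \<psi>" shows "T \<turnstile> \<phi> \<^bold>\<and> \<psi> \<^bold>\<longrightarrow> \<psi>"
  unfolding proves_def Conj_def
  by (rule derives.Imp_I, rule derives.Classical, rule derives_Neg_Hyp[of "\<phi> \<^bold>\<longrightarrow> \<^bold>\<not> \<psi>"], simp,
      rule derives.Imp_I, rule derives.Hyp) (simp_all add: assms)

lemma proves_neg_conj:
  assumes "T \<turnstile> \<phi> \<^bold>\<and> \<psi> \<^bold>\<longrightarrow> Falsum" shows "T \<turnstile> \<phi> \<^bold>\<longrightarrow> \<^bold>\<not> \<psi>"
proof -
  have wf: "wf_fm [] \<phi>" "wf_fm [] \<psi>" using proves_wf[OF assms] by auto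
  let ?C = "\<phi> \<^bold>\<and> \<psi> \<^bold>\<longrightarrow> Falsum" and ?I = "\<phi> \<^bold>\<longrightarrow> \<^bold>\<not> \<psi>"
  let ?G = "{?I, \<psi>, \<phi>, ?C}"
  have "derives T ?G (\<^bold>\<not> \<psi>)"
    by (rule derives_mp_Hyp[of \<phi>], simp, simp add: wf, rule derives.Hyp) (simp_all add: wf)
  then have "derives T ?G Falsum"
    unfolding Neg_def by (rule derives.Imp_E) (rule derives.Hyp, simp_all add: wf)
  then have "derives T {\<psi>, \<phi>, ?C} (\<phi> \<^bold>\<and> \<psi>)"
    unfolding Conj_def Neg_def[of ?I] by (rule derives.Imp_I) (simp add: wf)
  then have "derives T {\<psi>, \<phi>, ?C} Falsum"
    by (rule derives_mp_Hyp[rotated 2]) (simp_all add: wf)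
  then have "T \<turnstile> ?C \<^bold>\<longrightarrow> \<phi> \<^bold>\<longrightarrow> \<^bold>\<not> \<psi>"
    unfolding proves_def Neg_def[of \<psi>] by (intro derives.Imp_I) (simp_all add: wf)
  then show ?thesis using assms proves_mp by blast
qed

lemma proves_all_E:
  assumes "wf_fm [] (Forall \<sigma> \<phi>)" "typ_of [] t = Some \<sigma>"
  shows "T \<turnstile> Forall \<sigma> \<phi> \<^bold>\<longrightarrow> inst_fm 0 t \<phi>"
  unfolding proves_def
  by (intro derives.Imp_I derives.All_E[of _ _ \<sigma>] derives.Hyp) (auto simp: assms(2), use assms(1) in auto)

lemma proves_all_I:
  assumes "T \<turnstile> inst_fm 0 (V v) \<phi>" "v \<notin> vars_fm \<phi>" "wf_fm [] (Forall (snd v) \<phi>)"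
  shows "T \<turnstile> Forall (snd v) \<phi>"
  using assms unfolding proves_def by (intro derives.All_I) auto

lemma proves_all_v: "T \<turnstile> \<phi> \<Longrightarrow> T \<turnstile> all_v v \<phi>"
  unfolding all_v_def
proof (rule proves_all_I)
  assume *: "T \<turnstile> \<phi>"
  have "lc_fm 0 \<phi>" using wf_fm_lc[OF proves_wf[OF *]] by simp
  with * show "T \<turnstile> inst_fm 0 (V v) (bind_fm 0 v \<phi>)" by (simp add: inst_bind_fm)
  show "wf_fm [] (Forall (snd v) (bind_fm 0 v \<phi>))"
    using wf_fm_bind[OF proves_wf[OF *], of v] by simp
qed (simp add: vars_bind_fm)

text \<open>The implication is first generalised without hypotheses. Its closure and
  \<open>\<chi>\<close> are both free of \<open>v\<close>, so the same eigenvariable can be used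
  again under them.\<close>

lemma proves_all_imp:
  assumes "T \<turnstile> \<chi> \<^bold>\<longrightarrow> inst_fm 0 (V v) \<phi>" "v \<notin> vars_fm \<chi>" "v \<notin> vars_fm \<phi>" "wf_fm [] (Forall (snd v) \<phi>)"
  shows "T \<turnstile> \<chi> \<^bold>\<longrightarrow> Forall (snd v) \<phi>"
proof -
  have wf: "wf_fm [] \<chi>" using proves_wf[OF assms(1)] by simp
  then have lc: "lc_fm 0 \<chi>" using wf_fm_lc[of "[]"] by simp
  have wf': "wf_fm [snd v] \<chi>" using wf_fm_weaken[OF wf, of "[snd v]"] by simp
  let ?A = "Forall (snd v) (\<chi> \<^bold>\<longrightarrow> \<phi>)"
  have A: "T \<turnstile> ?A"
    by (rule proves_all_I) (use assms wf' lc in \<open>auto simp: inst_fm_lc\<close>)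
  have "derives T {\<chi>, ?A} (Forall (snd v) \<phi>)"
  proof (rule derives.All_I)
    have "derives T {\<chi>, ?A} (inst_fm 0 (V v) (\<chi> \<^bold>\<longrightarrow> \<phi>))"
      by (rule derives.All_E[of _ _ "snd v"], rule derives.Hyp) (use proves_wf[OF A] in auto)
    then have "derives T {\<chi>, ?A} (\<chi> \<^bold>\<longrightarrow> inst_fm 0 (V v) \<phi>)" using lc by (simp add: inst_fm_lc)
    then show "derives T {\<chi>, ?A} (inst_fm 0 (V v) \<phi>)"
      by (rule derives.Imp_E) (rule derives.Hyp, auto simp: wf)
  qed (use assms in auto)
  then have "T \<turnstile> ?A \<^bold>\<longrightarrow> \<chi> \<^bold>\<longrightarrow> Forall (snd v) \<phi>"
    unfolding proves_def using wf proves_wf[OF A] by (intro derives.Imp_I)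
  then show ?thesis using A proves_mp by blast
qed

end

text \<open>Membership behaves like truth. Universal formulas are tested on all typable terms, free
  variables included: variables serve as Henkin constants, so the language need not be
  extended.\<close>

definition henkin :: "fm set \<Rightarrow> fm set \<Rightarrow> bool"
  where "henkin T \<Delta> \<longleftrightarrow>
    (\<forall>\<phi>. (T \<turnstile> \<phi>) \<longrightarrow> \<phi> \<in> \<Delta>) \<and> Falsum \<notin> \<Delta> \<and>
    (\<forall>\<phi> \<psi>. wf_fm [] \<phi> \<longrightarrow> wf_fm [] \<psi> \<longrightarrow> ((\<phi> \<^bold>\<longrightarrow> \<psi>) \<in> \<Delta> \<longleftrightarrow> (\<phi> \<in> \<Delta> \<longrightarrow> \<psi> \<in> \<Delta>))) \<and>
    (\<forall>\<sigma> \<phi>. wf_fm [] (Forall \<sigma> \<phi>) \<longrightarrow>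
      (Forall \<sigma> \<phi> \<in> \<Delta> \<longleftrightarrow> (\<forall>t. typ_of [] t = Some \<sigma> \<longrightarrow> inst_fm 0 t \<phi> \<in> \<Delta>)))"

section \<open>Extension of a consistent formula to a Henkin set\<close>

instance ty :: countable by countable_datatype
instance tm :: countable by countable_datatype
instance fm :: countable by countable_datatype

text \<open>The conjunction \<open>\<chi>\<close> of the formulas accepted so far is extended by \<open>\<theta>\<close> if that is consistent,
  together with a counterexample in case \<open>\<theta>\<close> is a negated universal formula.\<close>

definition henkin_witness :: "fm \<Rightarrow> fm \<Rightarrow> fm"
  where "henkin_witness \<chi> \<theta> = (case \<theta> of
      Forall \<sigma> \<psi> \<^bold>\<longrightarrow> Falsum \<Rightarrow>
        \<chi> \<^bold>\<and> \<^bold>\<not> inst_fm 0 (V (SOME v. snd v = \<sigma> \<and> v \<notin> vars_fm \<chi> \<union> vars_fm \<psi>)) \<psi>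
    | _ \<Rightarrow> \<chi>)"

definition henkin_step :: "fm set \<Rightarrow> fm \<Rightarrow> fm \<Rightarrow> fm"
  where "henkin_step T \<chi> \<theta> =
    (if wf_fm [] \<theta> \<and> \<not> (T \<turnstile> \<chi> \<^bold>\<and> \<theta> \<^bold>\<longrightarrow> Falsum) then henkin_witness (\<chi> \<^bold>\<and> \<theta>) \<theta> else \<chi>)"

primrec henkin_seq :: "fm set \<Rightarrow> fm \<Rightarrow> nat \<Rightarrow> fm"
  where
    "henkin_seq T \<chi> 0 = \<chi>"
  | "henkin_seq T \<chi> (Suc n) = henkin_step T (henkin_seq T \<chi> n) (from_nat n)"

definition consistent :: "fm set \<Rightarrow> fm \<Rightarrow> bool"
  where "consistent T \<chi> \<longleftrightarrow> wf_fm [] \<chi> \<and> \<not> (T \<turnstile> \<chi> \<^bold>\<longrightarrow> Falsum)"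

text \<open>A fresh counterexample cannot destroy consistency: otherwise \<open>\<chi>\<close> would
  prove the instance at \<open>v\<close>, hence by generalisation the universal formula that it
  refutes.\<close>

lemma henkin_witness_Forall:
  assumes "consistent T \<chi>" "T \<turnstile> \<chi> \<^bold>\<longrightarrow> \<^bold>\<not> Forall \<sigma> \<psi>"
  obtains v where "snd v = \<sigma>" "henkin_witness \<chi> (\<^bold>\<not> Forall \<sigma> \<psi>) = (\<chi> \<^bold>\<and> \<^bold>\<not> inst_fm 0 (V v) \<psi>)"
    "wf_fm [] (inst_fm 0 (V v) \<psi>)" "consistent T (\<chi> \<^bold>\<and> \<^bold>\<not> inst_fm 0 (V v) \<psi>)"
proof -
  define v where "v = (SOME v. snd v = \<sigma> \<and> v \<notin> vars_fm \<chi> \<union> vars_fm \<psi>)"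
  have "\<exists>v. snd v = \<sigma> \<and> v \<notin> vars_fm \<chi> \<union> vars_fm \<psi>"
    by (rule fresh_var[of "vars_fm \<chi> \<union> vars_fm \<psi>" \<sigma>]) auto
  then have v: "snd v = \<sigma>" "v \<notin> vars_fm \<chi>" "v \<notin> vars_fm \<psi>"
    unfolding v_def by (metis (mono_tags, lifting) UnCI someI_ex)+
  have wf: "wf_fm [\<sigma>] \<psi>" using proves_wf[OF assms(2)] by simp
  then have wf': "wf_fm [] (inst_fm 0 (V v) \<psi>)"
    using wf_fm_inst[of "V v" \<sigma> "[]"] v by simp
  have "\<not> (T \<turnstile> (\<chi> \<^bold>\<and> \<^bold>\<not> inst_fm 0 (V v) \<psi>) \<^bold>\<longrightarrow> Falsum)"
  proof
    assume "T \<turnstile> (\<chi> \<^bold>\<and> \<^bold>\<not> inst_fm 0 (V v) \<psi>) \<^bold>\<longrightarrow> Falsum"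
    then have "T \<turnstile> \<chi> \<^bold>\<longrightarrow> inst_fm 0 (V v) \<psi>"
      using proves_trans[OF proves_neg_conj proves_dneg[OF wf']] by blast
    then have "T \<turnstile> \<chi> \<^bold>\<longrightarrow> Forall \<sigma> \<psi>" using proves_all_imp[of T \<chi> v \<psi>] v wf by simp
    then have "T \<turnstile> \<chi> \<^bold>\<longrightarrow> Falsum" using proves_mp_under assms(2) unfolding Neg_def by blast
    then show False using assms(1) by (simp add: consistent_def)
  qed
  then show ?thesis
    using v wf' assms(1)
    by (intro that[of v]) (auto simp: henkin_witness_def v_def Neg_def[of "Forall \<sigma> \<psi>"] consistent_def)
qed

lemma henkin_witness_cases:
  obtains \<sigma> \<psi> where "\<theta> = (\<^bold>\<not> Forall \<sigma> \<psi>)" | "\<And>\<chi>. henkin_witness \<chi> \<theta> = \<chi>"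
  by (cases "\<exists>\<sigma> \<psi>. \<theta> = (\<^bold>\<not> Forall \<sigma> \<psi>)")
     (auto simp: henkin_witness_def Neg_def split: fm.splits)

text \<open>Either \<open>\<theta>\<close> is added, or it is inconsistent with
  \<open>\<chi>\<close> and thus already refuted by it. Both ways the step decides
  \<open>\<theta>\<close>.\<close>

lemma henkin_step:
  assumes "consistent T \<chi>"
  shows "consistent T (henkin_step T \<chi> \<theta>)" and "T \<turnstile> henkin_step T \<chi> \<theta> \<^bold>\<longrightarrow> \<chi>"
    and "wf_fm [] \<theta> \<Longrightarrow> (T \<turnstile> henkin_step T \<chi> \<theta> \<^bold>\<longrightarrow> \<theta>) \<or> (T \<turnstile> henkin_step T \<chi> \<theta> \<^bold>\<longrightarrow> \<^bold>\<not> \<theta>)"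
proof -
  have wf: "wf_fm [] \<chi>" using assms by (simp add: consistent_def)
  have "consistent T (henkin_step T \<chi> \<theta>) \<and> (T \<turnstile> henkin_step T \<chi> \<theta> \<^bold>\<longrightarrow> \<chi>) \<and>
    (wf_fm [] \<theta> \<longrightarrow> (T \<turnstile> henkin_step T \<chi> \<theta> \<^bold>\<longrightarrow> \<theta>) \<or> (T \<turnstile> henkin_step T \<chi> \<theta> \<^bold>\<longrightarrow> \<^bold>\<not> \<theta>))"
  proof (cases "wf_fm [] \<theta> \<and> \<not> (T \<turnstile> \<chi> \<^bold>\<and> \<theta> \<^bold>\<longrightarrow> Falsum)")
    case True
    let ?\<chi> = "\<chi> \<^bold>\<and> \<theta>"
    have con: "consistent T ?\<chi>" using True wf by (simp add: consistent_def)
    have 1: "T \<turnstile> ?\<chi> \<^bold>\<longrightarrow> \<chi>" "T \<turnstile> ?\<chi> \<^bold>\<longrightarrow> \<theta>" using proves_conjD1 proves_conjD2 wf True by blast+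
    show ?thesis
    proof (cases rule: henkin_witness_cases[of \<theta>])
      case (1 \<sigma> \<psi>)
      from henkin_witness_Forall[OF con, of \<sigma> \<psi>] \<open>T \<turnstile> ?\<chi> \<^bold>\<longrightarrow> \<theta>\<close> 1
      obtain v where v: "henkin_witness ?\<chi> \<theta> = (?\<chi> \<^bold>\<and> \<^bold>\<not> inst_fm 0 (V v) \<psi>)"
        "wf_fm [] (inst_fm 0 (V v) \<psi>)" "consistent T (henkin_witness ?\<chi> \<theta>)" by metis
      have "T \<turnstile> henkin_witness ?\<chi> \<theta> \<^bold>\<longrightarrow> ?\<chi>" unfolding v(1)
        by (rule proves_conjD1) (use v wf True in auto)
      then have "T \<turnstile> henkin_witness ?\<chi> \<theta> \<^bold>\<longrightarrow> \<theta>" "T \<turnstile> henkin_witness ?\<chi> \<theta> \<^bold>\<longrightarrow> \<chi>"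
        using \<open>T \<turnstile> ?\<chi> \<^bold>\<longrightarrow> \<theta>\<close> \<open>T \<turnstile> ?\<chi> \<^bold>\<longrightarrow> \<chi>\<close> proves_trans by blast+
      with v True show ?thesis by (simp add: henkin_step_def)
    next
      case 2
      with 1 True con show ?thesis by (simp add: henkin_step_def)
    qed
  next
    case False
    then have h: "henkin_step T \<chi> \<theta> = \<chi>" by (auto simp: henkin_step_def)
    have "wf_fm [] \<theta> \<Longrightarrow> T \<turnstile> \<chi> \<^bold>\<longrightarrow> \<^bold>\<not> \<theta>" using False proves_neg_conj by blast
    then show ?thesis unfolding h using assms proves_refl[OF wf] by blast
  qed
  then show "consistent T (henkin_step T \<chi> \<theta>)" "T \<turnstile> henkin_step T \<chi> \<theta> \<^bold>\<longrightarrow> \<chi>"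
    "wf_fm [] \<theta> \<Longrightarrow> (T \<turnstile> henkin_step T \<chi> \<theta> \<^bold>\<longrightarrow> \<theta>) \<or> (T \<turnstile> henkin_step T \<chi> \<theta> \<^bold>\<longrightarrow> \<^bold>\<not> \<theta>)" by auto
qed

lemma henkin_extension:
  assumes "consistent T \<chi>"
  obtains \<Delta> where "henkin T \<Delta>" "\<chi> \<in> \<Delta>"
proof -
  let ?h = "henkin_seq T \<chi>"
  \<comment> \<open>The stages are single formulas of increasing strength, so finitely many
    consequences always follow from one common stage.\<close>
  define \<Delta> where "\<Delta> = {\<theta>. \<exists>n. T \<turnstile> ?h n \<^bold>\<longrightarrow> \<theta>}"
  have con: "consistent T (?h n)" for n
    by (induction n) (use assms in \<open>auto intro: henkin_step\<close>)
  then have wfh: "wf_fm [] (?h n)" for n by (simp add: consistent_def)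
  have mono: "T \<turnstile> ?h n \<^bold>\<longrightarrow> ?h m" if "m \<le> n" for m n
    using that
  proof (induction n rule: dec_induct)
    case base
    show ?case using wfh proves_refl by blast
  next
    case (step n)
    show ?case using proves_trans[OF henkin_step(2)[OF con] step.IH] by simp
  qed
  have prov: "\<phi> \<in> \<Delta>" if "T \<turnstile> \<phi>" for \<phi>
    unfolding \<Delta>_def using proves_weaken[OF that wfh] by blast
  have mp: "\<psi> \<in> \<Delta>" if "(\<phi> \<^bold>\<longrightarrow> \<psi>) \<in> \<Delta>" "\<phi> \<in> \<Delta>" for \<phi> \<psi>
  proof -
    from that obtain m n where "T \<turnstile> ?h m \<^bold>\<longrightarrow> \<phi> \<^bold>\<longrightarrow> \<psi>" "T \<turnstile> ?h n \<^bold>\<longrightarrow> \<phi>" unfolding \<Delta>_def by blast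
    then have "T \<turnstile> ?h (max m n) \<^bold>\<longrightarrow> \<phi> \<^bold>\<longrightarrow> \<psi>" "T \<turnstile> ?h (max m n) \<^bold>\<longrightarrow> \<phi>"
      using mono[OF max.cobounded1] mono[OF max.cobounded2] proves_trans by blast+
    then show ?thesis unfolding \<Delta>_def using proves_mp_under by blast
  qed
  have bot: "Falsum \<notin> \<Delta>" unfolding \<Delta>_def using con by (auto simp: consistent_def)
  have complete: "\<phi> \<in> \<Delta> \<or> (\<^bold>\<not> \<phi>) \<in> \<Delta>" if "wf_fm [] \<phi>" for \<phi>
    unfolding \<Delta>_def using henkin_step(3)[OF con that, of "to_nat \<phi>"]
    by (metis (mono_tags, lifting) from_nat_to_nat henkin_seq.simps(2) mem_Collect_eq)
  have imp: "(\<phi> \<^bold>\<longrightarrow> \<psi>) \<in> \<Delta> \<longleftrightarrow> (\<phi> \<in> \<Delta> \<longrightarrow> \<psi> \<in> \<Delta>)" if "wf_fm [] \<phi>" "wf_fm [] \<psi>" for \<phi> \<psi>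
    using that complete mp prov proves_K[of \<psi> \<phi> T] proves_exfalso[of \<phi> \<psi> T] by metis
  have all: "Forall \<sigma> \<phi> \<in> \<Delta> \<longleftrightarrow> (\<forall>t. typ_of [] t = Some \<sigma> \<longrightarrow> inst_fm 0 t \<phi> \<in> \<Delta>)"
    if wf: "wf_fm [] (Forall \<sigma> \<phi>)" for \<sigma> \<phi>
  proof
    assume "Forall \<sigma> \<phi> \<in> \<Delta>"
    then show "\<forall>t. typ_of [] t = Some \<sigma> \<longrightarrow> inst_fm 0 t \<phi> \<in> \<Delta>"
      using mp prov proves_all_E[OF wf] by blast
  next
    assume *: "\<forall>t. typ_of [] t = Some \<sigma> \<longrightarrow> inst_fm 0 t \<phi> \<in> \<Delta>"
    show "Forall \<sigma> \<phi> \<in> \<Delta>"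
    proof (rule ccontr)
      assume "Forall \<sigma> \<phi> \<notin> \<Delta>"
      let ?\<theta> = "\<^bold>\<not> Forall \<sigma> \<phi>"
      have in\<Delta>: "?\<theta> \<in> \<Delta>" using complete[OF wf] \<open>Forall \<sigma> \<phi> \<notin> \<Delta>\<close> by blast
      \<comment> \<open>The stage at which this negated universal formula is examined. It cannot be
        rejected there, since its negation would then belong to \<open>\<Delta>\<close> too; hence
        it received a witness.\<close>
      define n where "n = to_nat ?\<theta>"
      let ?\<chi> = "?h n \<^bold>\<and> ?\<theta>"
      have "\<not> (T \<turnstile> ?\<chi> \<^bold>\<longrightarrow> Falsum)"
      proof
        assume "T \<turnstile> ?\<chi> \<^bold>\<longrightarrow> Falsum"
        from proves_neg_conj[OF this] have "(\<^bold>\<not> ?\<theta>) \<in> \<Delta>" unfolding \<Delta>_def by blast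
        then show False using in\<Delta> mp bot unfolding Neg_def[of ?\<theta>] by blast
      qed
      then have h: "?h (Suc n) = henkin_witness ?\<chi> ?\<theta>" and c: "consistent T ?\<chi>"
        using wf wfh by (simp_all add: henkin_step_def n_def consistent_def)
      have "T \<turnstile> ?\<chi> \<^bold>\<longrightarrow> ?\<theta>" by (rule proves_conjD2) (use wf wfh in simp_all)
      from henkin_witness_Forall[OF c this] obtain v where
        v: "snd v = \<sigma>" "?h (Suc n) = (?\<chi> \<^bold>\<and> \<^bold>\<not> inst_fm 0 (V v) \<phi>)" "wf_fm [] (inst_fm 0 (V v) \<phi>)"
        unfolding h by metis
      have "T \<turnstile> ?h (Suc n) \<^bold>\<longrightarrow> \<^bold>\<not> inst_fm 0 (V v) \<phi>"
        unfolding v(2) by (rule proves_conjD2) (use wf wfh v(3) in simp_all)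
      then have "(\<^bold>\<not> inst_fm 0 (V v) \<phi>) \<in> \<Delta>" unfolding \<Delta>_def by blast
      moreover have "inst_fm 0 (V v) \<phi> \<in> \<Delta>" using * v(1) by simp
      ultimately show False using mp bot unfolding Neg_def by blast
    qed
  qed
  have "\<chi> \<in> \<Delta>" unfolding \<Delta>_def using mono[of 0 0] by (auto intro: exI[of _ 0])
  moreover have "henkin T \<Delta>" unfolding henkin_def using prov bot imp all by blast
  ultimately show ?thesis using that by blast
qed

section \<open>Applicative structures\<close>

text \<open>All types share one carrier and one application. Domains of different types may overlap,
  and application off the domains is arbitrary; only the membership conditions in quantifiers and
  environments keep the types apart.\<close>

locale applicative_structure =
  fixes D :: "ty \<Rightarrow> 'a set" and ap :: "'a \<Rightarrow> 'a \<Rightarrow> 'a" (infixl "\<cdot>" 90)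
    and I :: "tm \<Rightarrow> 'a" and lt :: "'a \<Rightarrow> 'a \<Rightarrow> bool"
begin

primrec eval :: "(var \<Rightarrow> 'a) \<Rightarrow> 'a list \<Rightarrow> tm \<Rightarrow> 'a"
  where
    "eval e bs (V v) = e v"
  | "eval e bs (Bound i) = bs ! i"
  | "eval e bs (s \<^bold>\<cdot> t) = eval e bs s \<cdot> eval e bs t"
  | "eval e bs Zero = I Zero"
  | "eval e bs One = I One"
  | "eval e bs Plus = I Plus"
  | "eval e bs Times = I Times"
  | "eval e bs (Pi_c \<sigma> \<tau>) = I (Pi_c \<sigma> \<tau>)"
  | "eval e bs (Sigma_c \<rho> \<sigma> \<tau>) = I (Sigma_c \<rho> \<sigma> \<tau>)"
  | "eval e bs (Rec \<sigma>) = I (Rec \<sigma>)"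

primrec sat :: "(var \<Rightarrow> 'a) \<Rightarrow> 'a list \<Rightarrow> fm \<Rightarrow> bool"
  where
    "sat e bs (s \<^bold>= t) \<longleftrightarrow> eval e bs s = eval e bs t"
  | "sat e bs (s \<^bold>< t) \<longleftrightarrow> lt (eval e bs s) (eval e bs t)"
  | "sat e bs Falsum \<longleftrightarrow> False"
  | "sat e bs (\<phi> \<^bold>\<longrightarrow> \<psi>) \<longleftrightarrow> (sat e bs \<phi> \<longrightarrow> sat e bs \<psi>)"
  | "sat e bs (Forall \<sigma> \<phi>) \<longleftrightarrow> (\<forall>a\<in>D \<sigma>. sat e (a # bs) \<phi>)"

definition env :: "(var \<Rightarrow> 'a) \<Rightarrow> bool"
  where "env e \<longleftrightarrow> (\<forall>v. e v \<in> D (snd v))"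

lemma envD: "env e \<Longrightarrow> e v \<in> D (snd v)"
  unfolding env_def by blast

lemma env_upd [simp]: "env e \<Longrightarrow> a \<in> D (snd v) \<Longrightarrow> env (e(v := a))"
  unfolding env_def by (metis fun_upd_apply)

lemma sat_connectives [simp]:
  "sat e bs (\<^bold>\<not> \<phi>) \<longleftrightarrow> \<not> sat e bs \<phi>"
  "sat e bs (\<phi> \<^bold>\<and> \<psi>) \<longleftrightarrow> sat e bs \<phi> \<and> sat e bs \<psi>"
  "sat e bs (\<phi> \<^bold>\<or> \<psi>) \<longleftrightarrow> sat e bs \<phi> \<or> sat e bs \<psi>"
  "sat e bs (\<phi> \<^bold>\<longleftrightarrow> \<psi>) \<longleftrightarrow> (sat e bs \<phi> \<longleftrightarrow> sat e bs \<psi>)"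
  "sat e bs (Exists \<sigma> \<phi>) \<longleftrightarrow> (\<exists>a\<in>D \<sigma>. sat e (a # bs) \<phi>)"
  by (auto simp: Neg_def Conj_def Disj_def Iff_def Exists_def)

lemma eval_bind: "lc_tm k t \<Longrightarrow> length bs = k \<Longrightarrow>
    eval e (bs @ [a]) (subst_tm v (Bound k) t) = eval (e(v := a)) bs t"
  by (induction t) (auto simp: nth_append)

lemma sat_bind: "lc_fm k \<phi> \<Longrightarrow> length bs = k \<Longrightarrow>
    sat e (bs @ [a]) (bind_fm k v \<phi>) = sat (e(v := a)) bs \<phi>"
proof (induction \<phi> arbitrary: k bs)
  case (Forall \<sigma> \<phi>)
  have "sat e ((b # bs) @ [a]) (bind_fm (Suc k) v \<phi>) = sat (e(v := a)) (b # bs) \<phi>" for b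
    by (rule Forall.IH) (use Forall.prems in auto)
  then show ?case by (simp del: fun_upd_apply)
qed (auto simp: eval_bind)

lemma sat_all_v [simp]: "lc_fm 0 \<phi> \<Longrightarrow> sat e [] (all_v v \<phi>) \<longleftrightarrow> (\<forall>a\<in>D (snd v). sat (e(v := a)) [] \<phi>)"
  using sat_bind[of 0 \<phi> "[]"] by (simp add: all_v_def)

lemma sat_ex_v [simp]: "lc_fm 0 \<phi> \<Longrightarrow> sat e [] (ex_v v \<phi>) \<longleftrightarrow> (\<exists>a\<in>D (snd v). sat (e(v := a)) [] \<phi>)"
  using sat_bind[of 0 \<phi> "[]"] by (simp add: ex_v_def)

lemma eval_lc: "lc_tm 0 t \<Longrightarrow> eval e (b # bs) t = eval e [] t"
  by (induction t) auto

lemma eval_subst: "lc_tm 0 u \<Longrightarrow> eval e bs (subst_tm v u t) = eval (e(v := eval e [] u)) bs t"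
proof (induction t)
  case (V w)
  then show ?case by (cases bs) (auto simp: eval_lc)
qed auto

lemma sat_subst: "lc_tm 0 u \<Longrightarrow> sat e bs (subst_fm v u \<phi>) = sat (e(v := eval e [] u)) bs \<phi>"
  by (induction \<phi> arbitrary: bs) (auto simp: eval_subst)

lemma eval_cong: "(\<And>v. v \<in> vars_tm t \<Longrightarrow> e v = e' v) \<Longrightarrow> eval e bs t = eval e' bs t"
  by (induction t) auto

lemma sat_cong: "(\<And>v. v \<in> vars_fm \<phi> \<Longrightarrow> e v = e' v) \<Longrightarrow> sat e bs \<phi> = sat e' bs \<phi>"
proof (induction \<phi> arbitrary: bs)
  case (Eq s t)
  then show ?case using eval_cong[of s e e'] eval_cong[of t e e'] by simp
next
  case (Less s t)
  then show ?case using eval_cong[of s e e'] eval_cong[of t e e'] by simp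
qed auto

end

section \<open>Local closedness of defined formulas and equality at higher types\<close>

lemma lc_connectives [simp]:
  "lc_fm k (\<^bold>\<not> \<phi>) \<longleftrightarrow> lc_fm k \<phi>"
  "lc_fm k (\<phi> \<^bold>\<and> \<psi>) \<longleftrightarrow> lc_fm k \<phi> \<and> lc_fm k \<psi>"
  "lc_fm k (\<phi> \<^bold>\<or> \<psi>) \<longleftrightarrow> lc_fm k \<phi> \<and> lc_fm k \<psi>"
  "lc_fm k (\<phi> \<^bold>\<longleftrightarrow> \<psi>) \<longleftrightarrow> lc_fm k \<phi> \<and> lc_fm k \<psi>"
  "lc_fm k (Exists \<sigma> \<phi>) \<longleftrightarrow> lc_fm (Suc k) \<phi>"
  by (auto simp: Neg_def Conj_def Disj_def Iff_def Exists_def)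

lemma lc_bind_tm: "lc_tm k t \<Longrightarrow> lc_tm (Suc k) (subst_tm v (Bound k) t)"
  by (induction t) auto

lemma lc_bind_fm: "lc_fm k \<phi> \<Longrightarrow> lc_fm (Suc k) (bind_fm k v \<phi>)"
  by (induction \<phi> arbitrary: k) (auto simp: lc_bind_tm)

lemma lc_all_v [simp]: "lc_fm 0 \<phi> \<Longrightarrow> lc_fm 0 (all_v v \<phi>)"
  and lc_ex_v [simp]: "lc_fm 0 \<phi> \<Longrightarrow> lc_fm 0 (ex_v v \<phi>)"
  using lc_bind_fm[of 0] by (auto simp: all_v_def ex_v_def)

lemma typ_of_lift: "typ_of (\<sigma> # E) (lift_tm t) = typ_of E t"
  by (induction t) auto

lemma wf_eq_at: "typ_of E s = Some \<sigma> \<Longrightarrow> typ_of E t = Some \<sigma> \<Longrightarrow> wf_fm E (eq_at \<sigma> s t)"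
  by (induction \<sigma> arbitrary: E s t) (auto simp: typ_of_lift)

lemma lift_tm_lc: "lc_tm 0 t \<Longrightarrow> lift_tm t = t"
  by (induction t) auto

lemma inst_lift_tm: "lc_tm 0 u \<Longrightarrow> inst_tm (Suc k) u (lift_tm t) = lift_tm (inst_tm k u t)"
  by (induction t) (auto simp: lift_tm_lc)

lemma inst_eq_at: "lc_tm 0 u \<Longrightarrow> inst_fm k u (eq_at \<sigma> s t) = eq_at \<sigma> (inst_tm k u s) (inst_tm k u t)"
  by (induction \<sigma> arbitrary: k s t) (auto simp: inst_lift_tm)

lemma msub_lift_tm:
  "typed_env e \<Longrightarrow> lc_tm k t \<Longrightarrow> msub_tm e [] (Suc k) (lift_tm t) = lift_tm (msub_tm e [] k t)"
proof (induction t)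
  case (V v)
  then show ?case using typ_of_lc[OF typed_envD, of e v] by (simp add: lift_tm_lc)
qed auto

lemma lc_lift_tm: "lc_tm k t \<Longrightarrow> lc_tm (Suc k) (lift_tm t)"
  by (induction t) auto

lemma msub_eq_at: "typed_env e \<Longrightarrow> lc_tm k s \<Longrightarrow> lc_tm k t \<Longrightarrow>
    msub_fm e [] k (eq_at \<sigma> s t) = eq_at \<sigma> (msub_tm e [] k s) (msub_tm e [] k t)"
  by (induction \<sigma> arbitrary: k s t) (auto simp: msub_lift_tm lc_lift_tm)

abbreviation (input) is_const :: "tm \<Rightarrow> bool"
  where "is_const c \<equiv> (case c of V _ \<Rightarrow> False | Bound _ \<Rightarrow> False | _ \<^bold>\<cdot> _ \<Rightarrow> False | _ \<Rightarrow> True)"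

text \<open>The numbers fill the whole carrier, so that the laws of an ordered algebraic structure
  can be stated for it. Extensionality is required as identity, which makes \<open>eq_at\<close>
  coincide with equality of the carrier.\<close>

locale RCA0_omega_model = applicative_structure +
  assumes D_T0: "D T0 = UNIV"
    and ap_in_D: "f \<in> D (\<sigma> \<^bold>\<rightarrow> \<tau>) \<Longrightarrow> x \<in> D \<sigma> \<Longrightarrow> f \<cdot> x \<in> D \<tau>"
    and I_in_D: "is_const c \<Longrightarrow> typ_of [] c = Some \<sigma> \<Longrightarrow> I c \<in> D \<sigma>"
    and ext: "f \<in> D (\<sigma> \<^bold>\<rightarrow> \<tau>) \<Longrightarrow> g \<in> D (\<sigma> \<^bold>\<rightarrow> \<tau>) \<Longrightarrow> (\<And>x. x \<in> D \<sigma> \<Longrightarrow> f \<cdot> x = g \<cdot> x) \<Longrightarrow> f = g"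
    and valid: "\<phi> \<in> RCA0_omega \<Longrightarrow> wf_fm [] \<phi> \<Longrightarrow> env e \<Longrightarrow> sat e [] \<phi>"

section \<open>The term model of a Henkin set\<close>

definition Tm :: "ty \<Rightarrow> tm set"
  where "Tm \<sigma> = {t. typ_of [] t = Some \<sigma>}"

lemma Tm_App: "f \<in> Tm (\<sigma> \<^bold>\<rightarrow> \<tau>) \<Longrightarrow> t \<in> Tm \<sigma> \<Longrightarrow> f \<^bold>\<cdot> t \<in> Tm \<tau>"
  by (simp add: Tm_def)

lemma Tm_lc: "t \<in> Tm \<sigma> \<Longrightarrow> lc_tm 0 t"
  unfolding Tm_def using typ_of_lc by fastforce

locale henkin_set =
  fixes \<Delta> :: "fm set"
  assumes henkin: "henkin RCA0_omega \<Delta>"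
begin

lemma thm_in: "RCA0_omega \<turnstile> \<phi> \<Longrightarrow> \<phi> \<in> \<Delta>"
  using henkin by (simp add: henkin_def)

lemma Falsum_notin: "Falsum \<notin> \<Delta>"
  using henkin by (simp add: henkin_def)

lemma Imp_in: "wf_fm [] (\<phi> \<^bold>\<longrightarrow> \<psi>) \<Longrightarrow> (\<phi> \<^bold>\<longrightarrow> \<psi>) \<in> \<Delta> \<longleftrightarrow> (\<phi> \<in> \<Delta> \<longrightarrow> \<psi> \<in> \<Delta>)"
  using henkin by (simp add: henkin_def)

lemma Forall_in: "wf_fm [] (Forall \<sigma> \<phi>) \<Longrightarrow> Forall \<sigma> \<phi> \<in> \<Delta> \<longleftrightarrow> (\<forall>t\<in>Tm \<sigma>. inst_fm 0 t \<phi> \<in> \<Delta>)"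
  using henkin by (simp add: henkin_def Tm_def)

lemma msub_all_v_in:
  assumes "wf_fm [] \<phi>" "typed_env e"
  shows "msub_fm e [] 0 (all_v v \<phi>) \<in> \<Delta> \<longleftrightarrow> (\<forall>t\<in>Tm (snd v). msub_fm (e(v := t)) [] 0 \<phi> \<in> \<Delta>)"
proof -
  have lc: "lc_fm 0 \<phi>" using wf_fm_lc[OF assms(1)] by simp
  have "wf_fm [] (msub_fm e [] 0 (all_v v \<phi>))"
    using msub_fm_wf[OF assms(2), of "[]" "[]" "[]"] assms(1) by simp
  moreover have "inst_fm 0 t (msub_fm e [] (Suc 0) (bind_fm 0 v \<phi>)) = msub_fm (e(v := t)) [] 0 \<phi>" for t
    using inst_msub_fm[OF assms(2), of "[]" "[]" 0] lc_bind_fm[OF lc] msub_bind_fm[OF lc] by simp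
  ultimately show ?thesis by (simp add: all_v_def Forall_in)
qed

text \<open>The instance is reached through the universal closure: the variables are instantiated
  one at a time, which turns the identity environment into \<open>e\<close> on the variables of
  \<open>\<phi>\<close>.\<close>

lemma msub_thm_in:
  assumes prov: "RCA0_omega \<turnstile> \<phi>" and e: "typed_env e"
  shows "msub_fm e [] 0 \<phi> \<in> \<Delta>"
proof -
  have wf: "wf_fm [] (foldr all_v vs \<phi>)" for vs
    by (induction vs) (use proves_wf[OF prov] in auto)
  have closure: "msub_fm e1 [] 0 \<phi> \<in> \<Delta>"
    if "typed_env e0" "typed_env e1" "msub_fm e0 [] 0 (foldr all_v vs \<phi>) \<in> \<Delta>" "\<forall>v. v \<notin> set vs \<longrightarrow> e1 v = e0 v"
    for vs e0 e1
    using that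
  proof (induction vs arbitrary: e0)
    case Nil
    then have "e1 = e0" by auto
    then show ?case using Nil by simp
  next
    case (Cons v vs)
    have "e1 v \<in> Tm (snd v)" using Cons.prems(2) unfolding Tm_def by (simp add: typed_envD)
    then have "msub_fm (e0(v := e1 v)) [] 0 (foldr all_v vs \<phi>) \<in> \<Delta>"
      using Cons.prems(3) msub_all_v_in[OF wf Cons.prems(1)] by simp
    moreover have "typed_env (e0(v := e1 v))"
      using typed_env_upd[OF Cons.prems(1)] typed_envD[OF Cons.prems(2)] by blast
    moreover have "\<forall>w. w \<notin> set vs \<longrightarrow> e1 w = (e0(v := e1 v)) w"
      using Cons.prems(4) by (metis fun_upd_apply set_ConsD)
    ultimately show ?case using Cons.IH Cons.prems(2) by blast
  qed
  obtain vs where vs: "set vs = vars_fm \<phi>" using finite_list[OF finite_vars_fm] by blast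
  have "RCA0_omega \<turnstile> foldr all_v vs \<phi>" by (induction vs) (use prov in \<open>auto intro: proves_all_v\<close>)
  moreover have "lc_fm 0 (foldr all_v vs \<phi>)" using wf_fm_lc[OF wf] by simp
  ultimately have V: "msub_fm V [] 0 (foldr all_v vs \<phi>) \<in> \<Delta>" by (simp add: msub_fm_V thm_in)
  \<comment> \<open>The closure covers finitely many names only, so \<open>e\<close> is cut down to
    the variables of the formula.\<close>
  let ?e = "\<lambda>v. if v \<in> vars_fm \<phi> then e v else V v"
  have "typed_env ?e" unfolding typed_env_def using typed_envD[OF e] by auto
  then have "msub_fm ?e [] 0 \<phi> \<in> \<Delta>" by (rule closure[OF typed_env_V _ V]) (simp add: vs)
  then show ?thesis by (simp add: msub_fm_cong[of \<phi> ?e e])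
qed

lemma axiom_in: "\<phi> \<in> RCA0_omega \<Longrightarrow> wf_fm [] \<phi> \<Longrightarrow> typed_env e \<Longrightarrow> msub_fm e [] 0 \<phi> \<in> \<Delta>"
  by (rule msub_thm_in) (simp_all add: proves_def derives.Ax)

lemma axiom3_in:
  assumes "\<phi> \<in> RCA0_omega" "wf_fm [] \<phi>" "s \<in> Tm T0" "t \<in> Tm T0" "u \<in> Tm T0"
  shows "msub_fm (V((''x'', T0) := s, (''y'', T0) := t, (''z'', T0) := u)) [] 0 \<phi> \<in> \<Delta>"
  using assms by (intro axiom_in typed_env_upd) (auto simp: Tm_def)

section \<open>Classes of terms that are equal according to the Henkin set\<close>

fun rel :: "ty \<Rightarrow> tm \<Rightarrow> tm \<Rightarrow> bool"
  where
    "rel T0 s t \<longleftrightarrow> (s \<^bold>= t) \<in> \<Delta>"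
  | "rel (\<sigma> \<^bold>\<rightarrow> \<tau>) s t \<longleftrightarrow> (\<forall>u\<in>Tm \<sigma>. rel \<tau> (s \<^bold>\<cdot> u) (t \<^bold>\<cdot> u))"

lemma eq_at_in: "s \<in> Tm \<sigma> \<Longrightarrow> t \<in> Tm \<sigma> \<Longrightarrow> eq_at \<sigma> s t \<in> \<Delta> \<longleftrightarrow> rel \<sigma> s t"
proof (induction \<sigma> arbitrary: s t)
  case (Fn \<sigma> \<tau>)
  have "wf_fm [] (eq_at (\<sigma> \<^bold>\<rightarrow> \<tau>) s t)" by (rule wf_eq_at) (use Fn.prems in \<open>auto simp: Tm_def\<close>)
  then have "eq_at (\<sigma> \<^bold>\<rightarrow> \<tau>) s t \<in> \<Delta> \<longleftrightarrow>
      (\<forall>u\<in>Tm \<sigma>. inst_fm 0 u (eq_at \<tau> (lift_tm s \<^bold>\<cdot> Bound 0) (lift_tm t \<^bold>\<cdot> Bound 0)) \<in> \<Delta>)"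
    by (simp add: Forall_in)
  also have "\<dots> \<longleftrightarrow> (\<forall>u\<in>Tm \<sigma>. eq_at \<tau> (s \<^bold>\<cdot> u) (t \<^bold>\<cdot> u) \<in> \<Delta>)"
    using Fn.prems[THEN Tm_lc] by (auto simp: inst_eq_at Tm_lc lift_tm_lc inst_tm_lc)
  also have "\<dots> \<longleftrightarrow> rel (\<sigma> \<^bold>\<rightarrow> \<tau>) s t" using Fn.IH(2) Fn.prems by (simp add: Tm_App)
  finally show ?case .
qed simp

lemma
  assumes "s \<in> Tm T0" "t \<in> Tm T0" "u \<in> Tm T0"
  shows rel_T0_refl: "(s \<^bold>= s) \<in> \<Delta>"
    and rel_T0_sym: "(s \<^bold>= t) \<in> \<Delta> \<Longrightarrow> (t \<^bold>= s) \<in> \<Delta>"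
    and rel_T0_trans: "(s \<^bold>= t) \<in> \<Delta> \<Longrightarrow> (t \<^bold>= u) \<in> \<Delta> \<Longrightarrow> (s \<^bold>= u) \<in> \<Delta>"
    and Less_cong1: "(s \<^bold>= t) \<in> \<Delta> \<Longrightarrow> (s \<^bold>< u) \<in> \<Delta> \<Longrightarrow> (t \<^bold>< u) \<in> \<Delta>"
    and Less_cong2: "(s \<^bold>= t) \<in> \<Delta> \<Longrightarrow> (u \<^bold>< s) \<in> \<Delta> \<Longrightarrow> (u \<^bold>< t) \<in> \<Delta>"
proof -
  let ?x = "V (''x'', T0)" and ?y = "V (''y'', T0)" and ?z = "V (''z'', T0)"
  note ax = axiom3_in[OF RCA0_omega.equality _ assms, unfolded equality_axioms_def]
  show "(s \<^bold>= s) \<in> \<Delta>" using ax[of "?x \<^bold>= ?x"] by simp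
  show "(s \<^bold>= t) \<in> \<Delta> \<Longrightarrow> (t \<^bold>= s) \<in> \<Delta>"
    using ax[of "?x \<^bold>= ?y \<^bold>\<longrightarrow> ?y \<^bold>= ?x"] assms by (simp add: Imp_in Tm_def)
  show "(s \<^bold>= t) \<in> \<Delta> \<Longrightarrow> (t \<^bold>= u) \<in> \<Delta> \<Longrightarrow> (s \<^bold>= u) \<in> \<Delta>"
    using ax[of "?x \<^bold>= ?y \<^bold>\<longrightarrow> ?y \<^bold>= ?z \<^bold>\<longrightarrow> ?x \<^bold>= ?z"] assms by (simp add: Imp_in Tm_def)
  show "(s \<^bold>= t) \<in> \<Delta> \<Longrightarrow> (s \<^bold>< u) \<in> \<Delta> \<Longrightarrow> (t \<^bold>< u) \<in> \<Delta>"
    using ax[of "?x \<^bold>= ?y \<^bold>\<longrightarrow> ?x \<^bold>< ?z \<^bold>\<longrightarrow> ?y \<^bold>< ?z"] assms by (simp add: Imp_in Tm_def)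
  show "(s \<^bold>= t) \<in> \<Delta> \<Longrightarrow> (u \<^bold>< s) \<in> \<Delta> \<Longrightarrow> (u \<^bold>< t) \<in> \<Delta>"
    using ax[of "?x \<^bold>= ?y \<^bold>\<longrightarrow> ?z \<^bold>< ?x \<^bold>\<longrightarrow> ?z \<^bold>< ?y"] assms by (simp add: Imp_in Tm_def)
qed

lemma rel_refl: "s \<in> Tm \<sigma> \<Longrightarrow> rel \<sigma> s s"
proof (induction \<sigma> arbitrary: s)
  case T0
  then show ?case using rel_T0_refl[of s s s] by simp
qed (auto simp: Tm_App)

lemma rel_sym: "s \<in> Tm \<sigma> \<Longrightarrow> t \<in> Tm \<sigma> \<Longrightarrow> rel \<sigma> s t \<Longrightarrow> rel \<sigma> t s"
proof (induction \<sigma> arbitrary: s t)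
  case T0
  then show ?case using rel_T0_sym[of s t s] by simp
qed (auto simp: Tm_App)

lemma rel_trans:
  "s \<in> Tm \<sigma> \<Longrightarrow> t \<in> Tm \<sigma> \<Longrightarrow> u \<in> Tm \<sigma> \<Longrightarrow> rel \<sigma> s t \<Longrightarrow> rel \<sigma> t u \<Longrightarrow> rel \<sigma> s u"
proof (induction \<sigma> arbitrary: s t u)
  case T0
  then show ?case using rel_T0_trans[of s t u] by simp
next
  case (Fn \<sigma> \<tau>)
  have "rel \<tau> (s \<^bold>\<cdot> v) (u \<^bold>\<cdot> v)" if "v \<in> Tm \<sigma>" for v
    by (rule Fn.IH(2)[of _ "t \<^bold>\<cdot> v"]) (use Fn.prems that in \<open>auto simp: Tm_App\<close>)
  then show ?case by simp
qed

text \<open>The extensionality axiom is what makes application well defined on classes of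
  terms.\<close>

lemma rel_ext:
  assumes f: "f \<in> Tm (\<rho> \<^bold>\<rightarrow> \<tau>)" and st: "s \<in> Tm \<rho>" "t \<in> Tm \<rho>" "rel \<rho> s t"
  shows "rel \<tau> (f \<^bold>\<cdot> s) (f \<^bold>\<cdot> t)"
proof -
  let ?x = "V (''x'', \<rho>)" and ?y = "V (''y'', \<rho>)" and ?f = "V (''f'', \<rho> \<^bold>\<rightarrow> \<tau>)"
  let ?e = "V((''x'', \<rho>) := s, (''y'', \<rho>) := t, (''f'', \<rho> \<^bold>\<rightarrow> \<tau>) := f)"
  let ?\<phi> = "eq_at \<rho> ?x ?y \<^bold>\<longrightarrow> eq_at \<tau> (?f \<^bold>\<cdot> ?x) (?f \<^bold>\<cdot> ?y)"
  have e: "typed_env ?e" using assms by (intro typed_env_upd) (auto simp: Tm_def)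
  have "msub_fm ?e [] 0 ?\<phi> \<in> \<Delta>"
    by (intro axiom_in RCA0_omega.extensionality e) (auto simp: wf_eq_at)
  then have "(eq_at \<rho> s t \<^bold>\<longrightarrow> eq_at \<tau> (f \<^bold>\<cdot> s) (f \<^bold>\<cdot> t)) \<in> \<Delta>"
    by (simp add: msub_eq_at[OF e])
  then show ?thesis using assms Imp_in wf_eq_at by (simp add: eq_at_in Tm_App Tm_def)
qed

lemma rel_App:
  assumes "f \<in> Tm (\<sigma> \<^bold>\<rightarrow> \<tau>)" "g \<in> Tm (\<sigma> \<^bold>\<rightarrow> \<tau>)" "rel (\<sigma> \<^bold>\<rightarrow> \<tau>) f g" "s \<in> Tm \<sigma>" "t \<in> Tm \<sigma>" "rel \<sigma> s t"
  shows "rel \<tau> (f \<^bold>\<cdot> s) (g \<^bold>\<cdot> t)"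
  using assms rel_ext[OF assms(1,4,5,6)] rel_trans[of "f \<^bold>\<cdot> s" \<tau> "f \<^bold>\<cdot> t" "g \<^bold>\<cdot> t"] by (simp add: Tm_App)

definition rep :: "ty \<Rightarrow> tm \<Rightarrow> tm"
  where "rep \<sigma> t = (SOME s. s \<in> Tm \<sigma> \<and> rel \<sigma> t s)"

lemma rep: assumes "t \<in> Tm \<sigma>" shows "rep \<sigma> t \<in> Tm \<sigma>" "rel \<sigma> t (rep \<sigma> t)"
  using someI[of "\<lambda>s. s \<in> Tm \<sigma> \<and> rel \<sigma> t s" t] assms rel_refl unfolding rep_def by blast+

text \<open>Related terms hand the same predicate to the choice operator, as \<open>rel\<close> is
  an equivalence on \<open>Tm\<close>. Hence \<open>rep\<close> picks one canonical member of each
  class.\<close>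

lemma rep_eq_iff:
  assumes "s \<in> Tm \<sigma>" "t \<in> Tm \<sigma>" shows "rep \<sigma> s = rep \<sigma> t \<longleftrightarrow> rel \<sigma> s t"
proof
  assume "rep \<sigma> s = rep \<sigma> t"
  then show "rel \<sigma> s t" using assms rep rel_sym rel_trans by metis
next
  assume "rel \<sigma> s t"
  then have "rel \<sigma> s u \<longleftrightarrow> rel \<sigma> t u" if "u \<in> Tm \<sigma>" for u
    using assms that rel_sym rel_trans by blast
  then show "rep \<sigma> s = rep \<sigma> t" unfolding rep_def by metis
qed

definition numbers :: "tm set"
  where "numbers = rep T0 ` Tm T0"

text \<open>Each numeral lies below the next one, and the order is transitive and irreflexive, so
  numerals fall into distinct classes. Infinitely many classes are needed to enumerate the numbers
  onto all of \<open>nat\<close>.\<close>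

lemma infinite_numbers: "infinite numbers"
proof -
  define num where "num = rec_nat Zero (\<lambda>_ t. t \<^bold>+ One)"
  have num: "num n \<in> Tm T0" for n
    by (induction n) (simp_all add: num_def Tm_def)
  have "(num n \<^bold>< num (Suc n)) \<in> \<Delta>" for n
  proof -
    let ?x = "V (''x'', T0)" and ?y = "V (''y'', T0)" and ?z = "V (''z'', T0)"
    have T: "Zero \<in> Tm T0" "One \<in> Tm T0" by (simp_all add: Tm_def)
    note order = axiom3_in[OF RCA0_omega.order, unfolded order_axioms_def]
    note semiring = axiom3_in[OF RCA0_omega.semiring, unfolded semiring_axioms_def]
    have "(Zero \<^bold>< One) \<in> \<Delta>" using order[of "Zero \<^bold>< One", OF _ _ T(1,1,1)] by simp
    then have "(Zero \<^bold>+ num n \<^bold>< One \<^bold>+ num n) \<in> \<Delta>"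
      using order[of "?x \<^bold>< ?y \<^bold>\<longrightarrow> ?x \<^bold>+ ?z \<^bold>< ?y \<^bold>+ ?z", OF _ _ T num[of n]] num[of n]
      by (simp add: Imp_in Tm_def)
    moreover have "(One \<^bold>+ num n \<^bold>= num n \<^bold>+ One) \<in> \<Delta>" "(Zero \<^bold>+ num n \<^bold>= num n \<^bold>+ Zero) \<in> \<Delta>"
      using semiring[of "?x \<^bold>+ ?y \<^bold>= ?y \<^bold>+ ?x", OF _ _ _ num[of n] T(1)] T by simp_all
    moreover have "(num n \<^bold>+ Zero \<^bold>= num n) \<in> \<Delta>"
      using semiring[of "?x \<^bold>+ Zero \<^bold>= ?x", OF _ _ num[of n] T(1) T(1)] by simp
    moreover have "Zero \<^bold>+ num n \<in> Tm T0" "One \<^bold>+ num n \<in> Tm T0" "num n \<^bold>+ Zero \<in> Tm T0" "num n \<^bold>+ One \<in> Tm T0"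
      using num[of n] by (simp_all add: Tm_def)
    ultimately have "(num n \<^bold>< num n \<^bold>+ One) \<in> \<Delta>"
      using Less_cong1[of "Zero \<^bold>+ num n"] Less_cong1[of "num n \<^bold>+ Zero"] Less_cong2[of "One \<^bold>+ num n"] num[of n]
      by meson
    then show ?thesis by (simp add: num_def)
  qed
  then have less: "(num m \<^bold>< num n) \<in> \<Delta>" if "m < n" for m n
  proof -
    let ?x = "V (''x'', T0)" and ?y = "V (''y'', T0)" and ?z = "V (''z'', T0)"
    have tr: "(s \<^bold>< u) \<in> \<Delta>" if "(s \<^bold>< t) \<in> \<Delta>" "(t \<^bold>< u) \<in> \<Delta>" "s \<in> Tm T0" "t \<in> Tm T0" "u \<in> Tm T0" for s t u
      using axiom3_in[OF RCA0_omega.order, unfolded order_axioms_def, of "?x \<^bold>< ?y \<^bold>\<longrightarrow> ?y \<^bold>< ?z \<^bold>\<longrightarrow> ?x \<^bold>< ?z", OF _ _ that(3-5)] that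
      by (simp add: Imp_in Tm_def)
    show ?thesis using that
      by (induction n) (use num tr \<open>\<And>n. (num n \<^bold>< num (Suc n)) \<in> \<Delta>\<close> less_Suc_eq in \<open>blast | auto\<close>)+
  qed
  have "(s \<^bold>< s) \<notin> \<Delta>" if "s \<in> Tm T0" for s
    using axiom3_in[OF RCA0_omega.order, unfolded order_axioms_def, of "\<^bold>\<not> V (''x'', T0) \<^bold>< V (''x'', T0)", OF _ _ that that that] that Falsum_notin
    by (simp add: Neg_def Imp_in Tm_def)
  then have "rep T0 (num m) \<noteq> rep T0 (num n)" if "m < n" for m n
    using less[OF that] num Less_cong2 rep_eq_iff rel.simps(1) rel_T0_sym by metis
  then have "inj (\<lambda>n. rep T0 (num n))"
    by (metis injI linorder_neqE_nat)
  then have "infinite (range (\<lambda>n. rep T0 (num n)))" using finite_imageD by blast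
  then show ?thesis unfolding numbers_def using num
    by (metis (no_types, lifting) finite_subset image_subset_iff imageI rangeE subsetI)
qed

text \<open>The type of the universe is \<^typ>\<open>nat\<close>: representatives of numbers are enumerated bijectively,
  so that the domain of type \<open>0\<close> is the whole type, and the other ones injectively.\<close>

definition cls :: "ty \<Rightarrow> tm \<Rightarrow> nat"
  where "cls \<sigma> t = (if \<sigma> = T0 then to_nat_on numbers (rep T0 t) else to_nat (rep \<sigma> t))"

lemma cls_eq_iff: "s \<in> Tm \<sigma> \<Longrightarrow> t \<in> Tm \<sigma> \<Longrightarrow> cls \<sigma> s = cls \<sigma> t \<longleftrightarrow> rel \<sigma> s t"
  using rep_eq_iff[of s \<sigma> t] inj_on_to_nat_on[of numbers]
  by (auto simp: cls_def numbers_def countableI_type inj_on_def simp del: rel.simps)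

lemma cls_T0_surj: "cls T0 ` Tm T0 = UNIV"
  using to_nat_on_infinite[OF countableI_type infinite_numbers]
  by (simp add: cls_def bij_betw_def numbers_def image_image)

text \<open>The code of a functional determines its representative and thereby its type, which tells
  at which type the code of the argument is to be read. The default 0 is not reached when both are
  codes of matching types.\<close>

definition app :: "nat \<Rightarrow> nat \<Rightarrow> nat"
  where "app f x = (case typ_of [] (from_nat f) of
      Some (\<sigma> \<^bold>\<rightarrow> \<tau>) \<Rightarrow> cls \<tau> (from_nat f \<^bold>\<cdot> (SOME t. t \<in> Tm \<sigma> \<and> cls \<sigma> t = x)) | _ \<Rightarrow> 0)"

lemma app_cls:
  assumes f: "f \<in> Tm (\<sigma> \<^bold>\<rightarrow> \<tau>)" and t: "t \<in> Tm \<sigma>"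
  shows "app (cls (\<sigma> \<^bold>\<rightarrow> \<tau>) f) (cls \<sigma> t) = cls \<tau> (f \<^bold>\<cdot> t)"
proof -
  define s where "s = (SOME s. s \<in> Tm \<sigma> \<and> cls \<sigma> s = cls \<sigma> t)"
  have s: "s \<in> Tm \<sigma>" "cls \<sigma> s = cls \<sigma> t"
    using someI[of "\<lambda>s. s \<in> Tm \<sigma> \<and> cls \<sigma> s = cls \<sigma> t" t] t unfolding s_def by blast+
  note r = rep[OF f]
  have "app (cls (\<sigma> \<^bold>\<rightarrow> \<tau>) f) (cls \<sigma> t) = cls \<tau> (rep (\<sigma> \<^bold>\<rightarrow> \<tau>) f \<^bold>\<cdot> s)"
    using r(1) unfolding app_def s_def by (simp add: cls_def Tm_def)
  also have "\<dots> = cls \<tau> (f \<^bold>\<cdot> t)"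
    using s t f r rel_App rel_sym cls_eq_iff by (simp add: Tm_App del: rel.simps)
  finally show ?thesis .
qed

definition const :: "tm \<Rightarrow> nat"
  where "const c = cls (the (typ_of [] c)) c"

definition less :: "nat \<Rightarrow> nat \<Rightarrow> bool"
  where "less m n \<longleftrightarrow> (\<exists>s\<in>Tm T0. \<exists>t\<in>Tm T0. m = cls T0 s \<and> n = cls T0 t \<and> (s \<^bold>< t) \<in> \<Delta>)"

lemma less_cls: "s \<in> Tm T0 \<Longrightarrow> t \<in> Tm T0 \<Longrightarrow> less (cls T0 s) (cls T0 t) \<longleftrightarrow> (s \<^bold>< t) \<in> \<Delta>"
  unfolding less_def using Less_cong1 Less_cong2 cls_eq_iff rel.simps(1) rel_T0_sym by metis

sublocale applicative_structure "\<lambda>\<sigma>. cls \<sigma> ` Tm \<sigma>" app const less .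

lemma eval_cls:
  assumes "typed_env e" "typed_list bs E"
  shows "typ_of E t = Some \<tau> \<Longrightarrow>
    eval (\<lambda>v. cls (snd v) (e v)) (map2 cls E bs) t = cls \<tau> (msub_tm e bs 0 t)"
proof (induction t arbitrary: \<tau>)
  case (Bound i)
  then show ?case using assms(2) by (auto simp: list_all2_conv_all_nth split: if_splits)
next
  case (App s t)
  from App.prems obtain \<sigma> where st: "typ_of E s = Some (\<sigma> \<^bold>\<rightarrow> \<tau>)" "typ_of E t = Some \<sigma>"
    by (auto simp del: typ_of.simps simp add: typ_of_App)
  then have "msub_tm e bs 0 s \<in> Tm (\<sigma> \<^bold>\<rightarrow> \<tau>)" "msub_tm e bs 0 t \<in> Tm \<sigma>"
    using msub_tm_typ[OF assms, of "[]"] by (simp_all add: Tm_def)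
  then show ?case using App.IH st app_cls by simp
qed (auto simp: const_def)

text \<open>The truth lemma. The stack of terms runs parallel to the stack of values, so the
  quantifier case instantiates with an arbitrary term and meets the Henkin condition for
  \<open>Forall\<close>.\<close>

lemma sat_cls:
  assumes "typed_env e"
  shows "typed_list bs E \<Longrightarrow> wf_fm E \<phi> \<Longrightarrow>
    sat (\<lambda>v. cls (snd v) (e v)) (map2 cls E bs) \<phi> \<longleftrightarrow> msub_fm e bs 0 \<phi> \<in> \<Delta>"
proof (induction \<phi> arbitrary: bs E)
  case (Eq s t)
  then have "msub_tm e bs 0 s \<in> Tm T0" "msub_tm e bs 0 t \<in> Tm T0"
    using msub_tm_typ[OF assms Eq.prems(1), of "[]"] by (simp_all add: Tm_def)
  then show ?case using Eq.prems eval_cls[OF assms Eq.prems(1)] by (simp add: cls_eq_iff)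
next
  case (Less s t)
  then have "msub_tm e bs 0 s \<in> Tm T0" "msub_tm e bs 0 t \<in> Tm T0"
    using msub_tm_typ[OF assms Less.prems(1), of "[]"] by (simp_all add: Tm_def)
  then show ?case using Less.prems eval_cls[OF assms Less.prems(1)] by (simp add: less_cls)
next
  case Falsum
  then show ?case by (simp add: Falsum_notin)
next
  case (Imp \<phi> \<psi>)
  then show ?case using msub_fm_wf[OF assms Imp.prems(1), of "[]"] by (simp add: Imp_in)
next
  case (Forall \<sigma> \<phi>)
  have "sat (\<lambda>v. cls (snd v) (e v)) (cls \<sigma> t # map2 cls E bs) \<phi> \<longleftrightarrow> inst_fm 0 t (msub_fm e bs 1 \<phi>) \<in> \<Delta>"
    if "t \<in> Tm \<sigma>" for t
  proof -
    have "typed_list (t # bs) (\<sigma> # E)" using that Forall.prems by (simp add: Tm_def)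
    moreover have "lc_fm (Suc (length E)) \<phi>" using wf_fm_lc Forall.prems(2) by fastforce
    ultimately show ?thesis
      using Forall.IH[of "t # bs" "\<sigma> # E"] Forall.prems inst_msub_fm[OF assms Forall.prems(1), of 0] by simp
  qed
  moreover have "wf_fm [] (msub_fm e bs 0 (Forall \<sigma> \<phi>))"
    using msub_fm_wf[OF assms Forall.prems(1), of "[]" "Forall \<sigma> \<phi>"] Forall.prems(2) by (simp del: msub_fm.simps)
  ultimately show ?case by (simp add: Forall_in)
qed

lemma env_cls:
  assumes "env e" obtains e' where "typed_env e'" "e = (\<lambda>v. cls (snd v) (e' v))"
proof -
  have "\<forall>v. \<exists>t. typ_of [] t = Some (snd v) \<and> e v = cls (snd v) t"
    using envD[OF assms] by (fastforce simp: Tm_def)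
  then obtain e' where "\<forall>v. typ_of [] (e' v) = Some (snd v) \<and> e v = cls (snd v) (e' v)" by metis
  then show ?thesis by (intro that[of e']) (auto simp: typed_env_def)
qed

sublocale RCA0_omega_model "\<lambda>\<sigma>. cls \<sigma> ` Tm \<sigma>" app const less
proof
  show "cls T0 ` Tm T0 = UNIV" by (rule cls_T0_surj)
next
  fix f \<sigma> \<tau> x assume "f \<in> cls (\<sigma> \<^bold>\<rightarrow> \<tau>) ` Tm (\<sigma> \<^bold>\<rightarrow> \<tau>)" "x \<in> cls \<sigma> ` Tm \<sigma>"
  then show "app f x \<in> cls \<tau> ` Tm \<tau>" by (auto simp: app_cls Tm_App)
next
  fix c \<sigma> assume "is_const c" "typ_of [] c = Some \<sigma>"
  then show "const c \<in> cls \<sigma> ` Tm \<sigma>" by (auto simp: const_def Tm_def)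
next
  fix f g \<sigma> \<tau>
  assume "f \<in> cls (\<sigma> \<^bold>\<rightarrow> \<tau>) ` Tm (\<sigma> \<^bold>\<rightarrow> \<tau>)" "g \<in> cls (\<sigma> \<^bold>\<rightarrow> \<tau>) ` Tm (\<sigma> \<^bold>\<rightarrow> \<tau>)"
    and eq: "\<And>x. x \<in> cls \<sigma> ` Tm \<sigma> \<Longrightarrow> app f x = app g x"
  then obtain s t where s: "s \<in> Tm (\<sigma> \<^bold>\<rightarrow> \<tau>)" "f = cls (\<sigma> \<^bold>\<rightarrow> \<tau>) s"
    and t: "t \<in> Tm (\<sigma> \<^bold>\<rightarrow> \<tau>)" "g = cls (\<sigma> \<^bold>\<rightarrow> \<tau>) t" by blast
  have "rel \<tau> (s \<^bold>\<cdot> u) (t \<^bold>\<cdot> u)" if "u \<in> Tm \<sigma>" for u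
    using eq[of "cls \<sigma> u"] that s t cls_eq_iff[of "s \<^bold>\<cdot> u" \<tau> "t \<^bold>\<cdot> u"] by (simp add: app_cls Tm_App)
  then show "f = g" using s t cls_eq_iff by simp
next
  fix \<phi> e assume \<phi>: "\<phi> \<in> RCA0_omega" "wf_fm [] \<phi>" and e: "env e"
  from e obtain e' where "typed_env e'" "e = (\<lambda>v. cls (snd v) (e' v))" by (rule env_cls)
  then show "sat e [] \<phi>" using sat_cls[of e' "[]" "[]"] axiom_in \<phi> by simp
qed

end

text \<open>An unprovable formula is refuted in the term model of a Henkin set containing its
  negation, under the environment that names each variable by itself. As the language is countable,
  models on \<open>nat\<close> suffice, and the hypothesis can be stated for one fixed
  carrier.\<close>

theorem RCA0_omega_complete:
  assumes "wf_fm [] \<phi>"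
    and model: "\<And>D ap I lt e. RCA0_omega_model (D :: ty \<Rightarrow> nat set) ap I lt \<Longrightarrow>
      applicative_structure.env D e \<Longrightarrow> applicative_structure.sat D ap I lt e [] \<phi>"
  shows "RCA0_omega \<turnstile> \<phi>"
proof (rule ccontr)
  assume not: "\<not> (RCA0_omega \<turnstile> \<phi>)"
  have "consistent RCA0_omega (\<^bold>\<not> \<phi>)"
    unfolding consistent_def using assms(1) not proves_mp[OF proves_dneg[OF assms(1)]]
    by (auto simp: Neg_def)
  then obtain \<Delta> where \<Delta>: "henkin RCA0_omega \<Delta>" "(\<^bold>\<not> \<phi>) \<in> \<Delta>" by (rule henkin_extension)
  interpret henkin_set \<Delta> by unfold_locales (rule \<Delta>)
  have "lc_fm 0 \<phi>" using wf_fm_lc[OF assms(1)] by simp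
  then have "sat (\<lambda>v. cls (snd v) (V v)) [] (\<^bold>\<not> \<phi>)"
    using sat_cls[OF typed_env_V, of "[]" "[]" "\<^bold>\<not> \<phi>"] assms(1) \<Delta>(2) by (simp add: msub_fm_V del: sat_connectives)
  moreover have "sat (\<lambda>v. cls (snd v) (V v)) [] \<phi>"
    by (rule model[OF RCA0_omega_model_axioms]) (unfold env_def, simp add: Tm_def)
  ultimately show False by simp
qed

section \<open>Arithmetic in a model\<close>

declare lam.simps [simp del]

lemma typ_of_closed: "typ_of [] t = Some \<tau> \<Longrightarrow> typ_of E t = Some \<tau>"
  using typ_of_weaken[of "[]" t \<tau> E] by simp

lemma typ_of_lam: "typ_of [] t = Some \<tau> \<Longrightarrow> typ_of E (lam v t) = Some (snd v \<^bold>\<rightarrow> \<tau>)"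
proof (rule typ_of_closed, induction t arbitrary: \<tau>)
  case (App s t)
  then obtain \<sigma> where "typ_of [] s = Some (\<sigma> \<^bold>\<rightarrow> \<tau>)" "typ_of [] t = Some \<sigma>"
    by (auto simp del: typ_of.simps simp add: typ_of_App)
  with App.IH show ?case by (simp add: lam.simps)
qed (auto simp: lam.simps)

lemma lc_lam: "typ_of [] t = Some \<tau> \<Longrightarrow> lc_tm k (lam v t)"
  by (rule lc_tm_mono[OF typ_of_lc[OF typ_of_lam, of t \<tau> "[]" v]]) simp_all

lemma vars_lam: "vars_tm (lam v t) = vars_tm t - {v}"
  by (induction t) (auto simp: lam.simps)

lemma typ_of_subst:
  assumes "typ_of [] u = Some (snd v)"
  shows "typ_of E t = Some \<tau> \<Longrightarrow> typ_of E (subst_tm v u t) = Some \<tau>"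
proof (induction t arbitrary: \<tau>)
  case (V w)
  then show ?case using typ_of_closed[OF assms, of E] by auto
qed (auto simp del: typ_of.simps(10) simp add: typ_of_App, blast?)

lemma wf_fm_subst: "typ_of [] u = Some (snd v) \<Longrightarrow> wf_fm E \<phi> \<Longrightarrow> wf_fm E (subst_fm v u \<phi>)"
  by (induction \<phi> arbitrary: E) (auto simp: typ_of_subst)

lemma wf_ex_v [simp]: "wf_fm [] \<phi> \<Longrightarrow> wf_fm [] (ex_v v \<phi>)"
  using wf_fm_bind[of "[]"] by (simp add: ex_v_def Exists_def)

lemma wf_connectives [simp]:
  "wf_fm E (\<phi> \<^bold>\<or> \<psi>) \<longleftrightarrow> wf_fm E \<phi> \<and> wf_fm E \<psi>"
  "wf_fm E (\<phi> \<^bold>\<longleftrightarrow> \<psi>) \<longleftrightarrow> wf_fm E \<phi> \<and> wf_fm E \<psi>"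
  "wf_fm E (Exists \<sigma> \<phi>) \<longleftrightarrow> wf_fm (\<sigma> # E) \<phi>"
  by (auto simp: Disj_def Iff_def Exists_def)

lemma qf_connectives [simp]:
  "quantifier_free (\<^bold>\<not> \<phi>) \<longleftrightarrow> quantifier_free \<phi>"
  "quantifier_free (\<phi> \<^bold>\<and> \<psi>) \<longleftrightarrow> quantifier_free \<phi> \<and> quantifier_free \<psi>"
  "quantifier_free (\<phi> \<^bold>\<or> \<psi>) \<longleftrightarrow> quantifier_free \<phi> \<and> quantifier_free \<psi>"
  by (auto simp: Neg_def Conj_def Disj_def)

lemma typ_of_closed_tms [simp]:
  "typ_of E pred_tm = Some T1"
  "typ_of E monus_tm = Some (T0 \<^bold>\<rightarrow> T0 \<^bold>\<rightarrow> T0)"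
  "typ_of E exp2_tm = Some T1"
  "typ_of E tri_tm = Some T1"
  "typ_of E tri_root_tm = Some T1"
  "typ_of E snd_tm = Some T1"
  "typ_of E fst_tm = Some T1"
proof -
  show [simp]: "typ_of E pred_tm = Some T1" for E by (simp add: pred_tm_def typ_of_lam)
  show [simp]: "typ_of E monus_tm = Some (T0 \<^bold>\<rightarrow> T0 \<^bold>\<rightarrow> T0)" for E by (simp add: monus_tm_def typ_of_lam)
  show [simp]: "typ_of E exp2_tm = Some T1" for E by (simp add: exp2_tm_def typ_of_lam)
  show [simp]: "typ_of E tri_tm = Some T1" for E by (simp add: tri_tm_def typ_of_lam)
  show [simp]: "typ_of E tri_root_tm = Some T1" for E by (simp add: tri_root_tm_def typ_of_lam)
  show [simp]: "typ_of E snd_tm = Some T1" for E by (simp add: snd_tm_def typ_of_lam)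
  show [simp]: "typ_of E fst_tm = Some T1" for E by (simp add: fst_tm_def typ_of_lam)
qed

lemma lc_closed_tms [simp]:
  "lc_tm k pred_tm" "lc_tm k monus_tm" "lc_tm k exp2_tm" "lc_tm k tri_tm" "lc_tm k tri_root_tm"
  "lc_tm k snd_tm" "lc_tm k fst_tm"
  by (rule lc_tm_mono[OF typ_of_lc, of "[]"]; simp)+

lemma vars_closed_tms [simp]:
  "vars_tm pred_tm = {}" "vars_tm monus_tm = {}" "vars_tm exp2_tm = {}" "vars_tm tri_tm = {}"
  "vars_tm tri_root_tm = {}" "vars_tm snd_tm = {}" "vars_tm fst_tm = {}"
proof -
  show [simp]: "vars_tm pred_tm = {}" by (auto simp: pred_tm_def vars_lam)
  show [simp]: "vars_tm monus_tm = {}" by (auto simp: monus_tm_def vars_lam)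
  show [simp]: "vars_tm exp2_tm = {}" by (auto simp: exp2_tm_def vars_lam)
  show [simp]: "vars_tm tri_tm = {}" by (auto simp: tri_tm_def vars_lam)
  show [simp]: "vars_tm tri_root_tm = {}" by (auto simp: tri_root_tm_def vars_lam)
  show [simp]: "vars_tm snd_tm = {}" by (auto simp: snd_tm_def vars_lam)
  show [simp]: "vars_tm fst_tm = {}" by (auto simp: fst_tm_def vars_lam)
qed

context RCA0_omega_model
begin

lemma in_D_T0 [simp]: "a \<in> D T0"
  by (simp add: D_T0)

lemma D_nonempty: "\<exists>a. a \<in> D \<sigma>"
proof (induction \<sigma>)
  case (Fn \<sigma> \<tau>)
  then obtain a where "a \<in> D \<tau>" by blast
  moreover have "I (Pi_c \<tau> \<sigma>) \<in> D (\<tau> \<^bold>\<rightarrow> \<sigma> \<^bold>\<rightarrow> \<tau>)" by (rule I_in_D) simp_all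
  ultimately show ?case using ap_in_D by blast
qed simp

definition env0 :: "var \<Rightarrow> 'a"
  where "env0 v = (SOME a. a \<in> D (snd v))"

lemma env_env0 [simp]: "env env0"
  unfolding env_def env0_def using someI_ex[OF D_nonempty] by blast

lemma eval_in_D:
  assumes "env e" "list_all2 (\<lambda>b \<sigma>. b \<in> D \<sigma>) bs E"
  shows "typ_of E t = Some \<tau> \<Longrightarrow> eval e bs t \<in> D \<tau>"
proof (induction t arbitrary: \<tau>)
  case (V v)
  then show ?case using envD[OF assms(1), of v] by simp
next
  case (Bound i)
  then show ?case using assms(2) by (auto simp: list_all2_conv_all_nth split: if_splits)
next
  case (App s t)
  then obtain \<sigma> where "typ_of E s = Some (\<sigma> \<^bold>\<rightarrow> \<tau>)" "typ_of E t = Some \<sigma>"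
    by (auto simp del: typ_of.simps simp add: typ_of_App)
  with App.IH show ?case using ap_in_D by simp
qed (auto intro: I_in_D)

lemma eval_closed_in_D: "env e \<Longrightarrow> typ_of [] t = Some \<tau> \<Longrightarrow> eval e [] t \<in> D \<tau>"
  by (rule eval_in_D) simp_all

lemma eval_lift: "eval e (a # bs) (lift_tm t) = eval e bs t"
  by (induction t) auto

text \<open>By \<open>ext\<close>, the defined equality collapses to identity at every type.\<close>

lemma sat_eq_at:
  assumes "env e"
  shows "list_all2 (\<lambda>b \<sigma>. b \<in> D \<sigma>) bs E \<Longrightarrow> typ_of E s = Some \<sigma> \<Longrightarrow> typ_of E t = Some \<sigma> \<Longrightarrow>
    sat e bs (eq_at \<sigma> s t) \<longleftrightarrow> eval e bs s = eval e bs t"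
proof (induction \<sigma> arbitrary: bs E s t)
  case (Fn \<sigma> \<tau>)
  have "sat e (a # bs) (eq_at \<tau> (lift_tm s \<^bold>\<cdot> Bound 0) (lift_tm t \<^bold>\<cdot> Bound 0)) \<longleftrightarrow>
      eval e bs s \<cdot> a = eval e bs t \<cdot> a" if "a \<in> D \<sigma>" for a
    using Fn.IH(2)[of "a # bs" "\<sigma> # E"] Fn.prems that by (simp add: typ_of_lift eval_lift)
  moreover have "eval e bs s \<in> D (\<sigma> \<^bold>\<rightarrow> \<tau>)" "eval e bs t \<in> D (\<sigma> \<^bold>\<rightarrow> \<tau>)"
    using eval_in_D[OF assms Fn.prems(1)] Fn.prems by auto
  ultimately show ?case using ext by auto
qed simp

section \<open>Combinators and abstraction in a model\<close>

lemma Pi_ap: assumes "x \<in> D \<sigma>" "y \<in> D \<tau>" shows "I (Pi_c \<sigma> \<tau>) \<cdot> x \<cdot> y = x"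
proof -
  let ?e = "env0((''x'', \<sigma>) := x, (''y'', \<tau>) := y)"
  have "sat ?e [] (eq_at \<sigma> (Pi_c \<sigma> \<tau> \<^bold>\<cdot> V (''x'', \<sigma>) \<^bold>\<cdot> V (''y'', \<tau>)) (V (''x'', \<sigma>)))"
    by (rule valid[OF RCA0_omega.Pi_combinator]) (use assms in \<open>simp_all add: wf_eq_at\<close>)
  then show ?thesis using assms by (simp add: sat_eq_at[where E = "[]"])
qed

lemma Sigma_ap:
  assumes "x \<in> D (\<rho> \<^bold>\<rightarrow> \<sigma> \<^bold>\<rightarrow> \<tau>)" "y \<in> D (\<rho> \<^bold>\<rightarrow> \<sigma>)" "z \<in> D \<rho>"
  shows "I (Sigma_c \<rho> \<sigma> \<tau>) \<cdot> x \<cdot> y \<cdot> z = x \<cdot> z \<cdot> (y \<cdot> z)"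
proof -
  let ?x = "(''x'', \<rho> \<^bold>\<rightarrow> \<sigma> \<^bold>\<rightarrow> \<tau>)" and ?y = "(''y'', \<rho> \<^bold>\<rightarrow> \<sigma>)" and ?z = "(''z'', \<rho>)"
  let ?e = "env0(?x := x, ?y := y, ?z := z)"
  have "sat ?e [] (eq_at \<tau> (Sigma_c \<rho> \<sigma> \<tau> \<^bold>\<cdot> V ?x \<^bold>\<cdot> V ?y \<^bold>\<cdot> V ?z) (V ?x \<^bold>\<cdot> V ?z \<^bold>\<cdot> (V ?y \<^bold>\<cdot> V ?z)))"
    by (rule valid[OF RCA0_omega.Sigma_combinator[OF refl refl refl]]) (use assms in \<open>simp_all add: wf_eq_at\<close>)
  then show ?thesis using assms by (simp add: sat_eq_at[where E = "[]"])
qed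

lemma eval_lc': "lc_tm 0 t \<Longrightarrow> eval e bs t = eval e [] t"
  by (cases bs) (simp_all add: eval_lc)

text \<open>The beta rule. Together with typing it is all that is used of abstractions later, so
  their combinator terms stay folded.\<close>

lemma eval_lam:
  assumes "env e" "a \<in> D (snd v)" "typ_of [] t = Some \<tau>"
  shows "eval e bs (lam v t) \<cdot> a = eval (e(v := a)) [] t"
proof -
  \<comment> \<open>Constants, other variables and applications without \<open>v\<close> are all
    abstracted by the constant-function combinator.\<close>
  have const: "eval e [] (Pi_c (the (typ_of [] s)) (snd v) \<^bold>\<cdot> s) \<cdot> a = eval (e(v := a)) [] s"
    if "typ_of [] s = Some \<rho>" "v \<notin> vars_tm s" for s \<rho>
  proof -
    have "eval (e(v := a)) [] s = eval e [] s" using that(2) by (intro eval_cong) auto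
    then show ?thesis using that(1) Pi_ap[OF eval_closed_in_D[OF assms(1) that(1)] assms(2)] by simp
  qed
  have "eval e [] (lam v t) \<cdot> a = eval (e(v := a)) [] t"
    using assms(3)
  proof (induction t arbitrary: \<tau>)
    case (V w)
    show ?case
    proof (cases "w = v")
      case True
      let ?\<sigma> = "snd v"
      have "I (Pi_c ?\<sigma> (?\<sigma> \<^bold>\<rightarrow> ?\<sigma>)) \<in> D (?\<sigma> \<^bold>\<rightarrow> (?\<sigma> \<^bold>\<rightarrow> ?\<sigma>) \<^bold>\<rightarrow> ?\<sigma>)" "I (Pi_c ?\<sigma> ?\<sigma>) \<in> D (?\<sigma> \<^bold>\<rightarrow> ?\<sigma> \<^bold>\<rightarrow> ?\<sigma>)"
        by (rule I_in_D; simp)+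
      with True assms(2) show ?thesis by (simp add: lam.simps Sigma_ap Pi_ap ap_in_D)
    next
      case False
      with const[of "V w"] show ?thesis by (simp add: lam.simps)
    qed
  next
    case (App s t)
    from App.prems obtain \<sigma> where st: "typ_of [] s = Some (\<sigma> \<^bold>\<rightarrow> \<tau>)" "typ_of [] t = Some \<sigma>"
      by (auto simp del: typ_of.simps simp add: typ_of_App)
    show ?case
    proof (cases "v \<in> vars_tm (s \<^bold>\<cdot> t)")
      case True
      have "eval e [] (lam v s) \<in> D (snd v \<^bold>\<rightarrow> \<sigma> \<^bold>\<rightarrow> \<tau>)" "eval e [] (lam v t) \<in> D (snd v \<^bold>\<rightarrow> \<sigma>)"
        using st assms(1) by (simp_all add: eval_closed_in_D typ_of_lam)
      with True App.IH st assms(2) show ?thesis by (simp add: lam.simps Sigma_ap)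
    next
      case False
      with const[of "s \<^bold>\<cdot> t" \<tau>] App.prems show ?thesis by (simp only: lam.simps if_False simp_thms)
    qed
  qed (unfold lam.simps, (rule const, simp, simp)+)
  moreover have "eval e bs (lam v t) = eval e [] (lam v t)" by (rule eval_lc'[OF lc_lam[OF assms(3)]])
  ultimately show ?thesis by simp
qed

definition cl :: "tm \<Rightarrow> 'a"
  where "cl t = eval env0 [] t"

lemma eval_closed: "vars_tm t = {} \<Longrightarrow> lc_tm 0 t \<Longrightarrow> eval e bs t = cl t"
  unfolding cl_def using eval_lc' eval_cong by (metis empty_iff)

lemma eval_closed_tms [simp]:
  "eval e bs pred_tm = cl pred_tm" "eval e bs monus_tm = cl monus_tm" "eval e bs exp2_tm = cl exp2_tm"
  "eval e bs tri_tm = cl tri_tm" "eval e bs tri_root_tm = cl tri_root_tm"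
  "eval e bs snd_tm = cl snd_tm" "eval e bs fst_tm = cl fst_tm"
  by (rule eval_closed; simp)+

lemma eval_lam_upd: "v \<notin> vars_tm (lam w t) \<Longrightarrow> eval (e(v := a)) bs (lam w t) = eval e bs (lam w t)"
  by (rule eval_cong) auto

lemma cl_lam: "a \<in> D (snd v) \<Longrightarrow> typ_of [] t = Some \<tau> \<Longrightarrow> cl (lam v t) \<cdot> a = eval (env0(v := a)) [] t"
  unfolding cl_def by (rule eval_lam) simp_all

section \<open>The ordered semiring of numbers\<close>

definition zero ("\<zero>") where "\<zero> = I Zero"
definition one ("\<one>") where "\<one> = I One"
definition plus (infixl "\<oplus>" 65) where "a \<oplus> b = I Plus \<cdot> a \<cdot> b"
definition times (infixl "\<otimes>" 70) where "a \<otimes> b = I Times \<cdot> a \<cdot> b"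
definition monus (infixl "\<ominus>" 65) where "a \<ominus> b = cl monus_tm \<cdot> a \<cdot> b"
abbreviation less (infix "\<sqsubset>" 50) where "a \<sqsubset> b \<equiv> lt a b"
definition less_eq (infix "\<sqsubseteq>" 50) where "a \<sqsubseteq> b \<longleftrightarrow> a \<sqsubset> b \<or> a = b"
definition pred where "pred a = cl pred_tm \<cdot> a"
definition exp2 where "exp2 a = cl exp2_tm \<cdot> a"
definition tri where "tri a = cl tri_tm \<cdot> a"
definition tri_root where "tri_root a = cl tri_root_tm \<cdot> a"
definition proj1 where "proj1 a = cl fst_tm \<cdot> a"
definition proj2 where "proj2 a = cl snd_tm \<cdot> a"

text \<open>Folds evaluated terms into operations of the model. Where the equations of a defined
  operation are proved, its own folding is switched off.\<close>

lemmas eval_ops [simp] = zero_def[symmetric] one_def[symmetric] plus_def[symmetric] times_def[symmetric]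
  monus_def[symmetric] pred_def[symmetric] exp2_def[symmetric] tri_def[symmetric] tri_root_def[symmetric]
  proj1_def[symmetric] proj2_def[symmetric]

lemma axiom3:
  assumes "\<phi> \<in> RCA0_omega" "wf_fm [] \<phi>"
  shows "sat (env0((''x'', T0) := a, (''y'', T0) := b, (''z'', T0) := c)) [] \<phi>"
  using assms by (intro valid) simp_all

lemma
  shows plus_assoc: "(a \<oplus> b) \<oplus> c = a \<oplus> (b \<oplus> c)"
    and plus_commute: "a \<oplus> b = b \<oplus> a"
    and plus_zero: "a \<oplus> \<zero> = a"
    and times_assoc: "(a \<otimes> b) \<otimes> c = a \<otimes> (b \<otimes> c)"
    and times_commute: "a \<otimes> b = b \<otimes> a"
    and times_one: "a \<otimes> \<one> = a"
    and times_zero: "a \<otimes> \<zero> = \<zero>"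
    and times_plus: "a \<otimes> (b \<oplus> c) = a \<otimes> b \<oplus> a \<otimes> c"
proof -
  let ?x = "V (''x'', T0)" and ?y = "V (''y'', T0)" and ?z = "V (''z'', T0)"
  note ax = axiom3[OF RCA0_omega.semiring, unfolded semiring_axioms_def, of _ a b c]
  show "(a \<oplus> b) \<oplus> c = a \<oplus> (b \<oplus> c)" using ax[of "(?x \<^bold>+ ?y) \<^bold>+ ?z \<^bold>= ?x \<^bold>+ (?y \<^bold>+ ?z)"] by simp
  show "a \<oplus> b = b \<oplus> a" using ax[of "?x \<^bold>+ ?y \<^bold>= ?y \<^bold>+ ?x"] by simp
  show "a \<oplus> \<zero> = a" using ax[of "?x \<^bold>+ Zero \<^bold>= ?x"] by simp
  show "(a \<otimes> b) \<otimes> c = a \<otimes> (b \<otimes> c)" using ax[of "(?x \<^bold>* ?y) \<^bold>* ?z \<^bold>= ?x \<^bold>* (?y \<^bold>* ?z)"] by simp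
  show "a \<otimes> b = b \<otimes> a" using ax[of "?x \<^bold>* ?y \<^bold>= ?y \<^bold>* ?x"] by simp
  show "a \<otimes> \<one> = a" using ax[of "?x \<^bold>* One \<^bold>= ?x"] by simp
  show "a \<otimes> \<zero> = \<zero>" using ax[of "?x \<^bold>* Zero \<^bold>= Zero"] by simp
  show "a \<otimes> (b \<oplus> c) = a \<otimes> b \<oplus> a \<otimes> c" using ax[of "?x \<^bold>* (?y \<^bold>+ ?z) \<^bold>= ?x \<^bold>* ?y \<^bold>+ ?x \<^bold>* ?z"] by simp
qed

lemma
  shows less_irrefl: "\<not> a \<sqsubset> a"
    and less_trans: "a \<sqsubset> b \<Longrightarrow> b \<sqsubset> c \<Longrightarrow> a \<sqsubset> c"
    and less_linear: "a \<sqsubset> b \<or> a = b \<or> b \<sqsubset> a"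
    and zero_less_one: "\<zero> \<sqsubset> \<one>"
    and plus_less_mono: "a \<sqsubset> b \<Longrightarrow> a \<oplus> c \<sqsubset> b \<oplus> c"
    and times_less_mono: "a \<sqsubset> b \<Longrightarrow> \<zero> \<sqsubset> c \<Longrightarrow> a \<otimes> c \<sqsubset> b \<otimes> c"
proof -
  let ?x = "V (''x'', T0)" and ?y = "V (''y'', T0)" and ?z = "V (''z'', T0)"
  note ax = axiom3[OF RCA0_omega.order, unfolded order_axioms_def, of _ a b c]
  show "\<not> a \<sqsubset> a" using ax[of "\<^bold>\<not> ?x \<^bold>< ?x"] by simp
  show "a \<sqsubset> b \<Longrightarrow> b \<sqsubset> c \<Longrightarrow> a \<sqsubset> c" using ax[of "?x \<^bold>< ?y \<^bold>\<longrightarrow> ?y \<^bold>< ?z \<^bold>\<longrightarrow> ?x \<^bold>< ?z"] by simp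
  show "a \<sqsubset> b \<or> a = b \<or> b \<sqsubset> a" using ax[of "?x \<^bold>< ?y \<^bold>\<or> ?x \<^bold>= ?y \<^bold>\<or> ?y \<^bold>< ?x"] by simp
  show "\<zero> \<sqsubset> \<one>" using ax[of "Zero \<^bold>< One"] by simp
  show "a \<sqsubset> b \<Longrightarrow> a \<oplus> c \<sqsubset> b \<oplus> c" using ax[of "?x \<^bold>< ?y \<^bold>\<longrightarrow> ?x \<^bold>+ ?z \<^bold>< ?y \<^bold>+ ?z"] by simp
  show "a \<sqsubset> b \<Longrightarrow> \<zero> \<sqsubset> c \<Longrightarrow> a \<otimes> c \<sqsubset> b \<otimes> c"
    using ax[of "?x \<^bold>< ?y \<^bold>\<longrightarrow> Zero \<^bold>< ?z \<^bold>\<longrightarrow> ?x \<^bold>* ?z \<^bold>< ?y \<^bold>* ?z"] by simp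
qed

lemma Rec_ap:
  assumes "f \<in> D (T0 \<^bold>\<rightarrow> T0 \<^bold>\<rightarrow> T0)"
  shows "I (Rec T0) \<cdot> f \<cdot> a \<cdot> \<zero> = a"
    and "I (Rec T0) \<cdot> f \<cdot> a \<cdot> (b \<oplus> \<one>) = f \<cdot> b \<cdot> (I (Rec T0) \<cdot> f \<cdot> a \<cdot> b)"
proof -
  let ?f = "(''f'', T0 \<^bold>\<rightarrow> T0 \<^bold>\<rightarrow> T0)"
  have "sat (env0(?f := f, vm := a, vn := b)) [] (Rec T0 \<^bold>\<cdot> V ?f \<^bold>\<cdot> V vm \<^bold>\<cdot> Zero \<^bold>= V vm)"
    "sat (env0(?f := f, vm := a, vn := b)) []
      (Rec T0 \<^bold>\<cdot> V ?f \<^bold>\<cdot> V vm \<^bold>\<cdot> (V vn \<^bold>+ One) \<^bold>= V ?f \<^bold>\<cdot> V vn \<^bold>\<cdot> (Rec T0 \<^bold>\<cdot> V ?f \<^bold>\<cdot> V vm \<^bold>\<cdot> V vn))"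
    by (rule valid[OF RCA0_omega.Rec_zero[OF refl refl]] valid[OF RCA0_omega.Rec_step[OF refl refl refl]];
        use assms in simp)+
  then show "I (Rec T0) \<cdot> f \<cdot> a \<cdot> \<zero> = a"
    "I (Rec T0) \<cdot> f \<cdot> a \<cdot> (b \<oplus> \<one>) = f \<cdot> b \<cdot> (I (Rec T0) \<cdot> f \<cdot> a \<cdot> b)" by simp_all
qed

text \<open>Recursion is available at type 0 only, but its step may use parameters of any type
  through \<open>e\<close>.\<close>

lemma Rec_lam:
  assumes "env e" "typ_of [] t = Some T0"
  shows "I (Rec T0) \<cdot> eval e bs (lam vi (lam vk t)) \<cdot> a \<cdot> \<zero> = a"
    and "I (Rec T0) \<cdot> eval e bs (lam vi (lam vk t)) \<cdot> a \<cdot> (b \<oplus> \<one>) =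
      eval (e(vi := b, vk := I (Rec T0) \<cdot> eval e bs (lam vi (lam vk t)) \<cdot> a \<cdot> b)) [] t"
proof -
  let ?f = "eval e bs (lam vi (lam vk t))"
  have t: "typ_of [] (lam vk t) = Some T1" using typ_of_lam[OF assms(2)] by simp
  have "eval e bs (lam vi (lam vk t)) = eval e [] (lam vi (lam vk t))"
    by (rule eval_lc') (rule lc_lam[OF t])
  then have "?f \<in> D (T0 \<^bold>\<rightarrow> T0 \<^bold>\<rightarrow> T0)"
    using eval_closed_in_D[OF assms(1) typ_of_lam[OF t, of "[]" vi]] by simp
  note R = Rec_ap[OF this]
  show "I (Rec T0) \<cdot> ?f \<cdot> a \<cdot> \<zero> = a" by (rule R)
  show "I (Rec T0) \<cdot> ?f \<cdot> a \<cdot> (b \<oplus> \<one>) =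
      eval (e(vi := b, vk := I (Rec T0) \<cdot> ?f \<cdot> a \<cdot> b)) [] t"
    unfolding R(2) by (simp add: eval_lam[OF _ _ t] eval_lam[OF _ _ assms(2)] assms(1))
qed

text \<open>The only induction on numbers of the model, which may be nonstandard. Each use must
  therefore exhibit a quantifier-free formula and place its parameters in the environment.\<close>

lemma qf_induct:
  assumes A: "quantifier_free A" "wf_fm [] A" and "snd n = T0" "env e"
    and "sat (e(n := \<zero>)) [] A" "\<And>a. sat (e(n := a)) [] A \<Longrightarrow> sat (e(n := a \<oplus> \<one>)) [] A"
  shows "sat (e(n := a)) [] A"
proof -
  have wf: "wf_fm [] (subst_fm n Zero A)" "wf_fm [] (subst_fm n (V n \<^bold>+ One) A)"
    using assms by (simp_all add: wf_fm_subst)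
  have lc: "lc_fm 0 A" "lc_fm 0 (subst_fm n (V n \<^bold>+ One) A)"
    using A(2) wf(2) wf_fm_lc[of "[]"] by simp_all
  have "sat e [] (induction_axiom n A)"
    by (rule valid[OF RCA0_omega.QF_induction]) (use assms wf in \<open>simp_all add: induction_axiom_def\<close>)
  then show ?thesis using assms lc by (simp add: induction_axiom_def sat_subst)
qed

section \<open>Recursion equations and truncated subtraction\<close>

lemma
  shows pred_zero: "pred \<zero> = \<zero>" and pred_Suc: "pred (a \<oplus> \<one>) = a"
  by (simp_all add: pred_def pred_tm_def cl_lam Rec_lam typ_of_lam eval_lam_upd vars_lam del: eval_ops(6))

lemma
  shows monus_zero: "a \<ominus> \<zero> = a" and monus_Suc: "a \<ominus> (b \<oplus> \<one>) = pred (a \<ominus> b)"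
  by (simp_all add: monus_def monus_tm_def cl_lam eval_lam Rec_lam typ_of_lam eval_lam_upd vars_lam del: eval_ops(5))

lemma
  shows exp2_zero: "exp2 \<zero> = \<one>" and exp2_Suc: "exp2 (a \<oplus> \<one>) = exp2 a \<oplus> exp2 a"
  by (simp_all add: exp2_def exp2_tm_def cl_lam eval_lam Rec_lam typ_of_lam eval_lam_upd vars_lam del: eval_ops(7))

lemma
  shows tri_zero: "tri \<zero> = \<zero>" and tri_Suc: "tri (a \<oplus> \<one>) = tri a \<oplus> (a \<oplus> \<one>)"
  by (simp_all add: tri_def tri_tm_def cl_lam eval_lam Rec_lam typ_of_lam eval_lam_upd vars_lam del: eval_ops(8))

lemma
  shows tri_root_zero: "tri_root \<zero> = \<zero>"
    and tri_root_Suc: "tri_root (a \<oplus> \<one>) =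
      tri_root a \<oplus> (\<one> \<ominus> (tri (tri_root a \<oplus> \<one>) \<ominus> (a \<oplus> \<one>)))"
  by (simp_all add: tri_root_def tri_root_tm_def cl_lam eval_lam Rec_lam typ_of_lam eval_lam_upd vars_lam del: eval_ops(9))

lemma proj2_eq: "proj2 a = a \<ominus> tri (tri_root a)"
  by (simp add: proj2_def snd_tm_def cl_lam del: eval_ops(11))

lemma proj1_eq: "proj1 a = tri_root a \<ominus> proj2 a"
  by (simp add: proj1_def fst_tm_def cl_lam del: eval_ops(10))

text \<open>The term \<open>pred_tm\<close> replaces the existential quantifier over predecessors,
  which makes the statement quantifier-free.\<close>

lemma zero_or_Suc: "a = \<zero> \<or> a = pred a \<oplus> \<one>"
  using qf_induct[of "V vn \<^bold>= Zero \<^bold>\<or> V vn \<^bold>= pred_tm \<^bold>\<cdot> V vn \<^bold>+ One" vn env0 a]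
  by (simp add: pred_Suc)

lemma less_Suc: "a \<sqsubset> a \<oplus> \<one>"
  using plus_less_mono[OF zero_less_one, of a] by (simp add: plus_zero plus_commute)

lemma not_less_zero: "\<not> a \<sqsubset> \<zero>"
  using qf_induct[of "\<^bold>\<not> V vn \<^bold>< Zero" vn env0 a] less_Suc less_trans less_irrefl by auto

lemma Suc_monus_Suc: "(a \<oplus> \<one>) \<ominus> (b \<oplus> \<one>) = a \<ominus> b"
  using qf_induct[of "monus_tm \<^bold>\<cdot> (V vm \<^bold>+ One) \<^bold>\<cdot> (V vn \<^bold>+ One) \<^bold>= monus_tm \<^bold>\<cdot> V vm \<^bold>\<cdot> V vn"
      vn "env0(vm := a)" b]
  by (simp add: monus_zero monus_Suc pred_Suc)

lemma plus_Suc: "a \<oplus> (b \<oplus> \<one>) = (a \<oplus> b) \<oplus> \<one>"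
  by (simp add: plus_assoc)

lemma plus_monus: "(a \<oplus> b) \<ominus> b = a"
  using qf_induct[of "monus_tm \<^bold>\<cdot> (V vm \<^bold>+ V vn) \<^bold>\<cdot> V vn \<^bold>= V vm" vn "env0(vm := a)" b]
  by (simp add: monus_zero plus_zero Suc_monus_Suc plus_Suc)

lemma zero_monus: "\<zero> \<ominus> a = \<zero>"
  using qf_induct[of "monus_tm \<^bold>\<cdot> Zero \<^bold>\<cdot> V vn \<^bold>= Zero" vn "env0" a]
  by (simp add: monus_zero monus_Suc pred_zero)

lemma monus_plus: "a \<ominus> (b \<oplus> a) = \<zero>"
  using qf_induct[of "monus_tm \<^bold>\<cdot> V vn \<^bold>\<cdot> (V vm \<^bold>+ V vn) \<^bold>= Zero" vn "env0(vm := b)" a]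
  by (simp add: zero_monus Suc_monus_Suc plus_Suc)

lemma monus_monus: "a \<ominus> b \<ominus> c = a \<ominus> (b \<oplus> c)"
  using qf_induct[of "monus_tm \<^bold>\<cdot> (monus_tm \<^bold>\<cdot> V vm \<^bold>\<cdot> V vk) \<^bold>\<cdot> V vn \<^bold>= monus_tm \<^bold>\<cdot> V vm \<^bold>\<cdot> (V vk \<^bold>+ V vn)"
      vn "env0(vm := a, vk := b)" c]
  by (simp add: monus_zero monus_Suc plus_Suc plus_zero)

text \<open>Induction on \<open>b\<close> needs the disjunction with \<open>a < b\<close>, the
  alternative that persists once \<open>b\<close> has passed \<open>a\<close>.\<close>

lemma plus_monus_inverse: "\<not> a \<sqsubset> b \<Longrightarrow> b \<oplus> (a \<ominus> b) = a"
proof -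
  have step: "(b \<oplus> \<one>) \<oplus> (a \<ominus> (b \<oplus> \<one>)) = a \<or> a \<sqsubset> b \<oplus> \<one>"
    if "b \<oplus> (a \<ominus> b) = a \<or> a \<sqsubset> b" for b
    using that
  proof
    assume "a \<sqsubset> b"
    then show ?thesis using less_trans[OF _ less_Suc] by blast
  next
    assume *: "b \<oplus> (a \<ominus> b) = a"
    from zero_or_Suc[of "a \<ominus> b"] show ?thesis
    proof
      assume "a \<ominus> b = \<zero>"
      then have "a = b" using * by (simp add: plus_zero)
      then show ?thesis using less_Suc by simp
    next
      assume c: "a \<ominus> b = pred (a \<ominus> b) \<oplus> \<one>"
      have "b \<oplus> (pred (a \<ominus> b) \<oplus> \<one>) = a" using * c by simp
      then show ?thesis by (simp add: monus_Suc plus_assoc plus_commute[of \<one>])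
    qed
  qed
  have "b \<oplus> (a \<ominus> b) = a \<or> a \<sqsubset> b"
    using qf_induct[of "V vn \<^bold>+ monus_tm \<^bold>\<cdot> V vm \<^bold>\<cdot> V vn \<^bold>= V vm \<^bold>\<or> V vm \<^bold>< V vn" vn "env0(vm := a)" b] step
    by (simp add: monus_zero plus_zero plus_commute[of \<zero>])
  then show "\<not> a \<sqsubset> b \<Longrightarrow> b \<oplus> (a \<ominus> b) = a" by blast
qed

end

text \<open>Possible because the numbers are the whole carrier. From here on the general laws of
  ordered semidomains do the algebra inside the model.\<close>

sublocale RCA0_omega_model \<subseteq> num: linordered_semidom plus monus less_eq lt zero times one
proof
  fix a b c
  show "a \<oplus> b \<oplus> c = a \<oplus> (b \<oplus> c)" by (rule plus_assoc)
  show "a \<oplus> b = b \<oplus> a" by (rule plus_commute)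
  show "a \<otimes> b \<otimes> c = a \<otimes> (b \<otimes> c)" by (rule times_assoc)
  show "a \<otimes> b = b \<otimes> a" by (rule times_commute)
  show "\<one> \<otimes> a = a" by (simp add: times_commute[of \<one>] times_one)
  show "\<zero> \<oplus> a = a" by (simp add: plus_commute[of \<zero>] plus_zero)
  show "(a \<oplus> b) \<otimes> c = a \<otimes> c \<oplus> b \<otimes> c" by (simp add: times_commute[of _ c] times_plus)
  show "a \<oplus> b \<ominus> a = b" by (simp add: plus_commute[of a] plus_monus)
  show "a \<ominus> b \<ominus> c = a \<ominus> (b \<oplus> c)" by (rule monus_monus)
  show "(\<zero> :: 'a) \<noteq> \<one>" using zero_less_one less_irrefl by auto
  show "\<zero> \<sqsubset> \<one>" by (rule zero_less_one)
  show "\<zero> \<otimes> a = \<zero>" by (simp add: times_commute[of \<zero>] times_zero)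
  show "a \<otimes> \<zero> = \<zero>" by (rule times_zero)
  have less_iff: "a \<sqsubset> b \<longleftrightarrow> a \<sqsubseteq> b \<and> \<not> b \<sqsubseteq> a" for a b
    unfolding less_eq_def using less_irrefl less_trans by blast
  then show "a \<sqsubset> b \<longleftrightarrow> a \<sqsubseteq> b \<and> \<not> b \<sqsubseteq> a" .
  show "a \<sqsubseteq> a" by (simp add: less_eq_def)
  show "a \<sqsubseteq> b \<Longrightarrow> b \<sqsubseteq> c \<Longrightarrow> a \<sqsubseteq> c" unfolding less_eq_def using less_trans by blast
  show "a \<sqsubseteq> b \<Longrightarrow> b \<sqsubseteq> a \<Longrightarrow> a = b" using less_iff less_eq_def by blast
  show "a \<sqsubseteq> b \<or> b \<sqsubseteq> a" unfolding less_eq_def using less_linear by blast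
  show "a \<sqsubseteq> b \<Longrightarrow> c \<oplus> a \<sqsubseteq> c \<oplus> b"
    unfolding less_eq_def using plus_less_mono[of a b c] by (auto simp: plus_commute)
  have times_mono: "a \<sqsubset> b \<Longrightarrow> \<zero> \<sqsubset> c \<Longrightarrow> c \<otimes> a \<sqsubset> c \<otimes> b" for a b c
    using times_less_mono[of a b c] by (simp add: times_commute)
  then show "a \<sqsubset> b \<Longrightarrow> \<zero> \<sqsubset> c \<Longrightarrow> c \<otimes> a \<sqsubset> c \<otimes> b" .
  show "b \<sqsubseteq> a \<Longrightarrow> a \<ominus> b \<oplus> b = a"
    using plus_monus_inverse[of a b] less_iff by (auto simp: plus_commute[of _ b])
  show "a \<otimes> (b \<oplus> c) = a \<otimes> b \<oplus> a \<otimes> c" by (rule times_plus)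
  \<comment> \<open>If \<open>b < c\<close>, both sides are truncated to zero; otherwise
    \<open>b\<close> is written as \<open>(b - c) + c\<close>.\<close>
  show "a \<otimes> (b \<ominus> c) = a \<otimes> b \<ominus> a \<otimes> c"
  proof (cases "b \<sqsubset> c")
    case True
    then have "\<not> c \<sqsubset> b" using less_trans less_irrefl by blast
    from plus_monus_inverse[OF this] have c: "c = (c \<ominus> b) \<oplus> b" by (simp add: plus_commute)
    have "a \<otimes> b \<ominus> a \<otimes> ((c \<ominus> b) \<oplus> b) = \<zero>" by (simp add: times_plus monus_plus)
    moreover have "b \<ominus> ((c \<ominus> b) \<oplus> b) = \<zero>" by (rule monus_plus)
    ultimately show ?thesis using c times_zero by metis
  next
    case False
    from plus_monus_inverse[OF this] have b: "(b \<ominus> c) \<oplus> c = b" by (simp add: plus_commute)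
    have "a \<otimes> ((b \<ominus> c) \<oplus> c) \<ominus> a \<otimes> c = a \<otimes> (b \<ominus> c)" by (simp add: times_plus plus_monus)
    then show ?thesis by (simp add: b)
  qed
  show "a \<noteq> \<zero> \<Longrightarrow> b \<noteq> \<zero> \<Longrightarrow> a \<otimes> b \<noteq> \<zero>"
  proof -
    assume "a \<noteq> \<zero>" "b \<noteq> \<zero>"
    then have "\<zero> \<sqsubset> a" "\<zero> \<sqsubset> b" using less_linear not_less_zero by blast+
    then have "a \<otimes> \<zero> \<sqsubset> a \<otimes> b" by (intro times_mono)
    then show "a \<otimes> b \<noteq> \<zero>" using times_zero less_irrefl by metis
  qed
qed

context RCA0_omega_model
begin

lemma zero_le: "\<zero> \<sqsubseteq> a"
  using not_less_zero[of a] num.not_less by blast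

lemma pred_plus_one: "\<zero> \<sqsubset> a \<Longrightarrow> pred a \<oplus> \<one> = a"
  using zero_or_Suc[of a] by auto

text \<open>Discreteness of the order: a positive difference is a successor.\<close>

lemma Suc_le_iff: "a \<oplus> \<one> \<sqsubseteq> b \<longleftrightarrow> a \<sqsubset> b"
proof
  assume "a \<oplus> \<one> \<sqsubseteq> b"
  with less_Suc[of a] show "a \<sqsubset> b" by (rule num.less_le_trans)
next
  assume "a \<sqsubset> b"
  then have "b = a \<oplus> (b \<ominus> a)" "b \<ominus> a \<noteq> \<zero>"
    using plus_monus_inverse[of b a] num.less_asym by (metis, metis num.less_irrefl plus_zero)
  then have "b = a \<oplus> (pred (b \<ominus> a) \<oplus> \<one>)" using zero_or_Suc[of "b \<ominus> a"] by metis
  then have "b = a \<oplus> \<one> \<oplus> pred (b \<ominus> a)" by (simp add: num.add_ac)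
  moreover have "a \<oplus> \<one> \<sqsubseteq> a \<oplus> \<one> \<oplus> pred (b \<ominus> a)" by (simp add: zero_le)
  ultimately show "a \<oplus> \<one> \<sqsubseteq> b" by metis
qed

lemma less_Suc_iff: "a \<sqsubset> b \<oplus> \<one> \<longleftrightarrow> a \<sqsubseteq> b"
  using Suc_le_iff[of b a] num.not_less by metis

section \<open>Powers of two, triangular numbers and Cantor pairing\<close>

lemma exp2_gt: "a \<sqsubset> exp2 a"
proof -
  have "sat (env0(vn := a)) [] (V vn \<^bold>< exp2_tm \<^bold>\<cdot> V vn)"
  proof (rule qf_induct)
    fix a assume "sat (env0(vn := a)) [] (V vn \<^bold>< exp2_tm \<^bold>\<cdot> V vn)"
    then have a: "a \<oplus> \<one> \<sqsubseteq> exp2 a" by (simp add: Suc_le_iff)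
    moreover have "\<zero> \<sqsubset> exp2 a" using a zero_le[of a] Suc_le_iff num.le_less_trans by blast
    ultimately have "a \<oplus> \<one> \<sqsubset> exp2 a \<oplus> exp2 a" using num.add_le_less_mono by fastforce
    then show "sat (env0(vn := a \<oplus> \<one>)) [] (V vn \<^bold>< exp2_tm \<^bold>\<cdot> V vn)" by (simp add: exp2_Suc)
  qed (simp_all add: exp2_zero)
  then show ?thesis by simp
qed

lemma exp2_pos: "\<zero> \<sqsubset> exp2 a"
  using exp2_gt[of a] zero_le[of a] num.le_less_trans by blast

lemma tri_le_plus: "tri a \<sqsubseteq> tri (a \<oplus> b)"
proof -
  have "sat (env0(vm := a, vn := b)) [] (\<^bold>\<not> tri_tm \<^bold>\<cdot> (V vm \<^bold>+ V vn) \<^bold>< tri_tm \<^bold>\<cdot> V vm)"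
  proof (rule qf_induct)
    fix b assume "sat (env0(vm := a, vn := b)) [] (\<^bold>\<not> tri_tm \<^bold>\<cdot> (V vm \<^bold>+ V vn) \<^bold>< tri_tm \<^bold>\<cdot> V vm)"
    then have "tri a \<sqsubseteq> tri (a \<oplus> b)" by (simp add: num.not_less)
    also have "tri (a \<oplus> b) \<sqsubseteq> tri (a \<oplus> b) \<oplus> (a \<oplus> b \<oplus> \<one>)" by (simp add: zero_le)
    finally show "sat (env0(vm := a, vn := b \<oplus> \<one>)) [] (\<^bold>\<not> tri_tm \<^bold>\<cdot> (V vm \<^bold>+ V vn) \<^bold>< tri_tm \<^bold>\<cdot> V vm)"
      by (simp add: num.not_less tri_Suc num.add_assoc[symmetric])
  qed simp_all
  then show ?thesis by (simp add: num.not_less)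
qed

lemma tri_mono: "a \<sqsubseteq> b \<Longrightarrow> tri a \<sqsubseteq> tri b"
  using tri_le_plus[of a "b \<ominus> a"] plus_monus_inverse[of b a] num.not_less by metis

lemma le_tri: "a \<sqsubseteq> tri a"
proof -
  from zero_or_Suc[of a] show ?thesis
  proof
    assume "a = pred a \<oplus> \<one>"
    moreover have "pred a \<oplus> \<one> \<sqsubseteq> tri (pred a) \<oplus> (pred a \<oplus> \<one>)" by (simp add: zero_le)
    ultimately show ?thesis using tri_Suc by metis
  qed (simp add: zero_le)
qed

text \<open>The recursion raises the root exactly when \<open>a + 1\<close> reaches the next
  triangular number, which cannot be overshot since the argument grows by one.\<close>

lemma tri_root_bounds: "tri (tri_root a) \<sqsubseteq> a \<and> a \<sqsubset> tri (tri_root a \<oplus> \<one>)"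
proof -
  let ?A = "\<^bold>\<not> V vn \<^bold>< tri_tm \<^bold>\<cdot> (tri_root_tm \<^bold>\<cdot> V vn) \<^bold>\<and> V vn \<^bold>< tri_tm \<^bold>\<cdot> (tri_root_tm \<^bold>\<cdot> V vn \<^bold>+ One)"
  have "sat (env0(vn := a)) [] ?A"
  proof (rule qf_induct)
    show "sat (env0(vn := \<zero>)) [] ?A"
      using tri_Suc[of \<zero>] by (simp add: tri_root_zero tri_zero num.not_less)
  next
    fix a assume "sat (env0(vn := a)) [] ?A"
    then have *: "tri (tri_root a) \<sqsubseteq> a" "a \<oplus> \<one> \<sqsubseteq> tri (tri_root a \<oplus> \<one>)"
      by (simp_all add: num.not_less Suc_le_iff)
    show "sat (env0(vn := a \<oplus> \<one>)) [] ?A"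
    proof (cases "a \<oplus> \<one> = tri (tri_root a \<oplus> \<one>)")
      case True
      \<comment> \<open>The difference inside the recursion is zero here, and subtracting it from
        one gives the increment one.\<close>
      then have "tri_root (a \<oplus> \<one>) = tri_root a \<oplus> \<one>"
        using tri_root_Suc[of a] monus_plus[of _ \<zero>] monus_zero by simp
      moreover have "a \<oplus> \<one> \<sqsubset> (a \<oplus> \<one>) \<oplus> (tri_root a \<oplus> \<one> \<oplus> \<one>)" using zero_le less_Suc_iff by simp
      ultimately show ?thesis using True tri_Suc[of "tri_root a \<oplus> \<one>"] by (simp add: num.not_less)
    next
      case False
      let ?d = "tri (tri_root a \<oplus> \<one>) \<ominus> (a \<oplus> \<one>)"
      have less: "a \<oplus> \<one> \<sqsubset> tri (tri_root a \<oplus> \<one>)" using * False num.le_neq_trans by blast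
      then have "a \<oplus> \<one> \<oplus> ?d = tri (tri_root a \<oplus> \<one>)"
        using plus_monus_inverse num.less_asym by blast
      then have "?d \<noteq> \<zero>" using False by (metis plus_zero)
      then have "?d = pred ?d \<oplus> \<one>" using zero_or_Suc by blast
      \<comment> \<open>Short of the next triangular number the difference is a successor, and the
        truncated increment vanishes.\<close>
      then have "\<one> \<ominus> ?d = \<zero>" using monus_plus[of \<one> "pred ?d"] by simp
      then have "tri_root (a \<oplus> \<one>) = tri_root a" using tri_root_Suc[of a] plus_zero by simp
      moreover have "tri (tri_root a) \<sqsubseteq> a \<oplus> \<one>" using *(1) less_Suc num.le_less_trans num.less_imp_le by blast
      ultimately show ?thesis using less by (simp add: num.not_less)
    qed
  qed simp_all
  then show ?thesis by (simp add: num.not_less)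
qed

definition pairing where "pairing a b = tri (a \<oplus> b) \<oplus> b"

text \<open>The code lies between the triangular numbers of \<open>a + b\<close> and of its
  successor, so the root recovers the sum.\<close>

lemma tri_root_pairing: "tri_root (pairing a b) = a \<oplus> b"
proof -
  let ?n = "pairing a b" and ?s = "a \<oplus> b"
  have n: "tri ?s \<sqsubseteq> ?n" by (simp add: pairing_def zero_le)
  have "b \<sqsubset> ?s \<oplus> \<one>" by (simp add: less_Suc_iff zero_le)
  then have n': "?n \<sqsubset> tri (?s \<oplus> \<one>)" by (simp add: pairing_def tri_Suc)
  show ?thesis
  proof (rule num.order_antisym)
    show "tri_root ?n \<sqsubseteq> ?s"
    proof (rule num.leI, rule notI)
      assume "?s \<sqsubset> tri_root ?n"
      then have "tri (?s \<oplus> \<one>) \<sqsubseteq> tri (tri_root ?n)" by (simp add: tri_mono Suc_le_iff)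
      then show False using n' tri_root_bounds[of ?n] num.less_le_trans num.less_irrefl by blast
    qed
    show "?s \<sqsubseteq> tri_root ?n"
    proof (rule num.leI, rule notI)
      assume "tri_root ?n \<sqsubset> ?s"
      then have "tri (tri_root ?n \<oplus> \<one>) \<sqsubseteq> tri ?s" by (simp add: tri_mono Suc_le_iff)
      then show False using n tri_root_bounds[of ?n] num.less_le_trans num.less_irrefl by blast
    qed
  qed
qed

lemma proj2_pairing [simp]: "proj2 (pairing a b) = b"
  by (simp add: proj2_eq tri_root_pairing) (simp add: pairing_def)

lemma proj1_pairing [simp]: "proj1 (pairing a b) = a"
  by (simp add: proj1_eq tri_root_pairing)

lemma monus_le: "a \<ominus> b \<sqsubseteq> a"
proof (cases "a \<sqsubset> b")
  case True
  then have "(b \<ominus> a) \<oplus> a = b" using plus_monus_inverse num.less_asym plus_commute by metis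
  then have "a \<ominus> b = \<zero>" using monus_plus[of a "b \<ominus> a"] by simp
  then show ?thesis by (simp add: zero_le)
next
  case False
  then have "b \<oplus> (a \<ominus> b) = a" by (rule plus_monus_inverse)
  moreover have "a \<ominus> b \<sqsubseteq> b \<oplus> (a \<ominus> b)" by (simp add: zero_le)
  ultimately show ?thesis by simp
qed

text \<open>Later turns a bound on codes of pairs, of a ball index with a precision, into a bound on
  ball indices.\<close>

lemma proj1_le: "proj1 a \<sqsubseteq> a"
proof -
  have "tri_root a \<sqsubseteq> a" using le_tri tri_root_bounds num.order_trans by blast
  then show ?thesis using monus_le proj1_eq num.order_trans by metis
qed

section \<open>Rationals and reals in a model\<close>

definition qrat where "qrat a b c = pairing (pairing a b) c"
definition qpos where "qpos q = proj1 (proj1 q)"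
definition qneg where "qneg q = proj2 (proj1 q)"
definition qden where "qden q = proj2 q \<oplus> \<one>"
definition qless where "qless q r \<longleftrightarrow>
  qpos q \<otimes> qden r \<oplus> qneg r \<otimes> qden q \<sqsubset> qpos r \<otimes> qden q \<oplus> qneg q \<otimes> qden r"
definition qplus where "qplus q r = qrat (qpos q \<otimes> qden r \<oplus> qpos r \<otimes> qden q)
  (qneg q \<otimes> qden r \<oplus> qneg r \<otimes> qden q) (proj2 q \<otimes> proj2 r \<oplus> proj2 q \<oplus> proj2 r)"
definition qminus where "qminus q r = qplus q (qrat (qneg r) (qpos r) (proj2 r))"
definition qabs where "qabs q = qrat ((qpos q \<ominus> qneg q) \<oplus> (qneg q \<ominus> qpos q)) \<zero> (proj2 q)"
definition half where "half a = qrat \<one> \<zero> (pred (exp2 a))"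
definition dhalf where "dhalf a = qrat (\<one> \<oplus> \<one>) \<zero> (pred (exp2 a))"

lemma qrat_sel [simp]:
  "qpos (qrat a b c) = a" "qneg (qrat a b c) = b" "proj2 (qrat a b c) = c" "qden (qrat a b c) = c \<oplus> \<one>"
  by (simp_all add: qrat_def qpos_def qneg_def qden_def)

lemma qplus_sel [simp]:
  "qpos (qplus q r) = qpos q \<otimes> qden r \<oplus> qpos r \<otimes> qden q"
  "qneg (qplus q r) = qneg q \<otimes> qden r \<oplus> qneg r \<otimes> qden q"
  "qden (qplus q r) = qden q \<otimes> qden r"
  by (simp_all add: qplus_def) (simp add: qden_def algebra_simps)

lemma half_sel [simp]:
  "qpos (half a) = \<one>" "qneg (half a) = \<zero>" "qden (half a) = exp2 a"
  by (simp_all add: half_def pred_plus_one exp2_pos)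

lemma dhalf_sel [simp]:
  "qpos (dhalf a) = \<one> \<oplus> \<one>" "qneg (dhalf a) = \<zero>" "qden (dhalf a) = exp2 a"
  by (simp_all add: dhalf_def pred_plus_one exp2_pos)

lemma qden_pos: "\<zero> \<sqsubset> qden q"
  unfolding qden_def less_Suc_iff by (rule zero_le)

lemma eval_rat [simp]:
  "eval e bs (pair s t) = pairing (eval e bs s) (eval e bs t)"
  "eval e bs (rat s t u) = qrat (eval e bs s) (eval e bs t) (eval e bs u)"
  "eval e bs (pos_part s) = qpos (eval e bs s)"
  "eval e bs (neg_part s) = qneg (eval e bs s)"
  "eval e bs (denom s) = qden (eval e bs s)"
  "eval e bs (denom_pred s) = proj2 (eval e bs s)"
  "eval e bs (s +\<^sub>Q t) = qplus (eval e bs s) (eval e bs t)"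
  "eval e bs (s -\<^sub>Q t) = qminus (eval e bs s) (eval e bs t)"
  "eval e bs (rat_abs s) = qabs (eval e bs s)"
  "eval e bs (half_pow s) = half (eval e bs s)"
  "eval e bs (double_half_pow s) = dhalf (eval e bs s)"
  "sat e bs (s <\<^sub>Q t) \<longleftrightarrow> qless (eval e bs s) (eval e bs t)"
  "sat e bs (s \<le>\<^sub>Q t) \<longleftrightarrow> \<not> qless (eval e bs t) (eval e bs s)"
proof -
  show [simp]: "eval e bs (pair s t) = pairing (eval e bs s) (eval e bs t)" for s t
    by (simp add: pair_def pairing_def)
  show [simp]: "eval e bs (rat s t u) = qrat (eval e bs s) (eval e bs t) (eval e bs u)" for s t u
    by (simp add: rat_def qrat_def)
  show [simp]: "eval e bs (pos_part s) = qpos (eval e bs s)" for s by (simp add: pos_part_def qpos_def)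
  show [simp]: "eval e bs (neg_part s) = qneg (eval e bs s)" for s by (simp add: neg_part_def qneg_def)
  show [simp]: "eval e bs (denom_pred s) = proj2 (eval e bs s)" for s by (simp add: denom_pred_def)
  show [simp]: "eval e bs (denom s) = qden (eval e bs s)" for s by (simp add: denom_def qden_def)
  show [simp]: "eval e bs (s +\<^sub>Q t) = qplus (eval e bs s) (eval e bs t)" for s t
    by (simp add: rat_plus_def qplus_def)
  show "eval e bs (s -\<^sub>Q t) = qminus (eval e bs s) (eval e bs t)" by (simp add: rat_minus_def qminus_def)
  show "eval e bs (rat_abs s) = qabs (eval e bs s)" by (simp add: rat_abs_def qabs_def)
  show "eval e bs (half_pow s) = half (eval e bs s)" by (simp add: half_pow_def half_def)
  show "eval e bs (double_half_pow s) = dhalf (eval e bs s)" by (simp add: double_half_pow_def dhalf_def)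
  show [simp]: "sat e bs (s <\<^sub>Q t) \<longleftrightarrow> qless (eval e bs s) (eval e bs t)" for s t
    by (simp add: rat_less_def qless_def)
  show "sat e bs (s \<le>\<^sub>Q t) \<longleftrightarrow> \<not> qless (eval e bs t) (eval e bs s)" by (simp add: rat_le_def)
qed

end

lemma lc_rat [simp]:
  "lc_tm k (pair s t) \<longleftrightarrow> lc_tm k s \<and> lc_tm k t"
  "lc_tm k (rat s t u) \<longleftrightarrow> lc_tm k s \<and> lc_tm k t \<and> lc_tm k u"
  "lc_tm k (pos_part s) \<longleftrightarrow> lc_tm k s"
  "lc_tm k (neg_part s) \<longleftrightarrow> lc_tm k s"
  "lc_tm k (denom_pred s) \<longleftrightarrow> lc_tm k s"
  "lc_tm k (denom s) \<longleftrightarrow> lc_tm k s"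
  "lc_tm k (s +\<^sub>Q t) \<longleftrightarrow> lc_tm k s \<and> lc_tm k t"
  "lc_tm k (s -\<^sub>Q t) \<longleftrightarrow> lc_tm k s \<and> lc_tm k t"
  "lc_tm k (rat_abs s) \<longleftrightarrow> lc_tm k s"
  "lc_tm k (half_pow s) \<longleftrightarrow> lc_tm k s"
  "lc_tm k (double_half_pow s) \<longleftrightarrow> lc_tm k s"
  "lc_fm k (s <\<^sub>Q t) \<longleftrightarrow> lc_tm k s \<and> lc_tm k t"
  "lc_fm k (s \<le>\<^sub>Q t) \<longleftrightarrow> lc_tm k s \<and> lc_tm k t"
  by (auto simp: pair_def rat_def pos_part_def neg_part_def denom_def denom_pred_def rat_plus_def
      rat_minus_def rat_abs_def half_pow_def double_half_pow_def rat_less_def rat_le_def)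

lemma typ_of_rat [simp]:
  "typ_of E s = Some T0 \<Longrightarrow> typ_of E t = Some T0 \<Longrightarrow> typ_of E (pair s t) = Some T0"
  "typ_of E s = Some T0 \<Longrightarrow> typ_of E t = Some T0 \<Longrightarrow> typ_of E u = Some T0 \<Longrightarrow> typ_of E (rat s t u) = Some T0"
  "typ_of E s = Some T0 \<Longrightarrow> typ_of E (pos_part s) = Some T0"
  "typ_of E s = Some T0 \<Longrightarrow> typ_of E (neg_part s) = Some T0"
  "typ_of E s = Some T0 \<Longrightarrow> typ_of E (denom_pred s) = Some T0"
  "typ_of E s = Some T0 \<Longrightarrow> typ_of E (denom s) = Some T0"
  "typ_of E s = Some T0 \<Longrightarrow> typ_of E t = Some T0 \<Longrightarrow> typ_of E (s +\<^sub>Q t) = Some T0"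
  "typ_of E s = Some T0 \<Longrightarrow> typ_of E t = Some T0 \<Longrightarrow> typ_of E (s -\<^sub>Q t) = Some T0"
  "typ_of E s = Some T0 \<Longrightarrow> typ_of E (rat_abs s) = Some T0"
  "typ_of E s = Some T0 \<Longrightarrow> typ_of E (half_pow s) = Some T0"
  "typ_of E s = Some T0 \<Longrightarrow> typ_of E (double_half_pow s) = Some T0"
  "typ_of E s = Some T0 \<Longrightarrow> typ_of E t = Some T0 \<Longrightarrow> wf_fm E (s <\<^sub>Q t)"
  "typ_of E s = Some T0 \<Longrightarrow> typ_of E t = Some T0 \<Longrightarrow> wf_fm E (s \<le>\<^sub>Q t)"
  by (simp_all add: pair_def rat_def pos_part_def neg_part_def denom_def denom_pred_def rat_plus_def
      rat_minus_def rat_abs_def half_pow_def double_half_pow_def rat_less_def rat_le_def)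

context RCA0_omega_model
begin

section \<open>Strong bounding\<close>

text \<open>The choice functional is an element of the model, so terms evaluated there may iterate
  it.\<close>

lemma qf_ac:
  assumes A: "quantifier_free A" "wf_fm [] A"
    and types: "snd x = T1" "snd y = T0" "snd Y = T1 \<^bold>\<rightarrow> T0" "Y \<notin> vars_fm A" and "env e"
    and "\<And>a. a \<in> D T1 \<Longrightarrow> \<exists>b. sat (e(x := a, y := b)) [] A"
  shows "\<exists>F\<in>D (T1 \<^bold>\<rightarrow> T0). \<forall>a\<in>D T1. sat (e(x := a, y := F \<cdot> a)) [] A"
proof -
  have u: "typ_of [] (V Y \<^bold>\<cdot> V x) = Some (snd y)" using types by simp
  have wf: "wf_fm [] (subst_fm y (V Y \<^bold>\<cdot> V x) A)" by (rule wf_fm_subst[OF u A(2)])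
  have lc: "lc_fm 0 A" "lc_fm 0 (subst_fm y (V Y \<^bold>\<cdot> V x) A)"
    using A(2) wf wf_fm_lc[of "[]"] by simp_all
  have "x \<noteq> Y" using types by auto
  have "\<forall>a\<in>D T1. \<exists>b\<in>D T0. sat (e(x := a, y := b)) [] A" using assms(8) in_D_T0 by blast
  moreover have "sat e [] (QF_AC_axiom x y Y A)"
    by (rule valid[OF RCA0_omega.QF_AC_1_0]) (use assms wf in \<open>simp_all add: QF_AC_axiom_def\<close>)
  ultimately obtain F where F: "F \<in> D (T1 \<^bold>\<rightarrow> T0)"
    "\<forall>a\<in>D T1. sat (e(Y := F, x := a, y := F \<cdot> a)) [] A"
    using types lc \<open>x \<noteq> Y\<close> by (auto simp: QF_AC_axiom_def sat_subst)
  have "sat (e(Y := F, x := a, y := F \<cdot> a)) [] A = sat (e(x := a, y := F \<cdot> a)) [] A" for a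
    by (rule sat_cong) (use types in auto)
  then show ?thesis using F by auto
qed

lemma one_monus: "\<one> \<ominus> a = (if a = \<zero> then \<one> else \<zero>)"
proof (cases "a = \<zero>")
  case False
  then have "a = pred a \<oplus> \<one>" using zero_or_Suc by blast
  then have "\<one> \<ominus> a = \<zero>" using monus_plus[of \<one> "pred a"] by simp
  then show ?thesis using False by simp
qed (simp add: monus_zero)

text \<open>Without a maximum, choice yields a functional that leads from each argument to one with
  a larger value. Along its iterates the values of \<open>f\<close> grow at least as fast as the
  number of steps.\<close>

lemma max_exists:
  assumes f: "f \<in> D T1" and bounded: "\<And>m. f \<cdot> m \<sqsubseteq> b"
  shows "\<exists>m. \<forall>n. f \<cdot> n \<sqsubseteq> f \<cdot> m"
proof (rule ccontr)
  assume "\<not> ?thesis"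
  then have larger: "\<exists>n. f \<cdot> m \<sqsubset> f \<cdot> n" for m by (auto simp: num.not_le)
  let ?f = "(''f'', T1)" and ?F = "(''F'', T1 \<^bold>\<rightarrow> T0)"
  \<comment> \<open>Choice takes arguments of type 1 only, so the number to be improved is passed as
    the value of \<open>x\<close> at zero.\<close>
  have "\<exists>F\<in>D (T1 \<^bold>\<rightarrow> T0). \<forall>x\<in>D T1.
      sat (env0(?f := f, vx := x, vn := F \<cdot> x)) [] (V ?f \<^bold>\<cdot> (V vx \<^bold>\<cdot> Zero) \<^bold>< V ?f \<^bold>\<cdot> V vn)"
    by (rule qf_ac[where Y = ?F]) (use f larger in auto)
  then obtain F where F: "F \<in> D (T1 \<^bold>\<rightarrow> T0)" "\<And>x. x \<in> D T1 \<Longrightarrow> f \<cdot> (x \<cdot> \<zero>) \<sqsubset> f \<cdot> (F \<cdot> x)"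
    by auto
  define e where "e = env0(?f := f, ?F := F, vm := b)"
  have e: "env e" "e ?f = f" "e ?F = F" "e vm = b" using F(1) f by (simp_all add: e_def)
  \<comment> \<open>The iteration feeds each number back to \<open>F\<close> as a constant sequence;
    recursion at type 0 suffices because the iterates are numbers.\<close>
  define g_tm where "g_tm = lam vn (Rec T0 \<^bold>\<cdot> lam vi (lam vk (V ?F \<^bold>\<cdot> (Pi_c T0 T0 \<^bold>\<cdot> V vk))) \<^bold>\<cdot> Zero \<^bold>\<cdot> V vn)"
  have g_tm: "typ_of E g_tm = Some T1" "lc_tm k g_tm" "vars_tm g_tm = {?F}" for E k
    by (auto simp: g_tm_def typ_of_lam vars_lam intro!: lc_lam)
  define g where "g = eval e [] g_tm"
  have g_Suc: "g \<cdot> (n \<oplus> \<one>) = F \<cdot> (I (Pi_c T0 T0) \<cdot> (g \<cdot> n))" for n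
    using e by (simp add: g_def g_tm_def eval_lam Rec_lam typ_of_lam eval_lam_upd vars_lam)
  have eval_g: "eval (e(vn := n)) [] g_tm = g" for n
    unfolding g_def by (rule eval_cong) (simp add: g_tm)
  have "I (Pi_c T0 T0) \<in> D (T0 \<^bold>\<rightarrow> T1)" by (rule I_in_D) simp_all
  then have step: "f \<cdot> (g \<cdot> n) \<sqsubset> f \<cdot> (g \<cdot> (n \<oplus> \<one>))" for n
    using F(2)[of "I (Pi_c T0 T0) \<cdot> (g \<cdot> n)"] by (simp add: g_Suc Pi_ap ap_in_D)
  have "sat (e(vn := n)) [] (\<^bold>\<not> V ?f \<^bold>\<cdot> (g_tm \<^bold>\<cdot> V vn) \<^bold>< V vn)" for n
  proof (rule qf_induct)
    fix n assume "sat (e(vn := n)) [] (\<^bold>\<not> V ?f \<^bold>\<cdot> (g_tm \<^bold>\<cdot> V vn) \<^bold>< V vn)"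
    then have "n \<sqsubseteq> f \<cdot> (g \<cdot> n)" by (simp add: eval_g e num.not_less)
    then have "n \<oplus> \<one> \<sqsubseteq> f \<cdot> (g \<cdot> (n \<oplus> \<one>))" using step num.le_less_trans Suc_le_iff by blast
    then show "sat (e(vn := n \<oplus> \<one>)) [] (\<^bold>\<not> V ?f \<^bold>\<cdot> (g_tm \<^bold>\<cdot> V vn) \<^bold>< V vn)"
      by (simp add: eval_g e num.not_less)
  qed (simp_all add: g_tm e not_less_zero)
  then have "n \<sqsubseteq> f \<cdot> (g \<cdot> n)" for n by (simp add: eval_g e num.not_less)
  \<comment> \<open>After \<open>b + 1\<close> steps the bound is exceeded.\<close>
  then have "b \<oplus> \<one> \<sqsubseteq> b" using bounded num.order_trans by blast
  then show False using Suc_le_iff num.less_irrefl by blast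
qed

text \<open>For a \<open>0\<close>-\<open>1\<close>-valued \<open>C\<close> that is monotone in the second argument, \<open>G b m\<close> counts the \<open>j \<le> b\<close>
  with \<open>C j m = 1\<close>. It stops growing as soon as \<open>m\<close> maximises it.\<close>

lemma stabilisation:
  assumes C: "C \<in> D (T0 \<^bold>\<rightarrow> T0 \<^bold>\<rightarrow> T0)" "\<And>j m. C \<cdot> j \<cdot> m \<sqsubseteq> \<one>"
    "\<And>j m n. m \<sqsubseteq> n \<Longrightarrow> C \<cdot> j \<cdot> m \<sqsubseteq> C \<cdot> j \<cdot> n"
  shows "\<exists>m. \<forall>j n. j \<sqsubseteq> b \<longrightarrow> C \<cdot> j \<cdot> n \<sqsubseteq> C \<cdot> j \<cdot> m"
proof -
  let ?C = "(''C'', T0 \<^bold>\<rightarrow> T0 \<^bold>\<rightarrow> T0)" and ?j = "(''j'', T0)"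
  define e where "e = env0(?C := C)"
  have e: "env e" "e ?C = C" using C(1) by (simp_all add: e_def)
  define G_tm where "G_tm = lam vn (lam vm
    (Rec T0 \<^bold>\<cdot> lam vi (lam vk (V vk \<^bold>+ V ?C \<^bold>\<cdot> (V vi \<^bold>+ One) \<^bold>\<cdot> V vm)) \<^bold>\<cdot> (V ?C \<^bold>\<cdot> Zero \<^bold>\<cdot> V vm) \<^bold>\<cdot> V vn))"
  have G_tm: "typ_of E G_tm = Some (T0 \<^bold>\<rightarrow> T0 \<^bold>\<rightarrow> T0)" "vars_tm G_tm = {?C}" for E
    by (auto simp: G_tm_def typ_of_lam vars_lam)
  define G where "G = eval e [] G_tm"
  have G_in_D: "G \<in> D (T0 \<^bold>\<rightarrow> T0 \<^bold>\<rightarrow> T0)"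
    unfolding G_def using e(1) by (rule eval_closed_in_D) (rule G_tm)
  have G_zero: "G \<cdot> \<zero> \<cdot> m = C \<cdot> \<zero> \<cdot> m" for m
    using e by (simp add: G_def G_tm_def eval_lam Rec_lam typ_of_lam)
  have G_Suc: "G \<cdot> (n \<oplus> \<one>) \<cdot> m = G \<cdot> n \<cdot> m \<oplus> C \<cdot> (n \<oplus> \<one>) \<cdot> m" for n m
    using e by (simp add: G_def G_tm_def eval_lam Rec_lam typ_of_lam eval_lam_upd vars_lam fun_upd_twist[of vn vm])
  have eval_G: "eval (e'(?C := C)) [] G_tm = G" for e'
    unfolding G_def by (rule eval_cong) (simp add: G_tm e)
  define e' where "e' m m' j = env0(vm := m, vk := m', ?j := j, ?C := C)" for m m' j
  have e': "env (e' m m' j)" "e' m m' j vm = m" "e' m m' j vk = m'" "e' m m' j ?j = j"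
    "eval ((e' m m' j)(vn := n)) [] G_tm = G" for m m' j n
    using C(1) eval_G[of "env0(vm := m, vk := m', ?j := j, vn := n)"]
    by (simp_all add: e'_def fun_upd_twist[of vn ?C])
  have bound: "G \<cdot> n \<cdot> m \<sqsubseteq> n \<oplus> \<one>" for n m
  proof -
    let ?A = "\<^bold>\<not> V vn \<^bold>+ One \<^bold>< G_tm \<^bold>\<cdot> V vn \<^bold>\<cdot> V vm"
    have "sat ((e' m m m)(vn := n)) [] ?A"
      by (rule qf_induct)
         (simp_all add: G_tm e' num.not_less G_zero G_Suc C(2) num.add_mono)
    then show ?thesis by (simp add: e' num.not_less)
  qed
  have mono: "G \<cdot> n \<cdot> m \<sqsubseteq> G \<cdot> n \<cdot> m'" if "m \<sqsubseteq> m'" for n m m'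
  proof -
    let ?A = "\<^bold>\<not> G_tm \<^bold>\<cdot> V vn \<^bold>\<cdot> V vk \<^bold>< G_tm \<^bold>\<cdot> V vn \<^bold>\<cdot> V vm"
    have "sat ((e' m m' m)(vn := n)) [] ?A"
      by (rule qf_induct)
         (simp_all add: G_tm e' num.not_less G_zero G_Suc C(3)[OF that] num.add_mono)
    then show ?thesis by (simp add: e' num.not_less)
  qed
  \<comment> \<open>A single strict increase, at index \<open>j\<close>, survives in the sum because
    all other summands are monotone. The claim is vacuous as long as \<open>n < j\<close>, which
    lets the induction start at zero.\<close>
  have strict: "G \<cdot> n \<cdot> m \<sqsubset> G \<cdot> n \<cdot> m'" if "j \<sqsubseteq> n" "m \<sqsubseteq> m'" "C \<cdot> j \<cdot> m \<sqsubset> C \<cdot> j \<cdot> m'" for n m m' j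
  proof -
    let ?A = "V vn \<^bold>< V ?j \<^bold>\<or> G_tm \<^bold>\<cdot> V vn \<^bold>\<cdot> V vm \<^bold>< G_tm \<^bold>\<cdot> V vn \<^bold>\<cdot> V vk"
    have "sat ((e' m m' j)(vn := n)) [] ?A"
    proof (rule qf_induct)
      show "sat ((e' m m' j)(vn := \<zero>)) [] ?A"
        using that(3) zero_le[of j] by (auto simp: e' G_zero num.le_less)
    next
      fix n assume IH: "sat ((e' m m' j)(vn := n)) [] ?A"
      consider "n \<oplus> \<one> \<sqsubset> j" | "n \<oplus> \<one> = j" | "\<not> n \<sqsubset> j"
        using num.less_linear Suc_le_iff num.le_less by blast
      then show "sat ((e' m m' j)(vn := n \<oplus> \<one>)) [] ?A"
      proof cases
        case 2
        then show ?thesis using that(3) mono[OF that(2), of n] unfolding 2[symmetric]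
            by (simp add: e' G_Suc num.add_le_less_mono)
      next
        case 3
        then show ?thesis using IH C(3)[OF that(2)] by (simp add: e' G_Suc num.add_less_le_mono)
      qed (simp add: e')
    qed (simp_all add: G_tm e')
    then show ?thesis using that(1) by (auto simp: e' num.not_less[symmetric])
  qed
  \<comment> \<open>There are \<open>b + 1\<close> indices up to \<open>b\<close>, so this number
    bounds the count.\<close>
  obtain m where m: "\<And>n. G \<cdot> b \<cdot> n \<sqsubseteq> G \<cdot> b \<cdot> m"
    using max_exists[of "G \<cdot> b" "b \<oplus> \<one>"] ap_in_D[OF G_in_D] bound by auto
  have "C \<cdot> j \<cdot> n \<sqsubseteq> C \<cdot> j \<cdot> m" if "j \<sqsubseteq> b" for j n
  proof (rule num.leI, rule notI)
    assume less: "C \<cdot> j \<cdot> m \<sqsubset> C \<cdot> j \<cdot> n"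
    then have "\<not> n \<sqsubseteq> m" using C(3)[of n m j] num.leD by blast
    then have "m \<sqsubseteq> n" using num.linear by blast
    from strict[OF that this less] show False using m num.leD by blast
  qed
  then show ?thesis by blast
qed

text \<open>The auxiliary \<open>w j m\<close> is the least \<open>i \<le> m\<close> with \<open>h j i \<noteq> 0\<close>, if there is one.\<close>

lemma strong_bounding:
  assumes h: "h \<in> D (T0 \<^bold>\<rightarrow> T0 \<^bold>\<rightarrow> T0)"
  shows "\<exists>m. \<forall>j i. j \<sqsubseteq> b \<longrightarrow> h \<cdot> j \<cdot> i \<noteq> \<zero> \<longrightarrow> (\<exists>i'. i' \<sqsubseteq> m \<and> h \<cdot> j \<cdot> i' \<noteq> \<zero>)"
proof -
  let ?h = "(''h'', T0 \<^bold>\<rightarrow> T0 \<^bold>\<rightarrow> T0)" and ?j = "(''j'', T0)"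
  define sg where "sg t = monus_tm \<^bold>\<cdot> One \<^bold>\<cdot> (monus_tm \<^bold>\<cdot> One \<^bold>\<cdot> t)" for t
  have sg: "eval e bs (sg t) = (if eval e bs t = \<zero> then \<zero> else \<one>)" for e bs t
    by (simp add: sg_def one_monus)
  define e where "e = env0(?h := h)"
  have e: "env e" "e ?h = h" using h by (simp_all add: e_def)
  \<comment> \<open>The sum encodes a case distinction: a candidate that is a hit is kept, otherwise
    the search moves on to \<open>i + 1\<close>. Without a hit before \<open>m\<close> the value is
    \<open>m\<close> itself.\<close>
  define w_tm where "w_tm = lam ?j (lam vm (Rec T0 \<^bold>\<cdot> lam vi (lam vk
      (sg (V ?h \<^bold>\<cdot> V ?j \<^bold>\<cdot> V vk) \<^bold>* V vk \<^bold>+ (monus_tm \<^bold>\<cdot> One \<^bold>\<cdot> (V ?h \<^bold>\<cdot> V ?j \<^bold>\<cdot> V vk)) \<^bold>* (V vi \<^bold>+ One)))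
    \<^bold>\<cdot> Zero \<^bold>\<cdot> V vm))"
  have w_tm: "typ_of E w_tm = Some (T0 \<^bold>\<rightarrow> T0 \<^bold>\<rightarrow> T0)" "vars_tm w_tm = {?h}" for E
    by (auto simp: w_tm_def sg_def typ_of_lam vars_lam)
  define w where "w = eval e [] w_tm"
  have w_zero: "w \<cdot> j \<cdot> \<zero> = \<zero>" for j
    using e by (simp add: w_def w_tm_def sg_def eval_lam Rec_lam typ_of_lam)
  have w_Suc: "w \<cdot> j \<cdot> (m \<oplus> \<one>) = (if h \<cdot> j \<cdot> (w \<cdot> j \<cdot> m) = \<zero> then m \<oplus> \<one> else w \<cdot> j \<cdot> m)" for j m
    using e by (simp add: w_def w_tm_def sg_def one_monus eval_lam Rec_lam typ_of_lam eval_lam_upd vars_lam)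
  define e' where "e' j i = env0(?j := j, vi := i, ?h := h)" for j i
  have e': "env (e' j i)" "e' j i ?j = j" "e' j i vi = i" "e' j i ?h = h"
    for j i
    using h by (simp_all add: e'_def)
  have eval_w: "e1 ?h = h \<Longrightarrow> eval e1 [] w_tm = w" for e1
    unfolding w_def by (rule eval_cong) (simp add: w_tm e)
  have w_le: "w \<cdot> j \<cdot> m \<sqsubseteq> m" for j m
  proof -
    have "sat ((e' j j)(vm := m)) [] (\<^bold>\<not> V vm \<^bold>< w_tm \<^bold>\<cdot> V ?j \<^bold>\<cdot> V vm)"
    proof (rule qf_induct)
      fix m assume "sat ((e' j j)(vm := m)) [] (\<^bold>\<not> V vm \<^bold>< w_tm \<^bold>\<cdot> V ?j \<^bold>\<cdot> V vm)"
      then have "w \<cdot> j \<cdot> m \<sqsubseteq> m" by (simp add: e' eval_w num.not_less)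
      then show "sat ((e' j j)(vm := m \<oplus> \<one>)) [] (\<^bold>\<not> V vm \<^bold>< w_tm \<^bold>\<cdot> V ?j \<^bold>\<cdot> V vm)"
        using less_Suc_iff[of "w \<cdot> j \<cdot> m" m] by (simp add: e' eval_w num.not_less w_Suc num.less_imp_le)
    qed (simp_all add: w_tm e' eval_w w_zero)
    then show ?thesis by (simp add: e' eval_w num.not_less)
  qed
  \<comment> \<open>Vacuous while \<open>m < i\<close>. When \<open>m\<close> reaches
    \<open>i\<close>, either an earlier hit was kept or \<open>i\<close> itself is taken, and hits
    are never given up.\<close>
  have w_hit: "h \<cdot> j \<cdot> (w \<cdot> j \<cdot> m) \<noteq> \<zero>" if "i \<sqsubseteq> m" "h \<cdot> j \<cdot> i \<noteq> \<zero>" for i j m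
  proof -
    let ?A = "V vm \<^bold>< V vi \<^bold>\<or> \<^bold>\<not> V ?h \<^bold>\<cdot> V ?j \<^bold>\<cdot> (w_tm \<^bold>\<cdot> V ?j \<^bold>\<cdot> V vm) \<^bold>= Zero"
    have "sat ((e' j i)(vm := m)) [] ?A"
    proof (rule qf_induct)
      show "sat ((e' j i)(vm := \<zero>)) [] ?A"
        using that(2) zero_le[of i] by (auto simp: e' eval_w w_zero num.le_less)
    next
      fix m assume IH: "sat ((e' j i)(vm := m)) [] ?A"
      consider "m \<oplus> \<one> \<sqsubset> i" | "m \<oplus> \<one> = i" | "\<not> m \<sqsubset> i"
        using num.less_linear Suc_le_iff num.le_less by blast
      then show "sat ((e' j i)(vm := m \<oplus> \<one>)) [] ?A"
        using IH that(2) by cases (auto simp: e' eval_w w_Suc split: if_splits)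
    qed (simp_all add: w_tm e' eval_w)
    then show ?thesis using that(1) by (auto simp: e' eval_w num.not_less[symmetric])
  qed
  \<comment> \<open>Through \<open>w\<close> the bounded search up to \<open>m\<close> becomes a
    term. A hit once found remains, which makes \<open>C\<close> monotone in
    \<open>m\<close>.\<close>
  define C where "C = eval e [] (lam ?j (lam vm (sg (V ?h \<^bold>\<cdot> V ?j \<^bold>\<cdot> (w_tm \<^bold>\<cdot> V ?j \<^bold>\<cdot> V vm)))))"
  have C_in_D: "C \<in> D (T0 \<^bold>\<rightarrow> T0 \<^bold>\<rightarrow> T0)"
    unfolding C_def using e(1) by (rule eval_closed_in_D) (simp add: typ_of_lam w_tm sg_def)
  have C: "C \<cdot> j \<cdot> m = (if h \<cdot> j \<cdot> (w \<cdot> j \<cdot> m) = \<zero> then \<zero> else \<one>)" for j m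
    using e by (simp add: C_def eval_lam typ_of_lam w_tm sg_def one_monus eval_w e(2))
  have "\<exists>m. \<forall>j n. j \<sqsubseteq> b \<longrightarrow> C \<cdot> j \<cdot> n \<sqsubseteq> C \<cdot> j \<cdot> m"
  proof (rule stabilisation[OF C_in_D])
    show "C \<cdot> j \<cdot> m \<sqsubseteq> \<one>" for j m by (simp add: C zero_le)
    show "C \<cdot> j \<cdot> m \<sqsubseteq> C \<cdot> j \<cdot> n" if "m \<sqsubseteq> n" for j m n
      using w_hit[of "w \<cdot> j \<cdot> m" n j] w_le[of j m] that num.order_trans by (auto simp: C zero_le)
  qed
  then obtain m where m: "\<And>j n. j \<sqsubseteq> b \<Longrightarrow> C \<cdot> j \<cdot> n \<sqsubseteq> C \<cdot> j \<cdot> m" by blast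
  have "w \<cdot> j \<cdot> m \<sqsubseteq> m \<and> h \<cdot> j \<cdot> (w \<cdot> j \<cdot> m) \<noteq> \<zero>" if "j \<sqsubseteq> b" "h \<cdot> j \<cdot> i \<noteq> \<zero>" for j i
  proof
    \<comment> \<open>A hit at \<open>i\<close> makes \<open>C\<close> equal to one at stage
      \<open>i\<close>. The stable stage \<open>m\<close> must then have seen a hit as well, even if
      \<open>i\<close> lies beyond \<open>m\<close>.\<close>
    have "C \<cdot> j \<cdot> i = \<one>" using w_hit[of i i j] that(2) by (simp add: C)
    then have "C \<cdot> j \<cdot> m \<noteq> \<zero>" using m[OF that(1), of i] zero_less_one num.leD by metis
    then show "h \<cdot> j \<cdot> (w \<cdot> j \<cdot> m) \<noteq> \<zero>" by (auto simp: C)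
  qed (rule w_le)
  then show ?thesis by blast
qed

end

section \<open>Real numbers in a model\<close>

lemma lc_reals [simp]:
  "lc_tm 0 x \<Longrightarrow> lc_fm 0 (is_real x)"
  "lc_tm 0 x \<Longrightarrow> lc_tm 0 y \<Longrightarrow> lc_fm 0 (x =\<^sub>R y)"
  "lc_tm 0 x \<Longrightarrow> lc_tm 0 y \<Longrightarrow> lc_fm 0 (x <\<^sub>R y)"
  "lc_tm 0 x \<Longrightarrow> lc_tm 0 y \<Longrightarrow> lc_fm 0 (x \<le>\<^sub>R y)"
  "lc_tm k (real_of_rat q) \<longleftrightarrow> lc_tm k q"
  "lc_tm k 0\<^sub>R" "lc_tm k 1\<^sub>R"
  by (auto simp: is_real_def real_eq_def real_less_def real_le_def real_of_rat_def real_zero_def real_one_def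
      intro: lc_tm_mono)

lemma typ_of_reals [simp]:
  "typ_of [] x = Some T1 \<Longrightarrow> wf_fm [] (is_real x)"
  "typ_of [] x = Some T1 \<Longrightarrow> typ_of [] y = Some T1 \<Longrightarrow> wf_fm [] (x =\<^sub>R y)"
  "typ_of [] x = Some T1 \<Longrightarrow> typ_of [] y = Some T1 \<Longrightarrow> wf_fm [] (x <\<^sub>R y)"
  "typ_of [] x = Some T1 \<Longrightarrow> typ_of [] y = Some T1 \<Longrightarrow> wf_fm [] (x \<le>\<^sub>R y)"
  "typ_of E q = Some T0 \<Longrightarrow> typ_of E (real_of_rat q) = Some T1"
  "typ_of E 0\<^sub>R = Some T1" "typ_of E 1\<^sub>R = Some T1"
  by (auto simp: is_real_def real_eq_def real_less_def real_le_def real_of_rat_def real_zero_def real_one_def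
      typ_of_closed[where E = "_ # _"])

lemma real_plus_tm [simp]:
  "typ_of E real_plus_tm = Some (T1 \<^bold>\<rightarrow> T1 \<^bold>\<rightarrow> T1)" "lc_tm k real_plus_tm" "vars_tm real_plus_tm = {}"
proof -
  show ty: "typ_of E real_plus_tm = Some (T1 \<^bold>\<rightarrow> T1 \<^bold>\<rightarrow> T1)" for E by (simp add: real_plus_tm_def typ_of_lam)
  show "lc_tm k real_plus_tm" by (rule lc_tm_mono[OF typ_of_lc[OF ty], of "[]"]) simp_all
  show "vars_tm real_plus_tm = {}"
    by (auto simp: real_plus_tm_def vars_lam rat_plus_def rat_def pair_def pos_part_def neg_part_def
        denom_def denom_pred_def)
qed

lemma real_plus [simp]:
  "lc_tm k (x +\<^sub>R y) \<longleftrightarrow> lc_tm k x \<and> lc_tm k y"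
  "typ_of E x = Some T1 \<Longrightarrow> typ_of E y = Some T1 \<Longrightarrow> typ_of E (x +\<^sub>R y) = Some T1"
  by (simp_all add: real_plus_def)

lemma wf_STS_plus: "wf_fm [] STS_plus"
  by (simp add: STS_plus_def is_set_def extensional_on_reals_def sub_unit_interval_def all_in_def mem_def
      nonempty_def metric_def real_functional_on_def countably_compact_def sequence_in_def in_ball_def
      separable_def)

lemma wf_cocode0: "wf_fm [] cocode0"
  by (simp add: cocode0_def is_set_def extensional_on_reals_def sub_unit_interval_def all_in_def mem_def
      nonempty_def Defs.countable_def sequence_in_def)

context RCA0_omega_model
begin

definition isreal where "isreal x \<longleftrightarrow> (\<forall>a b. qless (qabs (qminus (x \<cdot> a) (x \<cdot> (a \<oplus> b)))) (half a))"
definition req (infix "\<approx>" 50)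
  where "x \<approx> y \<longleftrightarrow> (\<forall>a. \<not> qless (dhalf a) (qabs (qminus (x \<cdot> a) (y \<cdot> a))))"
definition rless (infix "\<prec>" 50) where "x \<prec> y \<longleftrightarrow> (\<exists>a. qless (qplus (x \<cdot> a) (dhalf a)) (y \<cdot> a))"
definition cst where "cst q = I (Pi_c T0 T0) \<cdot> q"

lemma cst_in_D [simp]: "cst q \<in> D T1"
  unfolding cst_def by (rule ap_in_D[where \<sigma> = T0]) (auto intro: I_in_D)

lemma cst_ap [simp]: "cst q \<cdot> a = q"
  by (simp add: cst_def Pi_ap)

lemma sat_reals [simp]:
  "lc_tm 0 x \<Longrightarrow> sat e [] (is_real x) \<longleftrightarrow> isreal (eval e [] x)"
  "lc_tm 0 x \<Longrightarrow> lc_tm 0 y \<Longrightarrow> sat e [] (x =\<^sub>R y) \<longleftrightarrow> eval e [] x \<approx> eval e [] y"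
  "lc_tm 0 x \<Longrightarrow> lc_tm 0 y \<Longrightarrow> sat e [] (x <\<^sub>R y) \<longleftrightarrow> eval e [] x \<prec> eval e [] y"
  "lc_tm 0 x \<Longrightarrow> lc_tm 0 y \<Longrightarrow> sat e [] (x \<le>\<^sub>R y) \<longleftrightarrow> \<not> eval e [] y \<prec> eval e [] x"
  "eval e bs (real_of_rat q) = cst (eval e bs q)"
  by (simp_all add: is_real_def isreal_def real_eq_def req_def real_less_def rless_def real_le_def eval_lc D_T0
      real_of_rat_def cst_def)

definition rplus where "rplus x y = cl real_plus_tm \<cdot> x \<cdot> y"

lemma eval_rplus [simp]: "eval e bs (x +\<^sub>R y) = rplus (eval e bs x) (eval e bs y)"
  by (simp add: real_plus_def rplus_def eval_closed)

lemma rplus_ap: "x \<in> D T1 \<Longrightarrow> y \<in> D T1 \<Longrightarrow> rplus x y \<cdot> a = qplus (x \<cdot> (a \<oplus> \<one>)) (y \<cdot> (a \<oplus> \<one>))"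
  by (simp add: rplus_def real_plus_tm_def cl_lam eval_lam typ_of_lam)

section \<open>The two principles read in a model\<close>

definition member (infix "\<in>\<in>" 50) where "x \<in>\<in> F \<longleftrightarrow> x \<in> D T1 \<and> isreal x \<and> F \<cdot> x = \<one>"

definition extens where "extens F \<longleftrightarrow>
  (\<forall>x\<in>D T1. \<forall>y\<in>D T1. isreal x \<longrightarrow> isreal y \<longrightarrow> x \<approx> y \<longrightarrow> F \<cdot> x = F \<cdot> y)"

definition unit_set where "unit_set F \<longleftrightarrow> extens F \<and> (\<forall>x\<in>D T1. isreal x \<longrightarrow> F \<cdot> x = \<zero> \<or> F \<cdot> x = \<one>) \<and>
  (\<forall>x. x \<in>\<in> F \<longrightarrow> \<not> x \<prec> cst (qrat \<zero> \<zero> \<zero>) \<and> \<not> cst (qrat \<one> \<zero> \<zero>) \<prec> x) \<and> (\<exists>x. x \<in>\<in> F)"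

definition is_metric where "is_metric M d \<longleftrightarrow>
  (\<forall>x y. x \<in>\<in> M \<longrightarrow> y \<in>\<in> M \<longrightarrow> isreal (d \<cdot> x \<cdot> y)) \<and>
  (\<forall>x y z u. x \<in>\<in> M \<longrightarrow> y \<in>\<in> M \<longrightarrow> z \<in>\<in> M \<longrightarrow> u \<in>\<in> M \<longrightarrow> x \<approx> z \<longrightarrow> y \<approx> u \<longrightarrow> d \<cdot> x \<cdot> y \<approx> d \<cdot> z \<cdot> u) \<and>
  (\<forall>x y z. x \<in>\<in> M \<longrightarrow> y \<in>\<in> M \<longrightarrow> z \<in>\<in> M \<longrightarrow>
    (d \<cdot> x \<cdot> y \<approx> cst (qrat \<zero> \<zero> \<zero>) \<longleftrightarrow> x \<approx> y) \<and>
    \<not> d \<cdot> x \<cdot> y \<prec> cst (qrat \<zero> \<zero> \<zero>) \<and> d \<cdot> x \<cdot> y \<approx> d \<cdot> y \<cdot> x \<and>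
    \<not> rplus (d \<cdot> x \<cdot> z) (d \<cdot> z \<cdot> y) \<prec> d \<cdot> x \<cdot> y)"

definition is_compact where "is_compact M d \<longleftrightarrow> (\<forall>a\<in>D (T0 \<^bold>\<rightarrow> T1). \<forall>r\<in>D T1.
  (\<forall>n. a \<cdot> n \<in>\<in> M) \<longrightarrow>
  (\<forall>y. y \<in>\<in> M \<longrightarrow> (\<exists>n. d \<cdot> (a \<cdot> n) \<cdot> y \<prec> cst (r \<cdot> n))) \<longrightarrow>
  (\<exists>m. \<forall>y. y \<in>\<in> M \<longrightarrow> (\<exists>n. n \<sqsubseteq> m \<and> d \<cdot> (a \<cdot> n) \<cdot> y \<prec> cst (r \<cdot> n))))"

definition is_separable where "is_separable M d \<longleftrightarrow> (\<exists>a\<in>D (T0 \<^bold>\<rightarrow> T1). (\<forall>n. a \<cdot> n \<in>\<in> M) \<and>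
  (\<forall>x. x \<in>\<in> M \<longrightarrow> (\<forall>k. \<exists>n. d \<cdot> x \<cdot> (a \<cdot> n) \<prec> cst (half k))))"

definition is_countable where "is_countable F \<longleftrightarrow> (\<exists>Y\<in>D (T1 \<^bold>\<rightarrow> T0). extens Y \<and>
  (\<forall>x y. x \<in>\<in> F \<longrightarrow> y \<in>\<in> F \<longrightarrow> Y \<cdot> x = Y \<cdot> y \<longrightarrow> x \<approx> y))"

lemma seq_in_D: "a \<in> D (T0 \<^bold>\<rightarrow> T1) \<Longrightarrow> a \<cdot> n \<in> D T1"
  by (rule ap_in_D[where \<sigma> = T0]) simp_all

lemma sat_all_in:
  assumes "snd v = T1" "v \<notin> vars_tm F" "lc_tm 0 F" "lc_fm 0 \<phi>"
  shows "sat e [] (all_in v F \<phi>) \<longleftrightarrow> (\<forall>x. x \<in>\<in> eval e [] F \<longrightarrow> sat (e(v := x)) [] \<phi>)"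
proof -
  have "eval (e(v := x)) [] F = eval e [] F" for x
    by (rule eval_cong) (use assms(2) in auto)
  with assms show ?thesis by (auto simp: all_in_def mem_def member_def)
qed

lemma sat_mem: "lc_tm 0 x \<Longrightarrow> eval e [] x \<in> D T1 \<Longrightarrow> sat e [] (x \<^bold>\<in> F) \<longleftrightarrow> eval e [] x \<in>\<in> eval e [] F"
  by (simp add: mem_def member_def)

lemma lc_sets:
  "lc_tm 0 x \<Longrightarrow> lc_tm 0 F \<Longrightarrow> lc_fm 0 (x \<^bold>\<in> F)"
  "lc_tm 0 F \<Longrightarrow> lc_fm 0 \<phi> \<Longrightarrow> lc_fm 0 (all_in v F \<phi>)"
  "lc_tm 0 F \<Longrightarrow> lc_fm 0 (extensional_on_reals F)"
  "lc_tm 0 F \<Longrightarrow> lc_fm 0 (is_set F)"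
  "lc_tm 0 F \<Longrightarrow> lc_fm 0 (sub_unit_interval F)"
  "lc_tm 0 F \<Longrightarrow> lc_fm 0 (nonempty F)"
  "lc_tm 0 F \<Longrightarrow> lc_fm 0 (Defs.countable F)"
  "lc_tm 0 a \<Longrightarrow> lc_tm 0 F \<Longrightarrow> lc_fm 0 (sequence_in a F)"
  by (simp_all add: mem_def all_in_def extensional_on_reals_def is_set_def sub_unit_interval_def nonempty_def
      Defs.countable_def sequence_in_def)

lemma lc_metric:
  "lc_tm 0 M \<Longrightarrow> lc_tm 0 d \<Longrightarrow> lc_tm 0 x \<Longrightarrow> lc_tm 0 y \<Longrightarrow> lc_tm 0 q \<Longrightarrow> lc_fm 0 (in_ball M d y x q)"
  "lc_tm 0 M \<Longrightarrow> lc_tm 0 d \<Longrightarrow> lc_fm 0 (metric M d)"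
  "lc_tm 0 M \<Longrightarrow> lc_tm 0 d \<Longrightarrow> lc_fm 0 (countably_compact M d)"
  "lc_tm 0 M \<Longrightarrow> lc_tm 0 d \<Longrightarrow> lc_fm 0 (separable M d)"
  by (simp_all add: metric_def real_functional_on_def countably_compact_def in_ball_def separable_def lc_sets)

lemma sat_unit_set:
  assumes w: "snd w = T1 \<^bold>\<rightarrow> T0"
  shows "sat e [] (is_set (V w)) \<longleftrightarrow>
      extens (e w) \<and> (\<forall>x\<in>D T1. isreal x \<longrightarrow> e w \<cdot> x = \<zero> \<or> e w \<cdot> x = \<one>)"
    and "sat e [] (sub_unit_interval (V w)) \<longleftrightarrow>
      (\<forall>x. x \<in>\<in> e w \<longrightarrow> \<not> x \<prec> cst (qrat \<zero> \<zero> \<zero>) \<and> \<not> cst (qrat \<one> \<zero> \<zero>) \<prec> x)"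
    and "sat e [] (nonempty (V w)) \<longleftrightarrow> (\<exists>x. x \<in>\<in> e w)"
proof -
  from w have [simp]: "w \<noteq> (n, T1)" "(n, T1) \<noteq> w" for n by auto
  show "sat e [] (sub_unit_interval (V w)) \<longleftrightarrow>
      (\<forall>x. x \<in>\<in> e w \<longrightarrow> \<not> x \<prec> cst (qrat \<zero> \<zero> \<zero>) \<and> \<not> cst (qrat \<one> \<zero> \<zero>) \<prec> x)"
    by (simp add: sub_unit_interval_def sat_all_in real_zero_def real_one_def)
  show "sat e [] (nonempty (V w)) \<longleftrightarrow> (\<exists>x. x \<in>\<in> e w)"
    by (auto simp: nonempty_def sat_mem lc_sets member_def)
  show "sat e [] (is_set (V w)) \<longleftrightarrow>
      extens (e w) \<and> (\<forall>x\<in>D T1. isreal x \<longrightarrow> e w \<cdot> x = \<zero> \<or> e w \<cdot> x = \<one>)"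
    by (auto simp: is_set_def extensional_on_reals_def extens_def)
qed

lemma sat_countable: "sat e [] (Defs.countable (V vA)) \<longleftrightarrow> is_countable (e vA)"
  by (auto simp: Defs.countable_def extensional_on_reals_def sat_all_in lc_sets is_countable_def extens_def)

lemma sat_metric: "sat e [] (metric (V vM) (V vd)) \<longleftrightarrow> is_metric (e vM) (e vd)"
  by (simp add: metric_def real_functional_on_def sat_all_in lc_sets is_metric_def real_zero_def imp_conjL)

lemma sat_countably_compact:
  "sat e [] (countably_compact (V vM) (V vd)) \<longleftrightarrow> is_compact (e vM) (e vd)"
  by (simp add: countably_compact_def sequence_in_def in_ball_def sat_all_in sat_mem lc_sets lc_metric
      is_compact_def D_T0 seq_in_D less_eq_def member_def[THEN iffD1] cong: conj_cong imp_cong)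

lemma sat_separable: "sat e [] (separable (V vM) (V vd)) \<longleftrightarrow> is_separable (e vM) (e vd)"
  by (simp add: separable_def sequence_in_def sat_all_in sat_mem lc_sets is_separable_def D_T0 seq_in_D
      cong: conj_cong)

lemma sat_STS_plus: "sat e [] STS_plus \<longleftrightarrow>
  (\<forall>M\<in>D (T1 \<^bold>\<rightarrow> T0). \<forall>d\<in>D (T1 \<^bold>\<rightarrow> T1 \<^bold>\<rightarrow> T1).
    unit_set M \<longrightarrow> is_metric M d \<longrightarrow> is_compact M d \<longrightarrow> is_separable M d)"
  by (simp add: sat_unit_set unit_set_def STS_plus_def lc_sets lc_metric sat_metric sat_countably_compact sat_separable imp_conjL)

lemma sat_cocode0: "sat e [] cocode0 \<longleftrightarrow> (\<forall>A\<in>D (T1 \<^bold>\<rightarrow> T0). unit_set A \<longrightarrow> is_countable A \<longrightarrow>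
  (\<exists>a\<in>D (T0 \<^bold>\<rightarrow> T1). (\<forall>n. a \<cdot> n \<in>\<in> A) \<and> (\<forall>x\<in>D T1. isreal x \<longrightarrow> (x \<in>\<in> A \<longleftrightarrow> (\<exists>n. a \<cdot> n \<approx> x)))))"
  by (simp add: sat_unit_set unit_set_def cocode0_def lc_sets sat_countable sequence_in_def sat_mem seq_in_D D_T0 imp_conjL
      cong: conj_cong)

section \<open>The metric of a countable set\<close>

lemma monus_eq_zero: "a \<ominus> b = \<zero> \<longleftrightarrow> a \<sqsubseteq> b"
proof
  assume *: "a \<ominus> b = \<zero>"
  show "a \<sqsubseteq> b"
  proof (rule num.leI, rule notI)
    assume "b \<sqsubset> a"
    then have "b \<oplus> (a \<ominus> b) = a" using plus_monus_inverse num.less_asym by blast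
    then show False using * \<open>b \<sqsubset> a\<close> plus_zero num.less_irrefl by metis
  qed
next
  assume "a \<sqsubseteq> b"
  then have "(b \<ominus> a) \<oplus> a = b" using plus_monus_inverse num.leD plus_commute by metis
  then show "a \<ominus> b = \<zero>" using monus_plus[of a "b \<ominus> a"] by simp
qed

lemma monus_monus_min: "a \<ominus> (a \<ominus> b) = num.min a b"
proof (cases "a \<sqsubseteq> b")
  case True
  then have "a \<ominus> b = \<zero>" by (simp add: monus_eq_zero)
  then show ?thesis using True by (simp add: num.min_def monus_zero)
next
  case False
  then have "b \<oplus> (a \<ominus> b) = a" using plus_monus_inverse num.not_le num.less_asym by blast
  then have "a \<ominus> (a \<ominus> b) = b" using plus_monus[of b "a \<ominus> b"] by simp
  then show ?thesis using False by (simp add: num.min_def)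
qed

lemma le_zero_iff: "a \<sqsubseteq> \<zero> \<longleftrightarrow> a = \<zero>"
  using num.order_antisym[OF _ zero_le] by auto

text \<open>The value at distinct codes \<open>j\<close>, \<open>k\<close> is \<open>1 / (min j k + 1)\<close>, where \<open>j0\<close> counts as infinity.\<close>

definition idist where "idist j0 j k =
  (if j = j0 then k else if k = j0 then j else num.min j k)"

definition qdist where "qdist j0 j k =
  (if j = k then qrat \<zero> \<zero> \<zero> else qrat \<one> \<zero> (idist j0 j k))"

lemma qdist_refl [simp]: "qdist j0 j j = qrat \<zero> \<zero> \<zero>"
  by (simp add: qdist_def)

lemma qdist_sym: "qdist j0 j k = qdist j0 k j"
  by (simp add: qdist_def idist_def num.min.commute)

lemma qneg_qdist [simp]: "qneg (qdist j0 j k) = \<zero>"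
  by (simp add: qdist_def)

text \<open>For the distances \<open>1 / (i + 1)\<close> this says that one of the two sides through
  \<open>l\<close> is nondegenerate and at least as long as the side from \<open>j\<close> to
  \<open>k\<close>. With infinity for \<open>j0\<close>, that side starts at the endpoint of smaller
  code, or is the side from \<open>j\<close> to \<open>k\<close> itself if \<open>l\<close> is an
  endpoint.\<close>

lemma idist_ultrametric:
  assumes "j \<noteq> k"
  shows "j \<noteq> l \<and> idist j0 j l \<sqsubseteq> idist j0 j k \<or> l \<noteq> k \<and> idist j0 l k \<sqsubseteq> idist j0 j k"
  using assms num.linear by (auto simp: idist_def num.min_def)

lemma exists_qdist:
  "\<exists>\<delta>\<in>D (T0 \<^bold>\<rightarrow> T0 \<^bold>\<rightarrow> T0). \<forall>j k. \<delta> \<cdot> j \<cdot> k = qdist j0 j k"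
proof -
  let ?j = "(''j'', T0)"
  define e where "e = env0(vi := j0)"
  have e: "env e" "e vi = j0" by (simp_all add: e_def)
  define eq where "eq s t = monus_tm \<^bold>\<cdot> One \<^bold>\<cdot> (monus_tm \<^bold>\<cdot> s \<^bold>\<cdot> t \<^bold>+ monus_tm \<^bold>\<cdot> t \<^bold>\<cdot> s)" for s t
  have eq: "eval e bs (eq s t) = (if eval e bs s = eval e bs t then \<one> else \<zero>)" for e bs s t
  proof -
    have "a \<ominus> b \<oplus> (b \<ominus> a) = \<zero> \<longleftrightarrow> a = b" for a b
      using num.add_nonneg_eq_0_iff[OF zero_le zero_le, of "a \<ominus> b" "b \<ominus> a"] num.order_antisym
      by (auto simp: monus_eq_zero)
    then show ?thesis by (simp add: eq_def one_monus)
  qed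
  define ne where "ne s t = monus_tm \<^bold>\<cdot> One \<^bold>\<cdot> eq s t" for s t
  have ne: "eval e bs (ne s t) = (if eval e bs s = eval e bs t then \<zero> else \<one>)" for e bs s t
    by (simp add: ne_def eq one_monus)
  define mn where "mn s t = monus_tm \<^bold>\<cdot> s \<^bold>\<cdot> (monus_tm \<^bold>\<cdot> s \<^bold>\<cdot> t)" for s t
  \<comment> \<open>Adding the other code to an occurrence of \<open>j0\<close> makes it large
    enough that the minimum returns the other code, as infinity would. The factors \<open>ne\<close>
    give the code of zero on the diagonal, where both additions may occur at once.\<close>
  define body where "body = rat (ne (V ?j) (V vk)) Zero (ne (V ?j) (V vk) \<^bold>*
    (mn (V ?j \<^bold>+ eq (V ?j) (V vi) \<^bold>* V vk) (V vk \<^bold>+ eq (V vk) (V vi) \<^bold>* V ?j)))"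
  have typ_body: "typ_of E body = Some T0" for E
    by (simp add: body_def ne_def mn_def eq_def)
  have eval_body: "eval e [] body = qdist (e vi) (e ?j) (e vk)" for e
    by (auto simp: body_def eq ne mn_def monus_monus_min qdist_def idist_def num.min_def zero_le le_zero_iff)
  have "eval e [] (lam ?j (lam vk body)) \<cdot> j \<cdot> k = qdist j0 j k" for j k
    using e by (simp add: eval_lam typ_of_lam typ_body eval_body)
  moreover have "eval e [] (lam ?j (lam vk body)) \<in> D (T0 \<^bold>\<rightarrow> T0 \<^bold>\<rightarrow> T0)"
    using e(1) by (rule eval_closed_in_D) (simp add: typ_of_lam typ_body)
  ultimately show ?thesis by blast
qed

section \<open>Comparison of rational constants\<close>

lemma qabs_sel [simp]:
  "qpos (qabs q) = (qpos q \<ominus> qneg q) \<oplus> (qneg q \<ominus> qpos q)" "qneg (qabs q) = \<zero>" "qden (qabs q) = qden q"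
  by (simp_all add: qabs_def) (simp add: qden_def)

lemma qminus_sel [simp]:
  "qpos (qminus q r) = qpos q \<otimes> qden r \<oplus> qneg r \<otimes> qden q"
  "qneg (qminus q r) = qneg q \<otimes> qden r \<oplus> qpos r \<otimes> qden q"
  "qden (qminus q r) = qden q \<otimes> qden r"
  by (simp_all add: qminus_def) (simp_all add: qden_def)

lemma qpos_qabs_minus_self: "qpos (qabs (qminus q q)) = \<zero>"
  by (simp add: plus_commute)

lemma isreal_cst: "isreal (cst q)"
  using qpos_qabs_minus_self[of q]
  by (simp add: isreal_def qless_def num.mult_pos_pos qden_pos del: qabs_sel(1))

lemma cst_approx_refl: "cst q \<approx> cst q"
  using qpos_qabs_minus_self[of q]
  by (simp add: req_def qless_def not_less_zero del: qabs_sel(1))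

lemma not_cst_less_zero: "qneg q = \<zero> \<Longrightarrow> \<not> cst q \<prec> cst (qrat \<zero> \<zero> c)"
  by (simp add: rless_def qless_def not_less_zero)

lemma cst_one_not_approx_zero: "\<not> cst (qrat \<one> \<zero> c) \<approx> cst (qrat \<zero> \<zero> \<zero>)"
proof -
  \<comment> \<open>At this precision \<open>2 / 2^a\<close> is below \<open>1 / (c + 1)\<close>,
    since \<open>2^a > a = 2 (c + 1)\<close>.\<close>
  let ?a = "(\<one> \<oplus> \<one>) \<otimes> (c \<oplus> \<one>)"
  have "qless (dhalf ?a) (qabs (qminus (qrat \<one> \<zero> c) (qrat \<zero> \<zero> \<zero>)))"
    using exp2_gt[of ?a] by (simp add: qless_def monus_zero zero_monus)
  then show ?thesis by (auto simp: req_def)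
qed

text \<open>If one summand alone is at least \<open>q3\<close> and the other is nonnegative, so is
  the sum. Both orders are recorded, as the ultrametric inequality does not say which side is the
  long one.\<close>

lemma not_cst_sum_less:
  assumes "qneg q1 = \<zero>" "qneg q2 = \<zero>" "qpos q3 \<otimes> qden q1 \<sqsubseteq> qpos q1 \<otimes> qden q3"
    "qneg q3 = \<zero>"
  shows "\<not> rplus (cst q1) (cst q2) \<prec> cst q3" "\<not> rplus (cst q2) (cst q1) \<prec> cst q3"
proof -
  let ?n1 = "qpos q1" and ?n2 = "qpos q2" and ?n3 = "qpos q3"
    and ?d1 = "qden q1" and ?d2 = "qden q2" and ?d3 = "qden q3"
  \<comment> \<open>Here \<open>E\<close> stands for \<open>2^a\<close> in the margin of the strict
    order of reals; the inequality is \<open>q3 \<le> q1 + q2 + 2 / E\<close> with denominators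
    cleared.\<close>
  have *: "?n3 \<otimes> (?d1 \<otimes> ?d2 \<otimes> E) \<sqsubseteq> ((?n1 \<otimes> ?d2 \<oplus> ?n2 \<otimes> ?d1) \<otimes> E \<oplus> (\<one> \<oplus> \<one>) \<otimes> (?d1 \<otimes> ?d2)) \<otimes> ?d3" for E
  proof -
    have "?n3 \<otimes> ?d1 \<otimes> (?d2 \<otimes> E) \<sqsubseteq> ?n1 \<otimes> ?d3 \<otimes> (?d2 \<otimes> E)"
      by (rule num.mult_right_mono) (simp_all add: assms zero_le)
    also have "\<dots> \<sqsubseteq> ?n1 \<otimes> ?d3 \<otimes> (?d2 \<otimes> E) \<oplus>
        (?n2 \<otimes> ?d1 \<otimes> E \<otimes> ?d3 \<oplus> (\<one> \<oplus> \<one>) \<otimes> (?d1 \<otimes> ?d2) \<otimes> ?d3)"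
      by (simp add: zero_le)
    finally show ?thesis by (simp add: algebra_simps)
  qed
  show "\<not> rplus (cst q1) (cst q2) \<prec> cst q3"
    using * by (simp add: rless_def rplus_ap qless_def assms num.not_less)
  have "(?n2 \<otimes> ?d1 \<oplus> ?n1 \<otimes> ?d2) = (?n1 \<otimes> ?d2 \<oplus> ?n2 \<otimes> ?d1)" "?d2 \<otimes> ?d1 = ?d1 \<otimes> ?d2"
    by (simp_all add: plus_commute times_commute)
  then show "\<not> rplus (cst q2) (cst q1) \<prec> cst q3"
    using * by (simp add: rless_def rplus_ap qless_def assms num.not_less)
qed

lemma qdist_triangle: "\<not> rplus (cst (qdist j0 j l)) (cst (qdist j0 l k)) \<prec> cst (qdist j0 j k)"
proof (cases "j = k")
  case True
  then show ?thesis by (simp add: rless_def rplus_ap qless_def not_less_zero)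
next
  case False
  from idist_ultrametric[OF this, of l j0] show ?thesis
    by (elim disjE; intro not_cst_sum_less) (use False in \<open>auto simp: qdist_def\<close>)
qed

text \<open>The distance depends on codes only. Extensionality of \<open>Y\<close> makes it respect
  equality of reals, and injectivity of \<open>Y\<close> makes distinct members lie apart.\<close>

lemma metric_qdist:
  assumes Y: "extens Y" "\<And>x y. x \<in>\<in> A \<Longrightarrow> y \<in>\<in> A \<Longrightarrow> Y \<cdot> x = Y \<cdot> y \<Longrightarrow> x \<approx> y"
    and d: "\<And>x y. x \<in> D T1 \<Longrightarrow> y \<in> D T1 \<Longrightarrow> d \<cdot> x \<cdot> y = cst (qdist j0 (Y \<cdot> x) (Y \<cdot> y))"
  shows "is_metric A d"
proof -
  have D: "x \<in> D T1" if "x \<in>\<in> A" for x using that by (simp add: member_def)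
  have ext: "Y \<cdot> x = Y \<cdot> y" if "x \<in>\<in> A" "y \<in>\<in> A" "x \<approx> y" for x y
    using Y(1) that unfolding extens_def member_def by blast
  have zero: "cst (qdist j0 (Y \<cdot> x) (Y \<cdot> y)) \<approx> cst (qrat \<zero> \<zero> \<zero>) \<longleftrightarrow> x \<approx> y"
    if "x \<in>\<in> A" "y \<in>\<in> A" for x y
  proof (cases "Y \<cdot> x = Y \<cdot> y")
    case True
    then show ?thesis using Y(2)[OF that] by (simp add: cst_approx_refl)
  next
    case False
    then show ?thesis using ext[OF that] cst_one_not_approx_zero by (auto simp: qdist_def)
  qed
  show ?thesis unfolding is_metric_def
    using ext zero
    by (simp add: d D isreal_cst cst_approx_refl not_cst_less_zero qdist_triangle)
       (metis cst_approx_refl qdist_sym)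
qed

text \<open>A member whose code differs from that of \<open>x0\<close> has distance at least
  \<open>1 / (Y x + 1)\<close> from every member with another code, so a dense sequence has to hit
  it. Only \<open>x0\<close> may be approached without being hit.\<close>

lemma separable_qdist:
  assumes Y: "\<And>x y. x \<in>\<in> A \<Longrightarrow> y \<in>\<in> A \<Longrightarrow> Y \<cdot> x = Y \<cdot> y \<Longrightarrow> x \<approx> y" and x0: "x0 \<in>\<in> A"
    and d: "\<And>x y. x \<in> D T1 \<Longrightarrow> y \<in> D T1 \<Longrightarrow> d \<cdot> x \<cdot> y = cst (qdist (Y \<cdot> x0) (Y \<cdot> x) (Y \<cdot> y))"
    and sep: "is_separable A d"
  shows "\<exists>a\<in>D (T0 \<^bold>\<rightarrow> T1). (\<forall>n. a \<cdot> n \<in>\<in> A) \<and> (\<forall>x. x \<in>\<in> A \<longrightarrow> (\<exists>n. a \<cdot> n \<approx> x))"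
proof -
  obtain a where a: "a \<in> D (T0 \<^bold>\<rightarrow> T1)" "\<And>n. a \<cdot> n \<in>\<in> A"
    and dense: "\<And>x k. x \<in>\<in> A \<Longrightarrow> \<exists>n. d \<cdot> x \<cdot> (a \<cdot> n) \<prec> cst (half k)"
    using sep unfolding is_separable_def by blast
  have D: "x \<in> D T1" if "x \<in>\<in> A" for x using that by (simp add: member_def)
  have hit: "\<exists>n. a \<cdot> n \<approx> x" if x: "x \<in>\<in> A" and ne: "Y \<cdot> x \<noteq> Y \<cdot> x0" for x
  proof -
    \<comment> \<open>Chosen so that \<open>2^k > Y x + 1\<close>: a term within
      \<open>2^(-k)\<close> of \<open>x\<close> then has the same code as \<open>x\<close>.\<close>
    let ?k = "Y \<cdot> x \<oplus> \<one>"
    obtain n t where "qless (qplus (qdist (Y \<cdot> x0) (Y \<cdot> x) (Y \<cdot> (a \<cdot> n))) (dhalf t)) (half ?k)"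
      using dense[OF x, of ?k] a x by (auto simp: d D rless_def)
    moreover have "\<not> qless (qplus (qrat \<one> \<zero> c) (dhalf t)) (half ?k)" if "c \<sqsubseteq> Y \<cdot> x" for c
    proof -
      have "(c \<oplus> \<one>) \<otimes> exp2 t \<sqsubseteq> exp2 ?k \<otimes> exp2 t"
        by (rule num.mult_right_mono, rule num.order_trans[OF _ num.less_imp_le[OF exp2_gt]])
          (simp_all add: that zero_le)
      also have "\<dots> \<sqsubseteq> exp2 ?k \<otimes> exp2 t \<oplus> (\<one> \<oplus> \<one>) \<otimes> (c \<oplus> \<one>) \<otimes> exp2 ?k"
        by (simp add: zero_le)
      finally show ?thesis by (simp add: qless_def num.not_less algebra_simps)
    qed
    ultimately have "Y \<cdot> x = Y \<cdot> (a \<cdot> n)"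
      using ne by (auto simp: qdist_def idist_def split: if_splits)
    then show ?thesis using Y a(2) x by metis
  qed
  let ?x = "(''x'', T1)"
  define e where "e = env0(va := a, ?x := x0)"
  have e: "env e" "e va = a" "e ?x = x0" using a(1) D[OF x0] by (simp_all add: e_def)
  \<comment> \<open>Prepends \<open>x0\<close> to the sequence. The factors \<open>1 - n\<close> and
    \<open>1 - (1 - n)\<close>, with truncated subtraction, are the tests for \<open>n = 0\<close>
    and for its negation.\<close>
  define body where "body = monus_tm \<^bold>\<cdot> One \<^bold>\<cdot> V vn \<^bold>* (V ?x \<^bold>\<cdot> V vm) \<^bold>+
    monus_tm \<^bold>\<cdot> One \<^bold>\<cdot> (monus_tm \<^bold>\<cdot> One \<^bold>\<cdot> V vn) \<^bold>* (V va \<^bold>\<cdot> (pred_tm \<^bold>\<cdot> V vn) \<^bold>\<cdot> V vm)"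
  define b where "b = eval e [] (lam vn (lam vm body))"
  have typ_body: "typ_of E body = Some T0" for E by (simp add: body_def)
  have b: "b \<in> D (T0 \<^bold>\<rightarrow> T1)"
    unfolding b_def using e(1) by (rule eval_closed_in_D) (simp add: typ_of_lam typ_body)
  have b_ap: "b \<cdot> n \<cdot> m = (if n = \<zero> then x0 \<cdot> m else a \<cdot> pred n \<cdot> m)" for n m
    using e by (simp add: b_def eval_lam typ_of_lam typ_body) (simp add: body_def one_monus)
  \<comment> \<open>Extensionality at type 1 upgrades agreement of values to identity, so that
    membership in \<open>A\<close> carries over.\<close>
  have "b \<cdot> n = (if n = \<zero> then x0 else a \<cdot> pred n)" for n
    by (rule ext[of _ T0 T0]) (use b a D x0 in \<open>auto simp: b_ap seq_in_D\<close>)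
  note b_ap = this
  have "\<exists>n. b \<cdot> n \<approx> x" if x: "x \<in>\<in> A" for x
  proof (cases "Y \<cdot> x = Y \<cdot> x0")
    case True
    then have "b \<cdot> \<zero> \<approx> x" using Y x x0 by (simp add: b_ap)
    then show ?thesis by blast
  next
    case False
    from hit[OF x this] obtain n where "a \<cdot> n \<approx> x" by blast
    moreover have "n \<oplus> \<one> \<noteq> \<zero>" using less_Suc not_less_zero by metis
    ultimately have "b \<cdot> (n \<oplus> \<one>) \<approx> x" by (simp add: b_ap pred_Suc)
    then show ?thesis by blast
  qed
  moreover have "b \<cdot> n \<in>\<in> A" for n by (simp add: b_ap a(2) x0)
  ultimately show ?thesis using b by blast
qed

text \<open>As \<open>q\<close> is nonnegative, the hypothesis forces \<open>2 / 2^t < r\<close>. At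
  precision \<open>t + 1\<close> the margin is only \<open>1 / 2^t\<close>, and the half that is
  freed pays for \<open>1 / (j + 1)\<close> as soon as \<open>2^t \<le> j\<close>.\<close>

lemma qless_plus_dhalf:
  assumes "qneg q = \<zero>" "qless (qplus q (dhalf t)) r"
  shows "qless (qplus (qrat \<zero> \<zero> c) (dhalf t)) r"
    and "exp2 t \<sqsubseteq> j \<Longrightarrow> qless (qplus (qrat \<one> \<zero> j) (dhalf (t \<oplus> \<one>))) r"
proof -
  let ?E = "exp2 t" and ?p = "qpos q" and ?d = "qden q" and ?P = "qpos r" and ?M = "qneg r" and ?R = "qden r"
    and ?two = "\<one> \<oplus> \<one>"
  have "(?p \<otimes> ?E \<oplus> ?two \<otimes> ?d) \<otimes> ?R \<oplus> ?M \<otimes> (?d \<otimes> ?E) \<sqsubset> ?P \<otimes> (?d \<otimes> ?E)"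
    using assms by (simp add: qless_def)
  moreover have "?d \<otimes> (?two \<otimes> ?R \<oplus> ?M \<otimes> ?E) \<sqsubseteq> (?p \<otimes> ?E \<oplus> ?two \<otimes> ?d) \<otimes> ?R \<oplus> ?M \<otimes> (?d \<otimes> ?E)"
  proof -
    have "?d \<otimes> (?two \<otimes> ?R \<oplus> ?M \<otimes> ?E) \<sqsubseteq> ?d \<otimes> (?two \<otimes> ?R \<oplus> ?M \<otimes> ?E) \<oplus> ?p \<otimes> ?E \<otimes> ?R" by (simp add: zero_le)
    then show ?thesis by (simp add: algebra_simps)
  qed
  ultimately have "?d \<otimes> (?two \<otimes> ?R \<oplus> ?M \<otimes> ?E) \<sqsubset> ?P \<otimes> (?d \<otimes> ?E)"
    by (rule num.le_less_trans[rotated])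
  then have "?d \<otimes> (?two \<otimes> ?R \<oplus> ?M \<otimes> ?E) \<sqsubset> ?d \<otimes> (?P \<otimes> ?E)" by (simp only: num.mult.left_commute)
  \<comment> \<open>The contribution of \<open>q\<close> has been dropped and its positive
    denominator is cancelled, which leaves \<open>2 / 2^t < r\<close>.\<close>
  then have *: "?two \<otimes> ?R \<oplus> ?M \<otimes> ?E \<sqsubset> ?P \<otimes> ?E"
    using num.mult_left_less_imp_less zero_le by blast
  have scaled: "(c \<oplus> \<one>) \<otimes> (?two \<otimes> ?R \<oplus> ?M \<otimes> ?E) \<sqsubset> (c \<oplus> \<one>) \<otimes> (?P \<otimes> ?E)" for c
    by (rule num.mult_strict_left_mono[OF *]) (simp add: less_Suc_iff zero_le)
  show "qless (qplus (qrat \<zero> \<zero> c) (dhalf t)) r"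
    using scaled[of c] by (simp add: qless_def algebra_simps)
  show "qless (qplus (qrat \<one> \<zero> j) (dhalf (t \<oplus> \<one>))) r" if j: "?E \<sqsubseteq> j"
  proof -
    let ?j = "j \<oplus> \<one>"
    have "?E \<sqsubseteq> ?j" using j less_Suc num.le_less_trans num.less_imp_le by blast
    then have "(?E \<oplus> ?E \<oplus> ?two \<otimes> ?j) \<otimes> ?R \<sqsubseteq> (?j \<oplus> ?j \<oplus> ?two \<otimes> ?j) \<otimes> ?R"
      by (intro num.mult_right_mono num.add_mono) (simp_all add: zero_le)
    then have "(?E \<oplus> ?E \<oplus> ?two \<otimes> ?j) \<otimes> ?R \<oplus> ?M \<otimes> (?j \<otimes> (?E \<oplus> ?E)) \<sqsubseteq>
        (?j \<oplus> ?j \<oplus> ?two \<otimes> ?j) \<otimes> ?R \<oplus> ?M \<otimes> (?j \<otimes> (?E \<oplus> ?E))"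
      by (rule num.add_right_mono)
    also have "\<dots> = ?two \<otimes> (?j \<otimes> (?two \<otimes> ?R \<oplus> ?M \<otimes> ?E))"
      by (simp only: num.distrib_left num.distrib_right num.mult_1 num.mult_1_right num.add_ac num.mult_ac)
    also have "\<dots> \<sqsubset> ?two \<otimes> (?j \<otimes> (?P \<otimes> ?E))"
      by (rule num.mult_strict_left_mono[OF scaled]) (simp add: less_Suc_iff zero_le)
    also have "\<dots> = ?P \<otimes> (?j \<otimes> (?E \<oplus> ?E))"
      by (simp only: num.distrib_left num.distrib_right num.mult_1 num.mult_1_right num.add_ac num.mult_ac)
    finally show ?thesis by (simp add: qless_def exp2_Suc)
  qed
qed

text \<open>Around \<open>x0\<close> the distances \<open>1 / (j + 1)\<close> fall below any margin.
  Around another centre, every code \<open>j \<ge> p\<close> other than \<open>p\<close> is exactly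
  as far away as \<open>x0\<close>, and \<open>p\<close> itself is at distance zero.\<close>

lemma qdist_ball_cofinite:
  assumes "qless (qplus (qdist j0 p j0) (dhalf t)) r"
  shows "\<exists>b. \<forall>j. b \<sqsubseteq> j \<longrightarrow> (\<exists>k. qless (qplus (qdist j0 p j) (dhalf k)) r)"
proof (cases "p = j0")
  case True
  then have "qless (qplus (qrat \<zero> \<zero> \<zero>) (dhalf t)) r" using assms by simp
  note far = qless_plus_dhalf[OF _ this]
  have "\<exists>k. qless (qplus (qdist j0 p j) (dhalf k)) r" if "exp2 t \<sqsubseteq> j" for j
    using far(1)[of \<zero>] far(2)[OF _ that] True by (auto simp: qdist_def idist_def)
  then show ?thesis by blast
next
  case False
  have "qless (qplus (qdist j0 p j) (dhalf t)) r" if "p \<sqsubseteq> j" for j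
  proof (cases "j = p")
    case True
    then show ?thesis using qless_plus_dhalf(1)[OF _ assms] by simp
  next
    case False
    then have "qdist j0 p j = qdist j0 p j0"
      using \<open>p \<noteq> j0\<close> that by (auto simp: qdist_def idist_def num.min_def)
    then show ?thesis using assms by simp
  qed
  then show ?thesis by blast
qed

lemma compact_qdist:
  assumes Y: "Y \<in> D (T1 \<^bold>\<rightarrow> T0)" and x0: "x0 \<in>\<in> A"
    and d: "\<And>x y. x \<in> D T1 \<Longrightarrow> y \<in> D T1 \<Longrightarrow> d \<cdot> x \<cdot> y = cst (qdist (Y \<cdot> x0) (Y \<cdot> x) (Y \<cdot> y))"
  shows "is_compact A d"
  unfolding is_compact_def
proof (intro ballI impI)
  fix a r
  assume a: "a \<in> D (T0 \<^bold>\<rightarrow> T1)" "\<forall>n. a \<cdot> n \<in>\<in> A" and r: "r \<in> D T1"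
    and cover: "\<forall>y. y \<in>\<in> A \<longrightarrow> (\<exists>n. d \<cdot> (a \<cdot> n) \<cdot> y \<prec> cst (r \<cdot> n))"
  let ?j0 = "Y \<cdot> x0"
  \<comment> \<open>\<open>R\<close> compares rationals only, with \<open>k\<close> the precision
    that witnesses a strict inequality between reals. The point enters through its code
    \<open>j\<close>, so the quantifier over reals is gone.\<close>
  define R where "R j n k \<longleftrightarrow> qless (qplus (qdist ?j0 (Y \<cdot> (a \<cdot> n)) j) (dhalf k)) (r \<cdot> n)" for j n k
  have ball: "d \<cdot> (a \<cdot> n) \<cdot> y \<prec> cst (r \<cdot> n) \<longleftrightarrow> (\<exists>k. R (Y \<cdot> y) n k)" if "y \<in>\<in> A" for n y
    using that a(1) by (simp add: d seq_in_D member_def rless_def R_def)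
  have "\<exists>h\<in>D (T0 \<^bold>\<rightarrow> T0 \<^bold>\<rightarrow> T0). \<forall>j i. h \<cdot> j \<cdot> i \<noteq> \<zero> \<longleftrightarrow> R j (proj1 i) (proj2 i)"
  proof -
    obtain \<delta> where \<delta>: "\<delta> \<in> D (T0 \<^bold>\<rightarrow> T0 \<^bold>\<rightarrow> T0)" "\<And>j k. \<delta> \<cdot> j \<cdot> k = qdist ?j0 j k"
      using exists_qdist by blast
    let ?d = "(''d'', T0 \<^bold>\<rightarrow> T0 \<^bold>\<rightarrow> T0)" and ?j = "(''j'', T0)"
    define e where "e = env0(?d := \<delta>, va := a, vr := r, vY := Y)"
    have e: "env e" "e ?d = \<delta>" "e va = a" "e vr = r" "e vY = Y"
      using a(1) r Y \<delta>(1) by (simp_all add: e_def)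
    define n where "n = fst_tm \<^bold>\<cdot> V vi"
    define q where "q = V ?d \<^bold>\<cdot> (V vY \<^bold>\<cdot> (V va \<^bold>\<cdot> n)) \<^bold>\<cdot> V ?j +\<^sub>Q double_half_pow (snd_tm \<^bold>\<cdot> V vi)"
    define q' where "q' = V vr \<^bold>\<cdot> n"
    \<comment> \<open>The truncated difference of the two sides of the cross-multiplied inequality:
      nonzero exactly when the strict inequality holds.\<close>
    define body where "body = monus_tm \<^bold>\<cdot> (pos_part q' \<^bold>* denom q \<^bold>+ neg_part q \<^bold>* denom q')
      \<^bold>\<cdot> (pos_part q \<^bold>* denom q' \<^bold>+ neg_part q' \<^bold>* denom q)"
    have typ_body: "typ_of E body = Some T0" for E
      by (simp add: body_def q_def q'_def n_def)
    have eval_body: "eval (e(?j := j, vi := i)) [] body \<noteq> \<zero> \<longleftrightarrow> R j (proj1 i) (proj2 i)" for j i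
      using e \<delta>(2) by (simp add: body_def q_def q'_def n_def monus_eq_zero num.not_le R_def qless_def)
    have "eval e [] (lam ?j (lam vi body)) \<in> D (T0 \<^bold>\<rightarrow> T0 \<^bold>\<rightarrow> T0)"
      using e(1) by (rule eval_closed_in_D) (simp add: typ_of_lam typ_body)
    moreover have "eval e [] (lam ?j (lam vi body)) \<cdot> j \<cdot> i \<noteq> \<zero> \<longleftrightarrow> R j (proj1 i) (proj2 i)" for j i
      using e(1) by (simp add: eval_lam typ_of_lam typ_body eval_body)
    ultimately show ?thesis by blast
  qed
  then obtain h where h: "h \<in> D (T0 \<^bold>\<rightarrow> T0 \<^bold>\<rightarrow> T0)"
    "\<And>j i. h \<cdot> j \<cdot> i \<noteq> \<zero> \<longleftrightarrow> R j (proj1 i) (proj2 i)" by blast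
  \<comment> \<open>The ball that covers \<open>x0\<close> disposes of all codes from some
    \<open>b\<close> on.\<close>
  obtain N t where "R ?j0 N t" using cover ball x0 by blast
  then obtain b where b: "\<And>j. b \<sqsubseteq> j \<Longrightarrow> \<exists>k. R j N k"
    using qdist_ball_cofinite[of ?j0 "Y \<cdot> (a \<cdot> N)" t "r \<cdot> N"] unfolding R_def by blast
  \<comment> \<open>Some \<open>j \<le> b\<close> may be the code of no member and lie in no ball.
    Strong bounding demands nothing of them; for the codes of members the cover provides a
    hit.\<close>
  obtain m where m: "\<And>j i. j \<sqsubseteq> b \<Longrightarrow> h \<cdot> j \<cdot> i \<noteq> \<zero> \<Longrightarrow> \<exists>i'. i' \<sqsubseteq> m \<and> h \<cdot> j \<cdot> i' \<noteq> \<zero>"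
    using strong_bounding[OF h(1), of b] by blast
  have "\<exists>n. n \<sqsubseteq> num.max N m \<and> d \<cdot> (a \<cdot> n) \<cdot> y \<prec> cst (r \<cdot> n)" if y: "y \<in>\<in> A" for y
  proof (cases "Y \<cdot> y \<sqsubseteq> b")
    case True
    obtain n k where "R (Y \<cdot> y) n k" using cover ball y by blast
    then have "h \<cdot> (Y \<cdot> y) \<cdot> pairing n k \<noteq> \<zero>" by (simp add: h(2))
    from m[OF True this] obtain i where i: "i \<sqsubseteq> m" "R (Y \<cdot> y) (proj1 i) (proj2 i)" unfolding h(2) by blast
    then have "proj1 i \<sqsubseteq> num.max N m" using proj1_le num.order_trans num.max.cobounded2 by metis
    then show ?thesis using i(2) ball[OF y] by blast
  next
    case False
    then have "b \<sqsubseteq> Y \<cdot> y" using num.linear by blast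
    then show ?thesis using b ball[OF y] num.max.cobounded1 by blast
  qed
  then show "\<exists>m. \<forall>y. y \<in>\<in> A \<longrightarrow> (\<exists>n. n \<sqsubseteq> m \<and> d \<cdot> (a \<cdot> n) \<cdot> y \<prec> cst (r \<cdot> n))" by blast
qed

lemma STS_plus_imp_cocode0:
  assumes "sat e [] STS_plus" shows "sat e [] cocode0"
  unfolding sat_cocode0
proof (intro ballI impI)
  fix A assume A: "A \<in> D (T1 \<^bold>\<rightarrow> T0)" "unit_set A" and "is_countable A"
  then obtain Y where Y: "Y \<in> D (T1 \<^bold>\<rightarrow> T0)" "extens Y"
    "\<And>x y. x \<in>\<in> A \<Longrightarrow> y \<in>\<in> A \<Longrightarrow> Y \<cdot> x = Y \<cdot> y \<Longrightarrow> x \<approx> y"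
    unfolding is_countable_def by blast
  obtain x0 where x0: "x0 \<in>\<in> A" using A(2) unfolding unit_set_def by blast
  obtain \<delta> where \<delta>: "\<delta> \<in> D (T0 \<^bold>\<rightarrow> T0 \<^bold>\<rightarrow> T0)" "\<And>j k. \<delta> \<cdot> j \<cdot> k = qdist (Y \<cdot> x0) j k"
    using exists_qdist by blast
  let ?d = "(''d'', T0 \<^bold>\<rightarrow> T0 \<^bold>\<rightarrow> T0)"
  define e' where "e' = env0(?d := \<delta>, vY := Y)"
  have e': "env e'" "e' ?d = \<delta>" "e' vY = Y" using \<delta>(1) Y(1) by (simp_all add: e'_def)
  \<comment> \<open>Written as a term in \<open>Y\<close> and the distance of codes, the metric is
    an element of the model, as is required to apply the principle to it.\<close>
  define d_tm where "d_tm = lam vx (lam vy (real_of_rat (V ?d \<^bold>\<cdot> (V vY \<^bold>\<cdot> V vx) \<^bold>\<cdot> (V vY \<^bold>\<cdot> V vy))))"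
  define d where "d = eval e' [] d_tm"
  have d_in_D: "d \<in> D (T1 \<^bold>\<rightarrow> T1 \<^bold>\<rightarrow> T1)"
    unfolding d_def using e'(1) by (rule eval_closed_in_D) (simp add: d_tm_def typ_of_lam)
  have d: "d \<cdot> x \<cdot> y = cst (qdist (Y \<cdot> x0) (Y \<cdot> x) (Y \<cdot> y))" if "x \<in> D T1" "y \<in> D T1" for x y
    using e' that by (simp add: d_def d_tm_def eval_lam typ_of_lam \<delta>(2))
  have "is_metric A d" by (rule metric_qdist[OF Y(2,3) d])
  moreover have "is_compact A d" by (rule compact_qdist[OF Y(1) x0 d])
  ultimately have "is_separable A d" using assms A d_in_D unfolding sat_STS_plus by blast
  from separable_qdist[OF Y(3) x0 d this] obtain a where
    a: "a \<in> D (T0 \<^bold>\<rightarrow> T1)" "\<And>n. a \<cdot> n \<in>\<in> A" "\<And>x. x \<in>\<in> A \<Longrightarrow> \<exists>n. a \<cdot> n \<approx> x" by blast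
  \<comment> \<open>The converse half of the enumeration: the characteristic function of
    \<open>A\<close> is extensional, so reals equal to a term of the sequence are members.\<close>
  have "x \<in>\<in> A" if "x \<in> D T1" "isreal x" "a \<cdot> n \<approx> x" for x n
    using A(2) a(2)[of n] that unfolding unit_set_def extens_def member_def by metis
  then show "\<exists>a\<in>D (T0 \<^bold>\<rightarrow> T1). (\<forall>n. a \<cdot> n \<in>\<in> A) \<and>
      (\<forall>x\<in>D T1. isreal x \<longrightarrow> (x \<in>\<in> A \<longleftrightarrow> (\<exists>n. a \<cdot> n \<approx> x)))"
    using a by blast
qed

end

theorem theorem3p21:
  shows "RCA0_omega \<turnstile> (STS_plus \<^bold>\<longrightarrow> cocode0)"
proof (rule RCA0_omega_complete)
  fix D :: "ty \<Rightarrow> nat set" and ap I lt e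
  assume "RCA0_omega_model D ap I lt"
  then interpret RCA0_omega_model D ap I lt .
  show "sat e [] (STS_plus \<^bold>\<longrightarrow> cocode0)" using STS_plus_imp_cocode0 by simp
qed (simp add: wf_STS_plus wf_cocode0)

end
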